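(* Let $\varphi\in L^2(K)$ be a refinable function generating a multiresolution analysis, with refinement mask $m_0$, let $m_1,\dots,m_N$ be framelet masks, where $m_0,m_1,\dots,m_N$ are Walsh polynomials, and let $\hat\varphi(\xi)=m_0(\mathfrak p\xi)\hat\varphi(\mathfrak p\xi)$, $\hat\psi_n(\xi)=m_n(\mathfrak p\xi)\hat\varphi(\mathfrak p\xi)$ for $1\le n\le N$. Suppose that for every $k\in\{1,\dots,q-1\}$ the $(N+1)\times2$ matrix $\mathbf M(\xi)$ with rows $\big(m_n(\xi),\,m_n(\xi+\mathfrak pu(k))\big)$, $n=0,1,\dots,N$, satisfies $\mathbf M(\xi)^*\mathbf M(\xi)=I_2$, and that the wavelet system $\mathcal F(\Psi)$ generated by $\Psi=\{\psi_1,\dots,\psi_N\}$ is a normalized (Parseval) wavelet frame for $L^2(K)$. Let $A(\xi)$ be an $L\times L$ paraunitary matrix with integral periodic entries $a_{\ell,r}(\xi)$, and let $A_r(\xi)$ denote its $r$th column. For $r=1,\dots,L$ define new wavelet masks by $$\big(\eta_{n,1}^r(\xi),\dots,\eta_{n,L}^r(\xi)\big)^T=A_r(\xi)\,m_n(\xi),\qquad1\le n\le N,$$ that is, $\eta_{n,\ell}^r(\xi)=a_{\ell,r}(\xi)m_n(\xi)$. Then, for $r=1,2,\dots,L$, the wavelet systems $\mathcal F(\Psi^r)$ generated by $\Psi^r=\{\psi_{n,\ell}^r:1\le n\le N,\,1\le\ell\le L\}$, where $\hat\psi_{n,\ell}^r(\mathfrak p^{-1}\xi)=\eta_{n,\ell}^r(\xi)\hat\varphi(\xi)$,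 are tight wavelet frames for $L^2(K)$ and are pairwise orthogonal.
   Context: $K$ is a local field (locally compact, non-discrete, totally disconnected) of positive characteristic $p$, with ring of integers $\mathfrak D=\{|x|\le1\}$, prime ideal $\mathfrak B=\{|x|<1\}$, a fixed prime element $\mathfrak p$ (so $\mathfrak B=\mathfrak p\mathfrak D$), and residue field $\mathfrak D/\mathfrak B\cong GF(q)$, $q=p^c$; $|\mathfrak p|=q^{-1}$, and Haar measure $dx$ on $K^+$ is normalized so that $\mathfrak D$ has measure 1. Fix $1=\zeta_0,\zeta_1,\dots,\zeta_{c-1}\in\mathfrak D\setminus\mathfrak B$ spanning over $GF(p)$ a copy of $GF(q)$ in $K$. Let $\chi$ be the character of $K^+$, trivial on $\mathfrak D$, with $\chi(\zeta_\mu\mathfrak p^{-j})=e^{2\pi i/p}$ if $\mu=0$ and $j=1$, and $=1$ if $\mu\in\{1,\dots,c-1\}$ or $j\ne1$. Put $\chi_y(x)=\chi(yx)$. For $0\le n<q$, $n=a_0+a_1p+\dots+a_{c-1}p^{c-1}$ with $0\le a_k<p$, set $u(n)=(a_0+a_1\zeta_1+\dots+a_{c-1}\zeta_{c-1})\mathfrak p^{-1}$; for $n=b_0+b_1q+\dots+b_sq^s$ with $0\le b_k<q$ set $u(n)=u(b_0)+u(b_1)\mathfrak p^{-1}+\dots+u(b_s)\mathfrak p^{-s}$. Then $\{u(n):n\in\mathbb N_0\}$ is a complete set of coset representatives of $\mathfrak D$ in $K^+$. Write $\chi_n=\chi_{u(n)}$. The Fourier transform is $\hat f(\xi)=\int_Kf(x)\overline{\chi_\xi(x)}\,dx$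 on $L^1(K)\cap L^2(K)$, extended to a unitary operator on $L^2(K)$. A function $\varphi\in L^2(K)$ generates a multiresolution analysis if and only if $\sum_{k\in\mathbb N_0}|\hat\varphi(\xi-u(k))|^2=1$ for a.e. $\xi\in\mathfrak D$ and $\lim_{j\to\infty}|\hat\varphi(\mathfrak p^j\xi)|=1$ for a.e. $\xi\in K$ (for refinable $\varphi$). Masks that are Walsh polynomials are functions $m(\xi)=\frac1{\sqrt q}\sum_kd_k\overline{\chi_k(\xi)}$ with finitely many nonzero complex coefficients $d_k$. An $L\times L$ matrix-valued measurable function $A(\xi)$ is paraunitary if $A(\xi)^*A(\xi)=I_L$ for a.e. $\xi$, where $^*$ is conjugate transpose. Entries $a_{\ell,r}$ are called integral periodic here if $a_{\ell,r}(\xi+\mathfrak pu(k))=a_{\ell,r}(\xi)$ for all $k\in\mathbb N_0$. For a finite family $\Psi=(\psi_i)_{i\in I}\subset L^2(K)$, the wavelet system is $\mathcal F(\Psi)=\{\psi_{i,j,k}(x)=q^{j/2}\psi_i(\mathfrak p^{-j}x-u(k)):j\in\mathbb Z,\,k\in\mathbb N_0,\,i\in I\}$. It is a tight wavelet frame if there is a constant $A>0$ with $\sum_{i,j,k}|\langle f,\psi_{i,j,k}\rangle|^2=A\|f\|_2^2$ for all $f\in L^2(K)$, and a normalized (Parseval) frame if $A=1$. Two wavelet frames $\mathcal F(\Psi)$ and $\mathcal F(\Phi)$ indexed by the same set $I$ are orthogonal if $\sum_{i\in I}\sum_{j\in\mathbb Z}\sum_{k\in\mathbb N_0}\langle f,\psi_{i,j,k}\rangle\phi_{i,j,k}=0$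 for all $f\in L^2(K)$. *)

theory Defs
  imports
    "HOL-Analysis.Analysis"
    "HOL-Computational_Algebra.Computational_Algebra"
    "Jordan_Normal_Form.Schur_Decomposition"
begin

text \<open>
  The fixed data attached to a local field of positive characteristic. The field itself is the
  type \<open>'a\<close>.
\<close>

record 'a local_field =
  absv :: "'a \<Rightarrow> real"
  prime_elt :: 'a
  res_degree :: nat
  zeta :: "nat \<Rightarrow> 'a"
  chr :: "'a \<Rightarrow> complex"
  haar :: "'a measure"

definition int_ring :: "'a local_field \<Rightarrow> 'a set"
  where "int_ring K = {x. absv K x \<le> 1}"

definition max_ideal :: "'a local_field \<Rightarrow> 'a set"
  where "max_ideal K = {x. absv K x < 1}"

definition residue_card :: "('a :: field) local_field \<Rightarrow> nat"
  where "residue_card K = CHAR('a) ^ res_degree K"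

definition residue_classes :: "('a :: field) local_field \<Rightarrow> 'a set set"
  where "residue_classes K =
    int_ring K // {(x, y). x \<in> int_ring K \<and> y \<in> int_ring K \<and> x - y \<in> max_ideal K}"

definition zeta_span :: "('a :: field) local_field \<Rightarrow> 'a set"
  where "zeta_span K =
    {\<Sum>\<mu><res_degree K. of_nat (a \<mu>) * zeta K \<mu> | a. \<forall>\<mu><res_degree K. a \<mu> < CHAR('a)}"

text \<open>
  The absolute value is part of the data, and the metric of the type is the one it induces; hence
  the field operations are continuous and the topology is totally disconnected (proved below).
  A translation-invariant Borel measure giving the compact open ring of integers measure 1 is the
  normalized Haar measure. As \<open>\<DD>/\<BB>\<close> is a field, prescribing its cardinality \<open>q\<close> means that it is
  isomorphic to \<open>GF(q)\<close>.
\<close>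

locale char_p_local_field =
  fixes K :: "('a :: {field, metric_space}) local_field" (structure)
  assumes char_pos: "CHAR('a) > 0"
    and dist_absv: "dist x y = absv K (x - y)"
    and absv_mult: "absv K (x * y) = absv K x * absv K y"
    and absv_ultrametric: "absv K (x + y) \<le> max (absv K x) (absv K y)"
    and locally_compact: "locally compact (UNIV :: 'a set)"
    and non_discrete: "\<not> open {0 :: 'a}"
    and card_residue_classes: "card (residue_classes K) = residue_card K"
    and prime_elt_generates: "max_ideal K = (\<lambda>x. prime_elt K * x) ` int_ring K"
    and absv_prime_elt: "absv K (prime_elt K) = 1 / real (residue_card K)"
    and zeta_0: "zeta K 0 = 1"
    and zeta_unit: "\<mu> < res_degree K \<Longrightarrow> zeta K \<mu> \<in> int_ring K - max_ideal K"
    and card_zeta_span: "card (zeta_span K) = residue_card K"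
    and zeta_span_diff: "x \<in> zeta_span K \<Longrightarrow> y \<in> zeta_span K \<Longrightarrow> x - y \<in> zeta_span K"
    and zeta_span_mult: "x \<in> zeta_span K \<Longrightarrow> y \<in> zeta_span K \<Longrightarrow> x * y \<in> zeta_span K"
    and zeta_span_inverse: "x \<in> zeta_span K \<Longrightarrow> inverse x \<in> zeta_span K"
    and chr_norm: "cmod (chr K x) = 1"
    and chr_add: "chr K (x + y) = chr K x * chr K y"
    and chr_continuous: "continuous_on UNIV (chr K)"
    and chr_int_ring: "x \<in> int_ring K \<Longrightarrow> chr K x = 1"
    and chr_zeta: "\<mu> < res_degree K \<Longrightarrow> chr K (zeta K \<mu> * prime_elt K powi (- j)) =
      (if \<mu> = 0 \<and> j = 1 then exp (2 * of_real pi * \<i> / of_nat CHAR('a)) else 1)"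
    and sets_haar: "sets (haar K) = sets borel"
    and haar_translation: "S \<in> sets borel \<Longrightarrow>
      emeasure (haar K) ((\<lambda>x. a + x) ` S) = emeasure (haar K) S"
    and haar_int_ring: "emeasure (haar K) (int_ring K) = 1"

lemma (in char_p_local_field) totally_disconnected:
  fixes S :: "'a set"
  assumes "connected S" and "x \<in> S" and "y \<in> S"
  shows "x = y"
proof (rule ccontr)
  assume "x \<noteq> y"
  define U where "U = ball x (dist x y)"
  have *: "dist u w \<le> max (dist u v) (dist v w)" for u v w :: 'a
    using absv_ultrametric[of "u - v" "v - w"] by (simp add: dist_absv)
  have "ball z (dist x y) \<subseteq> - U" if "z \<in> - U" for z
  proof
    fix w assume "w \<in> ball z (dist x y)"
    then show "w \<in> - U"
      using that *[of x z w] by (auto simp: U_def dist_commute)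
  qed
  then have "open (- U)"
    unfolding open_contains_ball using \<open>x \<noteq> y\<close> by (metis zero_less_dist_iff)
  moreover have "open U" "x \<in> U" "y \<notin> U"
    using \<open>x \<noteq> y\<close> by (auto simp: U_def)
  ultimately show False
    using connectedD[OF assms(1), of U "- U"] assms(2,3) by auto
qed

definition unit_digit_rep :: "('a :: field) local_field \<Rightarrow> nat \<Rightarrow> 'a"
  where "unit_digit_rep K n =
    (\<Sum>k<res_degree K. of_nat (n div CHAR('a) ^ k mod CHAR('a)) * zeta K k) * inverse (prime_elt K)"

text \<open>
  The coset representatives \<open>u(n)\<close>. The \<open>k\<close>-th base-\<open>q\<close> digit of \<open>n\<close> is \<open>n div q^k mod q\<close>, which
  vanishes for \<open>k > n\<close> (and contributes 0), so that the sum may stop at \<open>k = n\<close>.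
\<close>

definition coset_rep :: "('a :: field) local_field \<Rightarrow> nat \<Rightarrow> 'a"
  where "coset_rep K n =
    (\<Sum>k\<le>n. unit_digit_rep K (n div residue_card K ^ k mod residue_card K) * inverse (prime_elt K) ^ k)"

definition walsh_polynomial :: "('a :: field) local_field \<Rightarrow> ('a \<Rightarrow> complex) \<Rightarrow> bool"
  where "walsh_polynomial K m \<longleftrightarrow> (\<exists>d :: nat \<Rightarrow> complex. finite {k. d k \<noteq> 0} \<and>
    (\<forall>\<xi>. m \<xi> = 1 / of_real (sqrt (real (residue_card K))) *
      (\<Sum>k | d k \<noteq> 0. d k * cnj (chr K (coset_rep K k * \<xi>)))))"

text \<open>Elements of \<open>L\<^sup>2(K)\<close> are represented by functions; equality in \<open>L\<^sup>2(K)\<close> is equality a.e.\<close>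

definition L2 :: "('a :: metric_space) local_field \<Rightarrow> ('a \<Rightarrow> complex) set"
  where "L2 K = {f \<in> borel_measurable (haar K). integrable (haar K) (\<lambda>x. (cmod (f x))\<^sup>2)}"

definition L2_inner ::
    "('a :: metric_space) local_field \<Rightarrow> ('a \<Rightarrow> complex) \<Rightarrow> ('a \<Rightarrow> complex) \<Rightarrow> complex"
  where "L2_inner K f g = (\<integral>x. f x * cnj (g x) \<partial>haar K)"

definition L2_norm :: "('a :: metric_space) local_field \<Rightarrow> ('a \<Rightarrow> complex) \<Rightarrow> real"
  where "L2_norm K f = sqrt (\<integral>x. (cmod (f x))\<^sup>2 \<partial>haar K)"

definition fourier_L1 ::
    "('a :: {field, metric_space}) local_field \<Rightarrow> ('a \<Rightarrow> complex) \<Rightarrow> 'a \<Rightarrow> complex"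
  where "fourier_L1 K f \<xi> = (\<integral>x. f x * cnj (chr K (\<xi> * x)) \<partial>haar K)"

text \<open>
  The Fourier transform on \<open>L\<^sup>2(K)\<close> is the continuous extension of its restriction to
  \<open>L\<^sup>1(K) \<inter> L\<^sup>2(K)\<close>; it is determined up to null sets, and \<open>fourier\<close> selects a representative.
\<close>

definition is_fourier ::
    "('a :: {field, metric_space}) local_field \<Rightarrow> ('a \<Rightarrow> complex) \<Rightarrow> ('a \<Rightarrow> complex) \<Rightarrow> bool"
  where "is_fourier K f g \<longleftrightarrow> f \<in> L2 K \<and> g \<in> L2 K \<and>
    (\<exists>F :: nat \<Rightarrow> 'a \<Rightarrow> complex.
      (\<forall>n. integrable (haar K) (F n) \<and> F n \<in> L2 K \<and> fourier_L1 K (F n) \<in> L2 K) \<and>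
      (\<lambda>n. L2_norm K (\<lambda>x. F n x - f x)) \<longlonglongrightarrow> 0 \<and>
      (\<lambda>n. L2_norm K (\<lambda>\<xi>. fourier_L1 K (F n) \<xi> - g \<xi>)) \<longlonglongrightarrow> 0)"

definition fourier ::
    "('a :: {field, metric_space}) local_field \<Rightarrow> ('a \<Rightarrow> complex) \<Rightarrow> 'a \<Rightarrow> complex"
  where "fourier K f = (SOME g. is_fourier K f g)"

text \<open>
  Multiresolution analyses in the usual sense: closed subspaces \<open>V\<^sub>j\<close> of \<open>L\<^sup>2(K)\<close> that are nested, have
  dense union and trivial intersection, are related by dilation by \<open>\<pp>\<^sup>-\<^sup>1\<close>, and such that the translates
  \<open>\<phi>(x - u(k))\<close> form an orthonormal basis of \<open>V\<^sub>0\<close>. A closed subspace is in particular closed under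
  equality a.e.
\<close>

definition L2_closed_subspace ::
    "('a :: metric_space) local_field \<Rightarrow> ('a \<Rightarrow> complex) set \<Rightarrow> bool"
  where "L2_closed_subspace K V \<longleftrightarrow> V \<subseteq> L2 K \<and> (\<lambda>x. 0) \<in> V \<and>
    (\<forall>f\<in>V. \<forall>g\<in>V. (\<lambda>x. f x + g x) \<in> V) \<and>
    (\<forall>a. \<forall>f\<in>V. (\<lambda>x. a * f x) \<in> V) \<and>
    (\<forall>f\<in>L2 K. (\<forall>\<epsilon>>0. \<exists>g\<in>V. L2_norm K (\<lambda>x. f x - g x) < \<epsilon>) \<longrightarrow> f \<in> V)"

definition multiresolution_analysis ::
    "('a :: {field, metric_space}) local_field \<Rightarrow> (int \<Rightarrow> ('a \<Rightarrow> complex) set) \<Rightarrow>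
      ('a \<Rightarrow> complex) \<Rightarrow> bool"
  where "multiresolution_analysis K V \<phi> \<longleftrightarrow>
    (\<forall>j. L2_closed_subspace K (V j)) \<and>
    (\<forall>j. V j \<subseteq> V (j + 1)) \<and>
    (\<forall>f\<in>L2 K. \<forall>\<epsilon>>0. \<exists>j. \<exists>g\<in>V j. L2_norm K (\<lambda>x. f x - g x) < \<epsilon>) \<and>
    (\<forall>f. (\<forall>j. f \<in> V j) \<longrightarrow> (AE x in haar K. f x = 0)) \<and>
    (\<forall>j f. f \<in> V j \<longleftrightarrow> (\<lambda>x. f (inverse (prime_elt K) * x)) \<in> V (j + 1)) \<and>
    (\<forall>k. (\<lambda>x. \<phi> (x - coset_rep K k)) \<in> V 0) \<and>
    (\<forall>k l. L2_inner K (\<lambda>x. \<phi> (x - coset_rep K k)) (\<lambda>x. \<phi> (x - coset_rep K l)) =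
      (if k = l then 1 else 0)) \<and>
    (\<forall>f\<in>V 0. \<forall>\<epsilon>>0. \<exists>n. \<exists>a :: nat \<Rightarrow> complex.
      L2_norm K (\<lambda>x. f x - (\<Sum>k<n. a k * \<phi> (x - coset_rep K k))) < \<epsilon>)"

definition generates_MRA ::
    "('a :: {field, metric_space}) local_field \<Rightarrow> ('a \<Rightarrow> complex) \<Rightarrow> bool"
  where "generates_MRA K \<phi> \<longleftrightarrow> (\<exists>V. multiresolution_analysis K V \<phi>)"

definition wavelet ::
    "('a :: field) local_field \<Rightarrow> ('a \<Rightarrow> complex) \<Rightarrow> int \<Rightarrow> nat \<Rightarrow> 'a \<Rightarrow> complex"
  where "wavelet K \<psi> j k x =
    of_real (real (residue_card K) powr (real_of_int j / 2)) *
      \<psi> (prime_elt K powi (- j) * x - coset_rep K k)"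

definition wavelet_frame_with_bound ::
    "('a :: {field, metric_space}) local_field \<Rightarrow> 'i set \<Rightarrow> ('i \<Rightarrow> 'a \<Rightarrow> complex) \<Rightarrow> real \<Rightarrow> bool"
  where "wavelet_frame_with_bound K I \<Psi> A \<longleftrightarrow> finite I \<and> (\<forall>i\<in>I. \<Psi> i \<in> L2 K) \<and>
    (\<forall>f\<in>L2 K. ((\<lambda>(i, j, k). (cmod (L2_inner K f (wavelet K (\<Psi> i) j k)))\<^sup>2)
      has_sum A * (L2_norm K f)\<^sup>2) (I \<times> UNIV \<times> UNIV))"

definition tight_wavelet_frame ::
    "('a :: {field, metric_space}) local_field \<Rightarrow> 'i set \<Rightarrow> ('i \<Rightarrow> 'a \<Rightarrow> complex) \<Rightarrow> bool"
  where "tight_wavelet_frame K I \<Psi> \<longleftrightarrow> (\<exists>A>0. wavelet_frame_with_bound K I \<Psi> A)"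

definition parseval_wavelet_frame ::
    "('a :: {field, metric_space}) local_field \<Rightarrow> 'i set \<Rightarrow> ('i \<Rightarrow> 'a \<Rightarrow> complex) \<Rightarrow> bool"
  where "parseval_wavelet_frame K I \<Psi> \<longleftrightarrow> wavelet_frame_with_bound K I \<Psi> 1"

text \<open>The series in the orthogonality condition is an unconditional sum in the norm of \<open>L\<^sup>2(K)\<close>.\<close>

definition orthogonal_wavelet_systems ::
    "('a :: {field, metric_space}) local_field \<Rightarrow> 'i set \<Rightarrow>
      ('i \<Rightarrow> 'a \<Rightarrow> complex) \<Rightarrow> ('i \<Rightarrow> 'a \<Rightarrow> complex) \<Rightarrow> bool"
  where "orthogonal_wavelet_systems K I \<Psi> \<Phi> \<longleftrightarrow>
    (\<forall>f\<in>L2 K. ((\<lambda>S. L2_norm K (\<lambda>x. \<Sum>(i, j, k)\<in>S.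
        L2_inner K f (wavelet K (\<Psi> i) j k) * wavelet K (\<Phi> i) j k x))
      \<longlongrightarrow> 0) (finite_subsets_at_top (I \<times> UNIV \<times> UNIV)))"

text \<open>
  The rows and columns of an \<open>L \<times> L\<close> matrix are numbered \<open>0, \<dots>, L - 1\<close>, as in the matrix library.
\<close>

definition paraunitary ::
    "('a :: metric_space) local_field \<Rightarrow> nat \<Rightarrow> ('a \<Rightarrow> complex mat) \<Rightarrow> bool"
  where "paraunitary K L A \<longleftrightarrow>
    (\<forall>\<xi>. A \<xi> \<in> carrier_mat L L) \<and>
    (\<forall>l<L. \<forall>r<L. (\<lambda>\<xi>. A \<xi> $$ (l, r)) \<in> borel_measurable (haar K)) \<and>
    (AE \<xi> in haar K. mat_adjoint (A \<xi>) * A \<xi> = 1\<^sub>m L)"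

definition integral_periodic :: "('a :: field) local_field \<Rightarrow> ('a \<Rightarrow> complex) \<Rightarrow> bool"
  where "integral_periodic K f \<longleftrightarrow> (\<forall>k \<xi>. f (\<xi> + prime_elt K * coset_rep K k) = f \<xi>)"

definition mask_matrix ::
    "('a :: field) local_field \<Rightarrow> nat \<Rightarrow> (nat \<Rightarrow> 'a \<Rightarrow> complex) \<Rightarrow> nat \<Rightarrow> 'a \<Rightarrow> complex mat"
  where "mask_matrix K N m k \<xi> = Matrix.mat (N + 1) 2
    (\<lambda>(n, s). if s = 0 then m n \<xi> else m n (\<xi> + prime_elt K * coset_rep K k))"

end

theory Submission
  imports Defs
begin

text \<open>
  Let \<open>a\<^sub>l\<^sub>r\<close> be the entries of \<open>A\<close> and put \<open>b\<^sub>l\<^sub>r(\<xi>) = a\<^sub>l\<^sub>r(\<pp>\<xi>)\<close>. The Fourier transform of the new wavelet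
  with indices \<open>n, l\<close> and \<open>r\<close> is \<open>b\<^sub>l\<^sub>r\<close> times that of \<open>\<psi>\<^sub>n\<close>. The functions \<open>b\<^sub>l\<^sub>r\<close> are periodic with
  respect to all \<open>u(k)\<close>, and at almost every point the columns of \<open>(b\<^sub>l\<^sub>r)\<close> are orthonormal.

  Consider the coefficients at one scale, which after a dilation of \<open>f\<close> is the scale 0
  (\<open>L2_inner_wavelet\<close>). By Plancherel's theorem the inner product of \<open>f\<close> with \<open>\<psi>\<^sub>n(x - u(k))\<close> is the
  integral of \<open>G \<chi>\<^sub>k\<close>, where \<open>G\<close> is the Fourier transform of \<open>f\<close> times the conjugate of that of \<open>\<psi>\<^sub>n\<close>.
  Since \<open>\<chi>\<^sub>k\<close> is trivial at all \<open>u(l)\<close>, this is also the \<open>k\<close>-th Fourier coefficient on \<open>\<DD>\<close> of the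
  periodization \<open>P(\<xi>) = \<Sum>\<^sub>l G(\<xi> + u(l))\<close>. Passing from \<open>\<psi>\<^sub>n\<close> to the new wavelet multiplies \<open>P\<close> by the
  conjugate of \<open>b\<^sub>l\<^sub>r\<close>, so by Parseval's equation on \<open>\<DD>\<close> (\<open>parseval_periodization\<close>) the squares of the new
  coefficients have, over \<open>k\<close> and \<open>l\<close>, the sum
  \<open>\<integral>\<^sub>\<DD> \<Sum>\<^sub>l |b\<^sub>l\<^sub>r|\<^sup>2 |P|\<^sup>2 = \<integral>\<^sub>\<DD> |P|\<^sup>2\<close>, which is the sum for \<open>\<psi>\<^sub>n\<close>. Hence each of the new systems
  inherits from \<open>\<F>(\<Psi>)\<close> the property of being a Parseval frame.

  For two different columns \<open>r\<close> and \<open>s\<close> the same computation is applied to the coefficients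
  \<open>c\<^sub>p\<close> of \<open>f\<close> in the system of \<open>r\<close> and \<open>d\<^sub>p\<close> of \<open>g\<close> in the system of \<open>s\<close>. Pythagoras' theorem in
  \<open>\<complex>\<^sup>L\<close> shows that \<open>\<Sum>\<^sub>p |c\<^sub>p + t d\<^sub>p|\<^sup>2 = \<parallel>f\<parallel>\<^sup>2 + |t|\<^sup>2 \<parallel>g\<parallel>\<^sup>2\<close> for every complex \<open>t\<close>
  (\<open>frame_coefficients\<close>), and polarization gives \<open>\<Sum>\<^sub>p c\<^sub>p d\<^sub>p\<^sup>* = 0\<close>. This is the weak form of
  orthogonality; \<open>L2_expansion_tendsto_zero\<close> upgrades it to convergence in norm by means of the Bessel
  inequality.

  Plancherel's theorem is derived from the fact that \<open>\<pp>\<^sup>n\<DD>\<close> and \<open>\<pp>\<^sup>-\<^sup>n\<DD>\<close> annihilate each other under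
  \<open>\<chi>(x y)\<close>: restricting the Fourier transform of \<open>F\<close> to \<open>\<pp>\<^sup>-\<^sup>n\<DD>\<close> amounts to averaging \<open>F\<close> over the cosets
  of \<open>\<pp>\<^sup>n\<DD>\<close>, and these averages converge to \<open>F\<close> (\<open>plancherel_L1\<close>). The periodization \<open>P\<close> is a priori
  only integrable. For this reason Plancherel's theorem is proved for all integrable functions, as an
  equation in \<open>[0, \<infinity>]\<close>.
\<close>

section \<open>Digits, unitary matrices and unconditional sums\<close>

lemma exists_digits:
  fixes b :: nat
  assumes "b > 0" "\<And>k. k < c \<Longrightarrow> a k < b"
  shows "\<exists>n<b ^ c. \<forall>k<c. n div b ^ k mod b = a k"
  using assms(2)
proof (induction c)
  case (Suc c)
  then obtain n where n: "n < b ^ c" "\<forall>k<c. n div b ^ k mod b = a k"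
    by (metis less_SucI)
  have "n + a c * b ^ c < b ^ c + a c * b ^ c"
    using n by simp
  also have "\<dots> \<le> b ^ Suc c"
    using Suc.prems[of c] mult_right_mono[of "Suc (a c)" b "b ^ c"] by simp
  finally have "n + a c * b ^ c < b ^ Suc c" .
  moreover have "(n + a c * b ^ c) div b ^ k mod b = a k" if "k < Suc c" for k
  proof (cases "k = c")
    case True
    then show ?thesis
      using n assms(1) Suc.prems[of c] by simp
  next
    case False
    then have "b ^ c = b ^ k * (b * b ^ (c - k - 1))"
      using that by (metis (no_types) Suc_diff_1 add_diff_inverse_nat diff_is_0_eq'
          le_neq_implies_less less_Suc_eq_le linorder_not_le power_Suc power_add zero_less_diff
          diff_diff_left plus_1_eq_Suc add.commute not_gr_zero)
    then have "n + a c * b ^ c = n + b ^ k * (b * (a c * b ^ (c - k - 1)))"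
      by (simp only: ac_simps)
    moreover have "(n + b ^ k * M) div b ^ k = n div b ^ k + M" for M
      using assms(1) by simp
    ultimately have "(n + a c * b ^ c) div b ^ k = n div b ^ k + b * (a c * b ^ (c - k - 1))"
      by (simp only:)
    then show ?thesis
      using n that False by simp
  qed
  ultimately show ?case
    by blast
qed simp

lemma of_real_indicator: "of_real (indicator A x) = indicator A x"
  by (simp add: indicator_def)

lemma borel_measurable_cnj [measurable (raw)]:
  fixes f :: "'b \<Rightarrow> complex"
  assumes "f \<in> borel_measurable M"
  shows "(\<lambda>x. cnj (f x)) \<in> borel_measurable M"
  by (rule measurable_compose[OF assms borel_measurable_continuous_onI]) (intro continuous_intros)

text \<open>
  Two columns of a unitary matrix. They are different for \<open>t \<noteq> 0\<close>; the case \<open>t = 0\<close> admits \<open>b = c\<close>, and so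
  covers the frame property of a single system.
\<close>

lemma pythagoras_columns:
  fixes b c :: "nat \<Rightarrow> complex"
  assumes "(\<Sum>l<L. b l * cnj (b l)) = 1" "(\<Sum>l<L. c l * cnj (c l)) = 1"
    and "t = 0 \<or> (\<Sum>l<L. cnj (b l) * c l) = 0"
  shows "(\<Sum>l<L. (cmod (cnj (b l) * x + t * cnj (c l) * y))\<^sup>2) = (cmod x)\<^sup>2 + (cmod t)\<^sup>2 * (cmod y)\<^sup>2"
proof -
  have orth: "t * (\<Sum>l<L. b l * cnj (c l)) = 0" "cnj t * (\<Sum>l<L. cnj (b l) * c l) = 0"
  proof -
    have "(\<Sum>l<L. b l * cnj (c l)) = cnj (\<Sum>l<L. cnj (b l) * c l)"
      by simp
    then show "t * (\<Sum>l<L. b l * cnj (c l)) = 0" "cnj t * (\<Sum>l<L. cnj (b l) * c l) = 0"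
      using assms(3) by (auto simp del: cnj_sum)
  qed
  have "of_real (\<Sum>l<L. (cmod (cnj (b l) * x + t * cnj (c l) * y))\<^sup>2) =
      (\<Sum>l<L. (cnj (b l) * x + t * cnj (c l) * y) * cnj (cnj (b l) * x + t * cnj (c l) * y))"
    by (simp only: of_real_sum complex_norm_square)
  also have "\<dots> = (\<Sum>l<L. (x * cnj x) * (b l * cnj (b l)) + (t * cnj t * (y * cnj y)) * (c l * cnj (c l)) +
      (x * cnj y) * (cnj t * (cnj (b l) * c l)) + (cnj x * y) * (t * (b l * cnj (c l))))"
    by (intro sum.cong refl) (simp add: algebra_simps)
  also have "\<dots> = (x * cnj x) * (\<Sum>l<L. b l * cnj (b l)) + (t * cnj t * (y * cnj y)) * (\<Sum>l<L. c l * cnj (c l)) +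
      (x * cnj y) * (cnj t * (\<Sum>l<L. cnj (b l) * c l)) + (cnj x * y) * (t * (\<Sum>l<L. b l * cnj (c l)))"
    by (simp only: sum.distrib sum_distrib_left)
  also have "\<dots> = of_real ((cmod x)\<^sup>2 + (cmod t)\<^sup>2 * (cmod y)\<^sup>2)"
    by (simp only: assms(1,2) orth of_real_add of_real_mult complex_norm_square) simp
  finally show ?thesis
    by (simp only: of_real_eq_iff)
qed

lemma mat_adjoint_mult_index:
  fixes A :: "complex mat"
  assumes "A \<in> carrier_mat L L" "r < L" "s < L"
  shows "(mat_adjoint A * A) $$ (r, s) = (\<Sum>l<L. cnj (A $$ (l, r)) * A $$ (l, s))"
  using assms by (simp add: mat_adjoint_def scalar_prod_def atLeast0LessThan)

text \<open>
  As integrals for the counting measure, unconditional sums of nonnegative terms may be rearranged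
  without a discussion of convergence.
\<close>

lemma has_sum_iff_nn_integral:
  fixes f :: "'b \<Rightarrow> real"
  assumes f: "\<And>x. x \<in> A \<Longrightarrow> f x \<ge> 0" and a: "a \<ge> 0"
  shows "(f has_sum a) A \<longleftrightarrow> (\<integral>\<^sup>+x. ennreal (f x) \<partial>count_space A) = ennreal a"
proof
  assume sum: "(f has_sum a) A"
  then have abs: "Infinite_Set_Sum.abs_summable_on f A"
    unfolding abs_summable_equivalent[symmetric] summable_on_iff_abs_summable_on_real[symmetric]
    by (rule has_sum_imp_summable)
  have "(\<integral>\<^sup>+x. ennreal (f x) \<partial>count_space A) = ennreal (infsetsum f A)"
    using abs f by (rule nn_integral_conv_infsetsum)
  then show "(\<integral>\<^sup>+x. ennreal (f x) \<partial>count_space A) = ennreal a"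
    by (simp only: infsetsum_infsum[OF abs] infsumI[OF sum])
next
  assume eq: "(\<integral>\<^sup>+x. ennreal (f x) \<partial>count_space A) = ennreal a"
  have "integrable (count_space A) f"
  proof (rule integrableI_nonneg)
    show "AE x in count_space A. 0 \<le> f x"
      by (rule AE_I2) (use f in simp)
    show "(\<integral>\<^sup>+x. ennreal (f x) \<partial>count_space A) < \<infinity>"
      unfolding eq by simp
  qed simp
  then have abs: "Infinite_Set_Sum.abs_summable_on f A"
    unfolding Infinite_Set_Sum.abs_summable_on_def .
  have "(\<integral>\<^sup>+x. ennreal (f x) \<partial>count_space A) = ennreal (infsetsum f A)"
    using abs f by (rule nn_integral_conv_infsetsum)
  then have "ennreal (infsum f A) = ennreal a"
    by (simp only: infsetsum_infsum[OF abs] eq)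
  moreover have "infsum f A \<ge> 0"
    using f by (rule infsum_nonneg)
  ultimately have "infsum f A = a"
    using a by (simp only: ennreal_inj)
  moreover have "f summable_on A"
    using abs unfolding abs_summable_equivalent[symmetric] summable_on_iff_abs_summable_on_real[symmetric] .
  ultimately show "(f has_sum a) A"
    using has_sum_infsum by blast
qed

lemma nn_integral_count_space_scales:
  fixes h :: "'i \<times> 'j \<times> nat \<Rightarrow> ennreal"
  assumes "finite I"
  shows "(\<integral>\<^sup>+p. h p \<partial>count_space (I \<times> UNIV \<times> UNIV)) =
    (\<Sum>i\<in>I. \<integral>\<^sup>+j. (\<Sum>k. h (i, j, k)) \<partial>count_space UNIV)"
proof -
  have "(\<integral>\<^sup>+p. h p \<partial>count_space (I \<times> UNIV \<times> UNIV)) =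
      (\<integral>\<^sup>+p. h p * indicator (I \<times> UNIV \<times> UNIV) p \<partial>count_space UNIV)"
    by (rule nn_integral_count_space_indicator) simp
  also have "\<dots> = (\<integral>\<^sup>+i. \<integral>\<^sup>+p. h (i, p) * indicator I i \<partial>count_space UNIV \<partial>count_space UNIV)"
    unfolding nn_integral_fst_count_space[symmetric]
    by (intro nn_integral_cong) (simp add: indicator_def)
  also have "\<dots> = (\<integral>\<^sup>+i. (\<integral>\<^sup>+p. h (i, p) \<partial>count_space UNIV) * indicator I i \<partial>count_space UNIV)"
    by (simp add: nn_integral_multc)
  also have "\<dots> = (\<integral>\<^sup>+i. (\<integral>\<^sup>+p. h (i, p) \<partial>count_space UNIV) \<partial>count_space I)"
    by (rule nn_integral_count_space_indicator[symmetric]) simp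
  also have "\<dots> = (\<Sum>i\<in>I. \<integral>\<^sup>+p. h (i, p) \<partial>count_space UNIV)"
    by (rule nn_integral_count_space_finite[OF assms])
  also have "\<dots> = (\<Sum>i\<in>I. \<integral>\<^sup>+j. (\<Sum>k. h (i, j, k)) \<partial>count_space UNIV)"
    by (simp add: nn_integral_fst_count_space[symmetric] nn_integral_count_space_nat)
  finally show ?thesis .
qed

text \<open>
  Comparing the hypothesis for \<open>t\<close> and \<open>-t\<close> leaves the terms \<open>2 Re (c\<^sub>p (t d\<^sub>p)\<^sup>*)\<close>; then \<open>t = 1\<close> gives the
  real part of the claim and \<open>t = \<i>\<close> the imaginary part.
\<close>

lemma has_sum_cross_terms_zero:
  fixes c d :: "'b \<Rightarrow> complex"
  assumes "\<And>t. ((\<lambda>p. (cmod (c p + t * d p))\<^sup>2) has_sum C + (cmod t)\<^sup>2 * D) A"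
  shows "((\<lambda>p. c p * cnj (d p)) has_sum 0) A"
proof -
  have Re: "((\<lambda>p. 2 * Re (c p * cnj (t * d p))) has_sum 0) A" for t
  proof -
    have "((\<lambda>p. 1 / 2 * ((cmod (c p + t * d p))\<^sup>2 + (- 1) * (cmod (c p + (- t) * d p))\<^sup>2)) has_sum
        1 / 2 * ((C + (cmod t)\<^sup>2 * D) + (- 1) * (C + (cmod (- t))\<^sup>2 * D))) A"
      by (intro has_sum_add has_sum_cmult_right assms)
    moreover have "1 / 2 * ((cmod (c p + t * d p))\<^sup>2 + (- 1) * (cmod (c p + (- t) * d p))\<^sup>2) =
      2 * Re (c p * cnj (t * d p))" for p
      unfolding cmod_power2 by (simp add: power2_eq_square algebra_simps)
    moreover have "1 / 2 * ((C + (cmod t)\<^sup>2 * D) + (- 1) * (C + (cmod (- t))\<^sup>2 * D)) = 0"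
      by simp
    ultimately show ?thesis
      by (simp only:)
  qed
  have "((\<lambda>p. 1 / 2 * (of_real (2 * Re (c p * cnj (1 * d p))) + \<i> * of_real (2 * Re (c p * cnj (\<i> * d p)))))
      has_sum 1 / 2 * (of_real 0 + \<i> * of_real 0)) A"
    by (intro has_sum_cmult_right has_sum_add has_sum_of_real Re)
  moreover have "1 / 2 * (of_real (2 * Re (c p * cnj (1 * d p))) + \<i> * of_real (2 * Re (c p * cnj (\<i> * d p)))) =
    c p * cnj (d p)" for p
    by (simp add: complex_eq_iff)
  moreover have "1 / 2 * (of_real 0 + \<i> * of_real 0) = (0 :: complex)"
    by simp
  ultimately show ?thesis
    by (simp only:)
qed

lemma has_sum_tail_small:
  fixes a :: "'b \<Rightarrow> real"
  assumes a: "(a has_sum s) A" and nonneg: "\<And>p. p \<in> A \<Longrightarrow> a p \<ge> 0" and "e > 0"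
  obtains X where "finite X" "X \<subseteq> A"
    "\<And>S S'. finite S' \<Longrightarrow> X \<subseteq> S \<Longrightarrow> S \<subseteq> S' \<Longrightarrow> S' \<subseteq> A \<Longrightarrow> sum a (S' - S) \<le> e"
proof -
  have "\<forall>\<^sub>F S in finite_subsets_at_top A. s - e < sum a S"
    by (rule order_tendstoD(1)[OF a[unfolded has_sum_def]]) (use \<open>e > 0\<close> in simp)
  then obtain X where X: "finite X" "X \<subseteq> A"
    "\<forall>S. finite S \<and> X \<subseteq> S \<and> S \<subseteq> A \<longrightarrow> s - e < sum a S"
    unfolding eventually_finite_subsets_at_top by blast
  have "sum a (S' - S) \<le> e" if "finite S'" "X \<subseteq> S" "S \<subseteq> S'" "S' \<subseteq> A" for S S'
  proof -
    have "s - e < sum a S"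
      using X(3) finite_subset[OF that(3,1)] that(2) subset_trans[OF that(3,4)] by simp
    moreover have "sum a S' \<le> s"
      by (rule finite_sum_le_has_sum[OF a that(1,4)]) (use nonneg in simp)
    ultimately show ?thesis
      using sum_diff[OF that(1,3), of a] by linarith
  qed
  with X(1,2) show ?thesis
    by (rule that)
qed

section \<open>Absolute value, character and coset representatives\<close>

context char_p_local_field
begin

abbreviation v :: "'a \<Rightarrow> real" where "v \<equiv> absv K"
abbreviation q :: nat where "q \<equiv> residue_card K"
abbreviation \<pp> :: 'a where "\<pp> \<equiv> prime_elt K"
abbreviation u :: "nat \<Rightarrow> 'a" where "u \<equiv> coset_rep K"
abbreviation chi :: "'a \<Rightarrow> complex" where "chi \<equiv> chr K"

lemma v_dist_0: "v x = dist x 0"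
  by (simp add: dist_absv)

lemma v_nonneg [simp]: "v x \<ge> 0"
  by (simp add: v_dist_0)

lemma v_0 [simp]: "v 0 = 0" and v_eq_0_iff [simp]: "v x = 0 \<longleftrightarrow> x = 0"
  by (simp_all add: v_dist_0)

lemma v_1 [simp]: "v 1 = 1"
  using absv_mult[of 1 1] by (metis mult_cancel_right1 mult_1 v_eq_0_iff zero_neq_one)

lemma v_minus [simp]: "v (- x) = v x"
  using dist_absv[of 0 x] by (simp add: v_dist_0 dist_commute)

lemma v_minus_commute: "v (x - y) = v (y - x)"
  by (metis minus_diff_eq v_minus)

lemma v_inverse [simp]: "v (inverse x) = inverse (v x)"
proof (cases "x = 0")
  case False
  then have "v x * v (inverse x) = 1"
    by (metis absv_mult right_inverse v_1)
  then show ?thesis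
    by (metis inverse_unique)
qed simp

lemma v_power: "v (x ^ n) = v x ^ n"
  by (induction n) (simp_all add: absv_mult)

lemma v_powi: "v (x powi n) = v x powi n"
  by (simp add: power_int_def v_power)

lemma ultrametric: "v (x + y) \<le> r" if "v x \<le> r" "v y \<le> r"
  using absv_ultrametric[of x y] that by linarith

lemma ultrametric_diff: "v (x - y) \<le> r" if "v x \<le> r" "v y \<le> r"
  using ultrametric[of x r "- y"] that by simp

lemma v_prime_elt: "v \<pp> = inverse (real q)"
  by (simp add: absv_prime_elt inverse_eq_divide)

lemma q_pos: "q > 0"
  using char_pos by (simp add: residue_card_def)

lemma q_gt_1: "q > 1"
proof -
  have "\<pp> \<in> max_ideal K"
    unfolding prime_elt_generates by (rule image_eqI[of _ _ 1]) (auto simp: int_ring_def)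
  then have "inverse (real q) < 1"
    by (simp add: max_ideal_def v_prime_elt)
  then show ?thesis
    using q_pos by (simp add: field_simps)
qed

lemma prime_elt_nz [simp]: "\<pp> \<noteq> 0"
  using v_prime_elt q_pos by force

lemma res_degree_pos: "res_degree K > 0"
  using q_gt_1 by (cases "res_degree K") (auto simp: residue_card_def)

lemma char_gt_1: "CHAR('a) > 1"
proof -
  have "CHAR('a) \<noteq> 1"
    by simp
  then show ?thesis
    using char_pos by linarith
qed

lemma v_less_1: "v x \<le> inverse (real q)" if "v x < 1"
proof -
  have "x \<in> max_ideal K"
    using that by (simp add: max_ideal_def)
  then obtain y where "x = \<pp> * y" "v y \<le> 1"
    unfolding prime_elt_generates int_ring_def by auto
  then show ?thesis
    using q_pos by (simp add: absv_mult v_prime_elt mult_left_le)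
qed

lemma chi_0 [simp]: "chi 0 = 1"
  by (rule chr_int_ring) (simp add: int_ring_def)

lemma chi_eq_1: "v x \<le> 1 \<Longrightarrow> chi x = 1"
  by (rule chr_int_ring) (simp add: int_ring_def)

lemma chi_cnj: "cnj (chi x) = chi (- x)"
proof -
  have "chi x * chi (- x) = 1"
    by (simp flip: chr_add)
  moreover have "chi x * cnj (chi x) = 1"
    by (simp add: chr_norm flip: complex_norm_square)
  moreover have "chi x \<noteq> 0"
    using chr_norm[of x] by auto
  ultimately show ?thesis
    by (metis mult_left_cancel)
qed

lemma chi_of_nat_mult: "chi (of_nat n * x) = chi x ^ n"
  by (induction n) (simp_all add: algebra_simps chr_add)

lemma chi_sum: "chi (sum f I) = (\<Prod>i\<in>I. chi (f i))"
  by (induction I rule: infinite_finite_induct) (simp_all add: chr_add)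

lemma chi_inverse_prime_elt: "chi (inverse \<pp>) \<noteq> 1"
proof
  assume "chi (inverse \<pp>) = 1"
  moreover have "chi (inverse \<pp>) = exp (2 * of_real pi * \<i> / of_nat CHAR('a))"
    using chr_zeta[of 0 1] res_degree_pos by (simp add: zeta_0)
  ultimately obtain n :: int where "2 * pi / real CHAR('a) = of_int (2 * n) * pi"
    by (auto simp: exp_eq_1)
  then have "of_int (n * int CHAR('a)) = (1 :: real)"
    using char_gt_1 by (simp add: field_simps)
  then have "n * int CHAR('a) = 1"
    by linarith
  then show False
    using char_gt_1 by (simp add: zmult_eq_1_iff)
qed

text \<open>Since \<open>\<chi>\<close> is trivial on \<open>\<DD>\<close> but not at \<open>\<pp>\<^sup>-\<^sup>1\<close>, the ring of integers is its own annihilator.\<close>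

lemma chi_nontrivial:
  assumes "v y > 1"
  obtains x where "v x \<le> 1" "chi (y * x) \<noteq> 1"
proof -
  \<comment> \<open>The witness is \<open>(y \<pp>)\<^sup>-\<^sup>1\<close>, which \<open>y\<close> multiplies to \<open>\<pp>\<^sup>-\<^sup>1\<close>.\<close>
  have "y \<noteq> 0" "v (inverse y) < 1"
    using assms by (auto simp: inverse_less_1_iff)
  with v_less_1[of "inverse y"] have "v (inverse y * inverse \<pp>) \<le> 1"
    using q_pos by (simp add: absv_mult v_prime_elt) (simp add: field_simps)
  moreover have "chi (y * (inverse y * inverse \<pp>)) \<noteq> 1"
    using chi_inverse_prime_elt \<open>y \<noteq> 0\<close> by (simp flip: mult.assoc)
  ultimately show ?thesis
    using that by blast
qed

lemma finite_zeta_span: "finite (zeta_span K)"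
  using card_zeta_span q_pos by (metis card.infinite less_nat_zero_code)

lemma one_in_zeta_span: "1 \<in> zeta_span K"
proof -
  have "\<not> zeta_span K \<subseteq> {0}"
    using card_zeta_span q_gt_1 card_mono[of "{0}" "zeta_span K"] by auto
  then obtain x where "x \<in> zeta_span K" "x \<noteq> 0"
    by auto
  then show ?thesis
    using zeta_span_mult[of x "inverse x"] zeta_span_inverse[of x] by simp
qed

text \<open>The nonzero elements of a finite subfield are roots of unity, hence units of \<open>\<DD>\<close>.\<close>

lemma v_zeta_span:
  assumes "x \<in> zeta_span K" "x \<noteq> 0"
  shows "v x = 1"
proof -
  have "x ^ n \<in> zeta_span K" for n
    by (induction n) (auto simp: one_in_zeta_span assms zeta_span_mult)
  then have "range (\<lambda>n. x ^ n) \<subseteq> zeta_span K"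
    by auto
  then have "\<not> inj (\<lambda>n :: nat. x ^ n)"
    using finite_zeta_span by (metis finite_subset infinite_UNIV_nat range_inj_infinite)
  then obtain i j :: nat where "i < j" "x ^ i = x ^ j"
    unfolding inj_def by (metis linorder_neqE_nat)
  then have "x ^ i * x ^ (j - i) = x ^ i * 1"
    by (metis le_add_diff_inverse less_imp_le_nat mult.right_neutral power_add)
  then have "v x ^ (j - i) = 1"
    using \<open>x \<noteq> 0\<close> by (metis mult_left_cancel power_not_zero v_1 v_power)
  then show ?thesis
    using \<open>i < j\<close> power_eq_imp_eq_base[of "v x" "j - i" 1] by simp
qed

lemma v_zeta_span_le: "x \<in> zeta_span K \<Longrightarrow> v x \<le> 1"
  using v_zeta_span[of x] by (cases "x = 0") auto

lemma zeta_span_residue_eq: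
  assumes "x \<in> zeta_span K" "y \<in> zeta_span K" "v (x - y) < 1"
  shows "x = y"
  using v_zeta_span[OF zeta_span_diff[OF assms(1,2)]] assms(3) by auto

text \<open>
  The span of the \<open>\<zeta>\<^sub>\<mu>\<close> meets every residue class, since it has as many elements as there are classes
  and its elements lie in different classes.
\<close>

lemma zeta_span_residue:
  assumes "v x \<le> 1"
  obtains z where "z \<in> zeta_span K" "v (x - z) < 1"
proof -
  define R where "R = {(x, y). x \<in> int_ring K \<and> y \<in> int_ring K \<and> x - y \<in> max_ideal K}"
  define cl where "cl z = R `` {z}" for z
  have cl_in: "cl z \<in> residue_classes K" if "v z \<le> 1" for z
    unfolding residue_classes_def cl_def R_def[symmetric]
    by (rule quotientI) (use that in \<open>simp add: int_ring_def\<close>)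
  have cl_self: "z \<in> cl z" if "v z \<le> 1" for z
    using that by (auto simp: cl_def R_def int_ring_def max_ideal_def)
  have "inj_on cl (zeta_span K)"
  proof (rule inj_onI)
    fix y z assume yz: "y \<in> zeta_span K" "z \<in> zeta_span K" "cl y = cl z"
    then have "z \<in> cl y"
      using cl_self v_zeta_span_le by blast
    then show "y = z"
      using yz by (intro zeta_span_residue_eq) (auto simp: cl_def R_def max_ideal_def)
  qed
  moreover have "cl ` zeta_span K \<subseteq> residue_classes K"
    using cl_in v_zeta_span_le by auto
  moreover have "finite (residue_classes K)"
    using card_residue_classes q_pos by (metis card.infinite less_nat_zero_code)
  ultimately have "cl ` zeta_span K = residue_classes K"
    by (metis card_image card_residue_classes card_subset_eq card_zeta_span)
  then obtain z where z: "z \<in> zeta_span K" "cl x = cl z"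
    using cl_in[OF assms] by (metis imageE)
  then have "x \<in> cl z"
    using cl_self[OF assms] by simp
  then have "v (z - x) < 1"
    by (auto simp: cl_def R_def max_ideal_def)
  then show ?thesis
    using that z(1) by (simp add: v_minus_commute)
qed

text \<open>
  The numerator of \<open>u(n)\<close> for \<open>n < q\<close>: the base-\<open>p\<close> digits of \<open>n\<close> are coordinates with respect to the
  \<open>\<zeta>\<^sub>\<mu>\<close>.
\<close>

definition digit :: "nat \<Rightarrow> 'a"
  where "digit n = (\<Sum>k<res_degree K. of_nat (n div CHAR('a) ^ k mod CHAR('a)) * zeta K k)"

lemma bij_digit: "bij_betw digit {..<q} (zeta_span K)"
proof -
  have "digit ` {..<q} = zeta_span K"
  proof (intro equalityI subsetI)
    fix x assume "x \<in> digit ` {..<q}"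
    then show "x \<in> zeta_span K"
      using char_pos unfolding zeta_span_def digit_def by fastforce
  next
    fix x assume "x \<in> zeta_span K"
    then obtain a where a: "x = (\<Sum>k<res_degree K. of_nat (a k) * zeta K k)"
      "\<forall>k<res_degree K. a k < CHAR('a)"
      unfolding zeta_span_def by auto
    then obtain n where "n < q" "\<forall>k<res_degree K. n div CHAR('a) ^ k mod CHAR('a) = a k"
      using exists_digits[of "CHAR('a)" "res_degree K" a] char_pos
      by (auto simp: residue_card_def)
    then have "x = digit n"
      unfolding a digit_def by (intro sum.cong) auto
    then show "x \<in> digit ` {..<q}"
      using \<open>n < q\<close> by auto
  qed
  moreover have "inj_on digit {..<q}"
    by (rule eq_card_imp_inj_on) (simp_all add: calculation card_zeta_span)
  ultimately show ?thesis
    by (simp add: bij_betw_def)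
qed

lemma digit_in_zeta_span: "n < q \<Longrightarrow> digit n \<in> zeta_span K"
  using bij_digit by (auto simp: bij_betw_def)

lemma coset_rep_0 [simp]: "u 0 = 0"
  by (simp add: coset_rep_def unit_digit_rep_def)

text \<open>
  Splitting off the lowest base-\<open>q\<close> digit reduces statements on \<open>u(n)\<close> to \<open>u(n div q)\<close>.
\<close>

lemma coset_rep_rec: "u n = inverse \<pp> * (digit (n mod q) + u (n div q))"
proof -
  define t where "t n k = digit (n div q ^ k mod q) * inverse \<pp> * inverse \<pp> ^ k" for n k
  have digit_0: "digit 0 = 0"
    by (simp add: digit_def)
  have u_eq: "u n = (\<Sum>k<M. t n k)" if "n < M" for n M
  proof -
    have "(\<Sum>k<M. t n k) = (\<Sum>k\<le>n. t n k)"
    proof (rule sum.mono_neutral_right)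
      show "\<forall>k\<in>{..<M} - {..n}. t n k = 0"
      proof
        fix k assume "k \<in> {..<M} - {..n}"
        then have "n < q ^ k"
          using q_gt_1 power_gt_expt[of q k] by auto
        then show "t n k = 0"
          by (simp add: t_def digit_0)
      qed
    qed (use that in auto)
    then show ?thesis
      by (simp add: coset_rep_def t_def unit_digit_rep_def digit_def)
  qed
  have "u n = (\<Sum>k<Suc (Suc n). t n k)"
    by (rule u_eq) simp
  also have "\<dots> = t n 0 + (\<Sum>k<Suc n. t n (Suc k))"
    by (rule sum.lessThan_Suc_shift)
  also have "(\<Sum>k<Suc n. t n (Suc k)) = inverse \<pp> * (\<Sum>k<Suc n. t (n div q) k)"
    unfolding sum_distrib_left by (intro sum.cong) (auto simp: t_def div_mult2_eq)
  also have "(\<Sum>k<Suc n. t (n div q) k) = u (n div q)"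
    by (rule u_eq[symmetric]) (metis div_le_dividend le_imp_less_Suc)
  finally show ?thesis
    by (simp add: t_def algebra_simps)
qed

lemma v_inverse_prime_elt_mult: "v (inverse \<pp> * x) = real q * v x"
  by (simp add: absv_mult v_prime_elt)

text \<open>
  If \<open>u(m) - u(n)\<close> is in \<open>\<DD>\<close>, then after multiplication by \<open>\<pp>\<close> the contributions of the higher digits
  differ by an element of \<open>\<DD>\<close>. By induction they agree, and then the lowest digits are congruent
  modulo \<open>\<BB>\<close>, hence equal.
\<close>

lemma coset_rep_inj: "v (u m - u n) \<le> 1 \<Longrightarrow> m = n"
proof (induction "m + n" arbitrary: m n rule: less_induct)
  case less
  show ?case
  proof (cases "m + n = 0")
    case False
    define z w where "z = digit (m mod q)" and "w = digit (n mod q)"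
    have zw: "z \<in> zeta_span K" "w \<in> zeta_span K"
      using q_pos by (auto simp: z_def w_def digit_in_zeta_span)
    have "u m - u n = inverse \<pp> * ((z - w) + (u (m div q) - u (n div q)))"
      unfolding coset_rep_rec[of m] coset_rep_rec[of n] z_def w_def by (simp add: algebra_simps)
    with less.prems have "real q * v ((z - w) + (u (m div q) - u (n div q))) \<le> 1"
      by (simp add: v_inverse_prime_elt_mult)
    then have lt: "v ((z - w) + (u (m div q) - u (n div q))) \<le> inverse (real q)"
      using q_pos by (simp add: field_simps)
    moreover have q1: "inverse (real q) < 1"
      using q_gt_1 by (simp add: inverse_less_1_iff)
    moreover have "v (z - w) \<le> 1"
      using zw by (intro ultrametric_diff v_zeta_span_le)
    ultimately have "v (u (m div q) - u (n div q)) \<le> 1"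
      using ultrametric_diff[of "(z - w) + (u (m div q) - u (n div q))" 1 "z - w"] by simp
    moreover have "m div q + n div q < m + n"
      using False q_gt_1
      by (cases "m = 0") (auto intro: add_less_le_mono div_less_dividend div_le_dividend)
    ultimately have div_eq: "m div q = n div q"
      using less.hyps by blast
    then have "v (z - w) < 1"
      using lt q1 by simp
    then have "z = w"
      using zw by (rule_tac zeta_span_residue_eq)
    then have "m mod q = n mod q"
      using bij_digit q_pos unfolding z_def w_def bij_betw_def inj_on_def by auto
    then show ?thesis
      using div_eq by (metis div_mult_mod_eq)
  qed simp
qed

lemma coset_rep_surj: "\<exists>k. v (x - u k) \<le> 1"
proof -
  have *: "\<exists>k. v (x - u k) \<le> 1" if "v x \<le> real q ^ N" for x N
    using that
  proof (induction N arbitrary: x)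
    case 0
    then show ?case
      by (intro exI[of _ 0]) simp
  next
    case (Suc N)
    then have "v (\<pp> * x) \<le> real q ^ N"
      using q_pos by (simp add: absv_mult v_prime_elt field_simps)
    then obtain k where "v (\<pp> * x - u k) \<le> 1"
      using Suc.IH by blast
    then obtain z where z: "z \<in> zeta_span K" "v (\<pp> * x - u k - z) < 1"
      by (rule zeta_span_residue)
    then obtain b where b: "b < q" "z = digit b"
      using bij_digit by (auto simp: bij_betw_def)
    have "u (q * k + b) = inverse \<pp> * (z + u k)"
      using coset_rep_rec[of "q * k + b"] b by simp
    then have "x - u (q * k + b) = inverse \<pp> * (\<pp> * x - u k - z)"
      by (simp add: algebra_simps)
    then have "v (x - u (q * k + b)) = real q * v (\<pp> * x - u k - z)"
      by (simp only: v_inverse_prime_elt_mult)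
    also have "\<dots> \<le> 1"
      using v_less_1[OF z(2)] q_pos by (simp add: field_simps)
    finally have "v (x - u (q * k + b)) \<le> 1" .
    then show ?case
      by blast
  qed
  obtain N where "v x < real q ^ N"
    using real_arch_pow[of "real q" "v x"] q_gt_1 by auto
  then show ?thesis
    using *[of x N] by simp
qed

lemma chi_zeta_span:
  assumes "z \<in> zeta_span K"
  shows "chi (z * inverse \<pp> ^ (j + 2)) = 1"
proof -
  obtain a where z: "z = (\<Sum>k<res_degree K. of_nat (a k) * zeta K k)"
    using assms unfolding zeta_span_def by auto
  have "chi (zeta K k * inverse \<pp> ^ (j + 2)) = 1" if "k < res_degree K" for k
  proof -
    have "\<pp> powi (- int (j + 2)) = inverse \<pp> ^ (j + 2)"
      by (simp only: power_int_minus power_int_of_nat power_inverse)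
    then show ?thesis
      using chr_zeta[OF that, of "int (j + 2)"] by (simp del: power_Suc)
  qed
  then show ?thesis
    unfolding z sum_distrib_right mult.assoc chi_sum chi_of_nat_mult by simp
qed

text \<open>
  A product \<open>u(k) u(l)\<close> is a combination of the powers \<open>\<pp>\<^sup>-\<^sup>2, \<pp>\<^sup>-\<^sup>3, \<dots>\<close> with coefficients in the span
  of the \<open>\<zeta>\<^sub>\<mu>\<close>, and \<open>\<chi>\<close> only detects the power \<open>\<pp>\<^sup>-\<^sup>1\<close>. So the \<open>\<chi>\<^sub>k\<close> are periodic with respect
  to the \<open>u(l)\<close>.
\<close>

lemma chi_coset_rep_mult: "chi (u k * u l) = 1"
proof -
  have *: "chi (z * inverse \<pp> ^ (j + 1) * u l) = 1" if "z \<in> zeta_span K" for z j l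
    using that
  proof (induction l arbitrary: j z rule: less_induct)
    case (less l)
    show ?case
    proof (cases "l = 0")
      case False
      then have "chi (z * inverse \<pp> ^ (Suc j + 1) * u (l div q)) = 1"
        using q_gt_1 by (intro less) auto
      moreover have "chi (z * digit (l mod q) * inverse \<pp> ^ (j + 2)) = 1"
        using q_pos less.prems by (intro chi_zeta_span zeta_span_mult digit_in_zeta_span) auto
      moreover have "z * inverse \<pp> ^ (j + 1) * u l =
        z * digit (l mod q) * inverse \<pp> ^ (j + 2) + z * inverse \<pp> ^ (Suc j + 1) * u (l div q)"
        unfolding coset_rep_rec[of l] by (simp add: algebra_simps)
      ultimately show ?thesis
        by (simp only: chr_add mult_1)
    qed simp
  qed
  have "chi (inverse \<pp> ^ j * u k * u l) = 1" for j
  proof (induction k arbitrary: j rule: less_induct)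
    case (less k)
    show ?case
    proof (cases "k = 0")
      case False
      then have "chi (inverse \<pp> ^ Suc j * u (k div q) * u l) = 1"
        using q_gt_1 by (intro less) auto
      moreover have "chi (digit (k mod q) * inverse \<pp> ^ (j + 1) * u l) = 1"
        using q_pos by (intro * digit_in_zeta_span) auto
      moreover have "inverse \<pp> ^ j * u k * u l =
        digit (k mod q) * inverse \<pp> ^ (j + 1) * u l + inverse \<pp> ^ Suc j * u (k div q) * u l"
        unfolding coset_rep_rec[of k] by (simp add: algebra_simps)
      ultimately show ?thesis
        by (simp only: chr_add mult_1)
    qed simp
  qed
  from this[of 0] show ?thesis
    by simp
qed

section \<open>Cosets and Haar measure\<close>

declare sets_haar [measurable_cong]

lemma space_haar [simp]: "space (haar K) = UNIV"
  using sets_eq_imp_space_eq[OF sets_haar] by simp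

text \<open>
  The ball of radius \<open>q\<^sup>-\<^sup>n\<close> about \<open>a\<close>, which is the coset \<open>a + \<pp>\<^sup>n\<DD>\<close>.
\<close>

definition coset :: "int \<Rightarrow> 'a \<Rightarrow> 'a set"
  where "coset n a = {x. v (x - a) \<le> real q powi (- n)}"

text \<open>
  For fixed \<open>n\<close> these are representatives of the cosets of \<open>\<pp>\<^sup>n\<DD>\<close> in \<open>K\<close>.
\<close>

definition rep :: "int \<Rightarrow> nat \<Rightarrow> 'a"
  where "rep n k = \<pp> powi n * u k"

lemma v_prime_elt_powi: "v (\<pp> powi n) = real q powi (- n)"
  by (simp add: v_powi v_prime_elt power_int_inverse power_int_minus)

lemma prime_elt_powi_cancel [simp]: "\<pp> powi n * (\<pp> powi (- n) * x) = x"
  by (simp add: power_int_minus flip: mult.assoc)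

lemma prime_elt_powi_cancel' [simp]: "\<pp> powi (- n) * (\<pp> powi n * x) = x"
  by (simp add: power_int_minus flip: mult.assoc)

lemma q_powi_pos [simp]: "real q powi n > 0"
  using q_pos by simp

lemma coset_self [simp]: "a \<in> coset n a"
  by (simp add: coset_def less_imp_le)

lemma coset_mono: "m \<le> n \<Longrightarrow> coset n a \<subseteq> coset m a"
  using power_int_increasing[of "- n" "- m" "real q"] q_pos by (auto simp: coset_def)

lemma mem_coset_commute: "a \<in> coset n b \<longleftrightarrow> b \<in> coset n a"
  by (simp add: coset_def v_minus_commute)

lemma coset_subset: "b \<in> coset n a \<Longrightarrow> coset n b \<subseteq> coset n a"
proof
  fix x assume "b \<in> coset n a" "x \<in> coset n b"
  then show "x \<in> coset n a"
    using ultrametric[of "x - b" "real q powi (- n)" "b - a"] by (simp add: coset_def)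
qed

lemma coset_eq: "b \<in> coset n a \<Longrightarrow> coset n b = coset n a"
  using coset_subset[of b n a] coset_subset[of a n b] mem_coset_commute[of b n a] by simp

lemma mem_coset_translate: "c + x \<in> coset n a \<longleftrightarrow> x \<in> coset n (a - c)"
  by (simp add: coset_def algebra_simps)

lemma mem_coset_dilate: "\<pp> powi j * x \<in> coset n a \<longleftrightarrow> x \<in> coset (n - j) (\<pp> powi (- j) * a)"
proof -
  have "\<pp> powi j * x - a = \<pp> powi j * (x - \<pp> powi (- j) * a)"
    by (simp add: algebra_simps power_int_minus)
  then have "v (\<pp> powi j * x - a) = real q powi (- j) * v (x - \<pp> powi (- j) * a)"
    by (simp only: absv_mult v_prime_elt_powi)
  moreover have "real q powi (- n) = real q powi (- j) * real q powi (- (n - j))"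
    using q_pos by (simp flip: power_int_add)
  ultimately show ?thesis
    by (simp add: coset_def mult_le_cancel_left_pos)
qed

lemma coset_borel [measurable]: "coset n a \<in> sets borel"
proof -
  have "coset n a = cball a (real q powi (- n))"
    by (auto simp: coset_def dist_absv v_minus_commute)
  then show ?thesis
    by simp
qed

lemma coset_sets [measurable]: "coset n a \<in> sets (haar K)"
  by (simp add: sets_haar)

lemma coset_rep_partition: "\<exists>!k. x \<in> coset n (rep n k)"
proof -
  have "x \<in> coset n (rep n k) \<longleftrightarrow> v (\<pp> powi (- n) * x - u k) \<le> 1" for k
  proof -
    have "x \<in> coset n (rep n k) \<longleftrightarrow> \<pp> powi (- n) * x \<in> coset 0 (\<pp> powi (- n) * rep n k)"
      using mem_coset_dilate[of n "\<pp> powi (- n) * x" n "rep n k"] by simp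
    then show ?thesis
      by (simp add: coset_def rep_def)
  qed
  moreover have "i = j" if "v (y - u i) \<le> 1" "v (y - u j) \<le> 1" for y i j
    using ultrametric_diff[OF that] by (intro coset_rep_inj) (simp add: v_minus_commute)
  ultimately show ?thesis
    using coset_rep_surj[of "\<pp> powi (- n) * x"] by (simp only:) blast
qed

lemma UN_cosets: "(\<Union>k. coset n (rep n k)) = UNIV"
  using ex1_implies_ex[OF coset_rep_partition] by blast

lemma disjoint_cosets: "disjoint_family (\<lambda>k. coset n (rep n k))"
proof -
  have "i = j" if "x \<in> coset n (rep n i)" "x \<in> coset n (rep n j)" for i j x
    using ex1_implies_ex[OF coset_rep_partition] coset_rep_partition[of x n] that by (metis (no_types))
  then show ?thesis
    unfolding disjoint_family_on_def by blast
qed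

lemma coset_split: "coset n a = (\<Union>z\<in>zeta_span K. coset (n + 1) (a + \<pp> powi n * z))"
proof (intro equalityI subsetI)
  fix x assume x: "x \<in> coset n a"
  have shift: "x = a + \<pp> powi n * (\<pp> powi (- n) * (x - a))"
    by simp
  have "v (\<pp> powi (- n) * (x - a)) \<le> 1"
    using x mult_left_mono[of "v (x - a)" "real q powi (- n)" "real q powi n"] q_pos
    by (simp add: coset_def absv_mult v_prime_elt_powi power_int_minus)
  then obtain z where z: "z \<in> zeta_span K" "v (\<pp> powi (- n) * (x - a) - z) < 1"
    by (rule zeta_span_residue)
  have "x - (a + \<pp> powi n * z) = \<pp> powi n * (\<pp> powi (- n) * (x - a) - z)"
    by (simp add: algebra_simps power_int_minus)
  then have "v (x - (a + \<pp> powi n * z)) = real q powi (- n) * v (\<pp> powi (- n) * (x - a) - z)"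
    by (simp only: absv_mult v_prime_elt_powi)
  also have "\<dots> \<le> real q powi (- n) * inverse (real q)"
    using v_less_1[OF z(2)] by (intro mult_left_mono) (auto simp: less_imp_le)
  also have "\<dots> = real q powi (- (n + 1))"
    using q_pos power_int_diff[of "real q" "- n" 1] by (simp add: divide_inverse)
  finally show "x \<in> (\<Union>z\<in>zeta_span K. coset (n + 1) (a + \<pp> powi n * z))"
    using z(1) by (auto simp: coset_def)
next
  fix x assume "x \<in> (\<Union>z\<in>zeta_span K. coset (n + 1) (a + \<pp> powi n * z))"
  then obtain z where z: "z \<in> zeta_span K" "x \<in> coset (n + 1) (a + \<pp> powi n * z)"
    by auto
  have "v (\<pp> powi n * z) \<le> real q powi (- n)"
    using v_zeta_span_le[OF z(1)] by (simp add: absv_mult v_prime_elt_powi mult_left_le less_imp_le)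
  then have "a + \<pp> powi n * z \<in> coset n a"
    by (simp add: coset_def)
  moreover have "x \<in> coset n (a + \<pp> powi n * z)"
    using z(2) coset_mono[of n "n + 1"] by auto
  ultimately show "x \<in> coset n a"
    using coset_eq[of "a + \<pp> powi n * z" n a] by simp
qed

lemma disjoint_coset_split:
  "disjoint_family_on (\<lambda>z. coset (n + 1) (a + \<pp> powi n * z)) (zeta_span K)"
proof -
  have "y = z" if yz: "y \<in> zeta_span K" "z \<in> zeta_span K"
    and x: "x \<in> coset (n + 1) (a + \<pp> powi n * y)" "x \<in> coset (n + 1) (a + \<pp> powi n * z)" for x y z
  proof (rule zeta_span_residue_eq[OF yz])
    have "(x - (a + \<pp> powi n * z)) - (x - (a + \<pp> powi n * y)) = \<pp> powi n * (y - z)"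
      by (simp add: algebra_simps)
    then have "v (\<pp> powi n * (y - z)) \<le> real q powi (- (n + 1))"
      using ultrametric_diff[OF x(2)[unfolded coset_def mem_Collect_eq] x(1)[unfolded coset_def mem_Collect_eq]]
      by simp
    also have "\<dots> < real q powi (- n)"
      using q_gt_1 by (intro power_int_strict_increasing) auto
    finally show "v (y - z) < 1"
      by (simp add: absv_mult v_prime_elt_powi)
  qed
  then show ?thesis
    unfolding disjoint_family_on_def by blast
qed

lemma emeasure_coset_0: "emeasure (haar K) (coset n a) = emeasure (haar K) (coset n 0)"
proof -
  have "(\<lambda>x. a + x) ` coset n 0 = coset n a"
    by (auto simp: coset_def image_iff intro!: exI[of _ "_ - a"])
  then show ?thesis
    using haar_translation[of "coset n 0" a] by (metis coset_borel)
qed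

text \<open>Each coset of \<open>\<pp>\<^sup>n\<DD>\<close> splits into \<open>q\<close> translates of \<open>\<pp>\<^sup>n\<^sup>+\<^sup>1\<DD>\<close>.\<close>

lemma emeasure_coset [simp]: "emeasure (haar K) (coset n a) = ennreal (real q powi (- n))"
proof -
  have step: "emeasure (haar K) (coset n 0) = ennreal (real q) * emeasure (haar K) (coset (n + 1) 0)" for n
  proof -
    have "emeasure (haar K) (coset n 0) =
      (\<Sum>z\<in>zeta_span K. emeasure (haar K) (coset (n + 1) (0 + \<pp> powi n * z)))"
      unfolding coset_split[of n 0]
      using disjoint_coset_split[of n 0] finite_zeta_span
      by (intro sum_emeasure[symmetric]) auto
    also have "\<dots> = (\<Sum>z\<in>zeta_span K. emeasure (haar K) (coset (n + 1) 0))"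
      by (intro sum.cong refl) (rule emeasure_coset_0)
    finally show ?thesis
      by (simp add: card_zeta_span ennreal_of_nat_eq_real_of_nat)
  qed
  have pw: "real q powi (- n) = real q * real q powi (- (n + 1))" for n
    using q_pos power_int_add[of "real q" 1 "- (n + 1)"] by simp
  have "emeasure (haar K) (coset n 0) = ennreal (real q powi (- n))"
  proof (induction n rule: int_induct[where k = 0])
    case base
    have "coset 0 0 = int_ring K"
      by (auto simp: coset_def int_ring_def)
    then show ?case
      using haar_int_ring by simp
  next
    case (step1 i)
    have "ennreal (real q) * emeasure (haar K) (coset (i + 1) 0) =
      ennreal (real q) * ennreal (real q powi (- (i + 1)))"
      using step1(2) unfolding step[of i] pw[of i] by (simp add: ennreal_mult less_imp_le)
    then show ?case
      using q_pos by (subst (asm) ennreal_mult_cancel_left) auto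
  next
    case (step2 i)
    then show ?case
      using step[of "i - 1"] pw[of "i - 1"] by (simp add: ennreal_mult less_imp_le)
  qed
  then show ?thesis
    by (metis emeasure_coset_0)
qed

lemma measure_coset [simp]: "measure (haar K) (coset n a) = real q powi (- n)"
  by (simp add: measure_def less_imp_le)

text \<open>
  The cosets are a countable base of the topology, and two of them are nested or disjoint. So they
  form a generator, stable under intersection, of the Borel sets.
\<close>

lemma sets_borel_cosets:
  "sets (borel :: 'a measure) = sigma_sets UNIV (insert {} (range (\<lambda>(n, a). coset n a)))"
proof -
  let ?E = "insert {} (range (\<lambda>(n, a). coset n a))"
  have "sets (borel :: 'a measure) = sigma_sets UNIV {S. open S}"
    by (simp add: borel_def)
  also have "\<dots> = sigma_sets UNIV ?E"
  proof (rule sigma_sets_eqI)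
    fix U :: "'a set" assume "U \<in> {S. open S}"
    then have U: "open U"
      by simp
    have "U = (\<Union>i\<in>{(n, k). coset n (rep n k) \<subseteq> U}. coset (fst i) (rep (fst i) (snd i)))"
    proof (intro equalityI subsetI)
      fix x assume "x \<in> U"
      then obtain e where e: "e > 0" "ball x e \<subseteq> U"
        using U open_contains_ball by blast
      have "inverse (real q) < 1"
        using q_gt_1 by (simp add: inverse_less_1_iff)
      then obtain n where n: "inverse (real q) ^ n < e"
        using real_arch_pow_inv[OF e(1)] by blast
      have "coset (int n) x \<subseteq> ball x e"
        using n by (auto simp: coset_def dist_absv v_minus_commute power_int_minus power_inverse)
      moreover obtain k where k: "x \<in> coset (int n) (rep (int n) k)"
        using coset_rep_partition by blast
      ultimately have "coset (int n) (rep (int n) k) \<subseteq> U"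
        using coset_eq[OF k] e(2) by simp
      with k show "x \<in> (\<Union>i\<in>{(n, k). coset n (rep n k) \<subseteq> U}. coset (fst i) (rep (fst i) (snd i)))"
        by force
    qed auto
    also have "\<dots> \<in> sigma_sets UNIV ?E"
      by (rule sigma_sets_UNION) auto
    finally show "U \<in> sigma_sets UNIV ?E" .
  next
    fix A assume "A \<in> ?E"
    then have "A \<in> sets (borel :: 'a measure)"
      by auto
    then show "A \<in> sigma_sets UNIV {S. open S}"
      by (simp add: borel_def)
  qed
  finally show ?thesis .
qed

lemma Int_stable_cosets: "Int_stable (insert {} (range (\<lambda>(n, a). coset n a)))"
proof -
  have *: "coset m a \<inter> coset n b = {} \<or> coset m a \<inter> coset n b = coset n b" if "m \<le> n" for m n a b
  proof (cases "coset m a \<inter> coset n b = {}")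
    case False
    then obtain x where "x \<in> coset m a" "x \<in> coset n b"
      by blast
    then have "coset n b \<subseteq> coset m a"
      using coset_mono[OF that, of x] coset_eq[of x m a] coset_eq[of x n b] by simp
    then show ?thesis
      by blast
  qed simp
  define E where "E = insert {} (range (\<lambda>(n, a). coset n a))"
  have E_iff: "A \<in> E \<longleftrightarrow> A = {} \<or> (\<exists>n a. A = coset n a)" for A
    by (auto simp: E_def)
  have "coset m a \<inter> coset n b \<in> E" for m n a b
    unfolding E_iff using *[of m n a b] *[of n m b a] by (metis Int_commute linorder_le_cases)
  moreover have "{} \<in> E"
    by (simp add: E_iff)
  ultimately have "Int_stable E"
    unfolding Int_stable_def by (metis E_iff Int_empty_left Int_empty_right)
  then show ?thesis
    by (simp add: E_def)
qed

text \<open>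
  A Borel measure that is finite on the cosets is determined by its values there. Applied to an image of the Haar measure,
  this gives the transformation rules under translation and dilation.
\<close>

lemma haar_unique:
  assumes "sets M = sets borel"
    and "\<And>n a. emeasure M (coset n a) = ennreal c * emeasure (haar K) (coset n a)"
  shows "M = density (haar K) (\<lambda>_. ennreal c)"
proof (rule measure_eqI_generator_eq[OF Int_stable_cosets])
  fix X assume "X \<in> insert {} (range (\<lambda>(n, a). coset n a))"
  then show "emeasure M X = emeasure (density (haar K) (\<lambda>_. ennreal c)) X"
    using assms(2) by (auto simp: emeasure_density_const)
next
  show "range (\<lambda>k. coset 0 (rep 0 k)) \<subseteq> insert {} (range (\<lambda>(n, a). coset n a))"
    by auto
next
  show "emeasure M (coset 0 (rep 0 k)) \<noteq> \<infinity>" for k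
    by (simp add: assms(2) ennreal_mult_eq_top_iff)
qed (use assms sets_borel_cosets UN_cosets sets_haar in \<open>simp_all\<close>)

lemma translation_measurable [measurable]: "(\<lambda>x. a + x) \<in> borel_measurable (borel :: 'a measure)"
  by (intro borel_measurable_continuous_onI continuous_onI) (auto simp: dist_absv)

lemma dilation_measurable [measurable]: "(\<lambda>x. a * x) \<in> borel_measurable (borel :: 'a measure)"
proof -
  have "(v a)-lipschitz_on UNIV ((*) a)"
    by (rule lipschitz_onI) (auto simp: dist_absv absv_mult simp flip: right_diff_distrib)
  then show ?thesis
    by (intro borel_measurable_continuous_onI lipschitz_on_continuous_on)
qed

lemma haar_distr_translation: "distr (haar K) borel (\<lambda>x. a + x) = haar K"
proof -
  have "distr (haar K) borel (\<lambda>x. a + x) = density (haar K) (\<lambda>_. ennreal 1)"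
  proof (rule haar_unique)
    fix n b
    have "(\<lambda>x. a + x) -` coset n b = coset n (b - a)"
      by (auto simp: mem_coset_translate)
    then show "emeasure (distr (haar K) borel (\<lambda>x. a + x)) (coset n b) =
        ennreal 1 * emeasure (haar K) (coset n b)"
      by (subst emeasure_distr) auto
  qed simp
  then show ?thesis
    by (simp add: density_1)
qed

lemma haar_distr_dilation:
  "distr (haar K) borel (\<lambda>x. \<pp> powi j * x) = density (haar K) (\<lambda>_. ennreal (real q powi j))"
proof (rule haar_unique)
  fix n b
  have "(\<lambda>x. \<pp> powi j * x) -` coset n b = coset (n - j) (\<pp> powi (- j) * b)"
    by (auto simp: mem_coset_dilate)
  then have "emeasure (distr (haar K) borel (\<lambda>x. \<pp> powi j * x)) (coset n b) =
      ennreal (real q powi (- (n - j)))"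
    by (subst emeasure_distr) auto
  also have "real q powi (- (n - j)) = real q powi j * real q powi (- n)"
    using q_pos by (simp flip: power_int_add)
  finally show "emeasure (distr (haar K) borel (\<lambda>x. \<pp> powi j * x)) (coset n b) =
      ennreal (real q powi j) * emeasure (haar K) (coset n b)"
    by (simp add: ennreal_mult less_imp_le)
qed simp

lemma integral_translate:
  fixes f :: "'a \<Rightarrow> 'b :: {banach, second_countable_topology}"
  assumes [measurable]: "f \<in> borel_measurable (haar K)"
  shows "(\<integral>x. f (a + x) \<partial>haar K) = (\<integral>x. f x \<partial>haar K)"
proof -
  have "(\<integral>x. f x \<partial>distr (haar K) borel (\<lambda>x. a + x)) = (\<integral>x. f (a + x) \<partial>haar K)"
    by (rule integral_distr) simp_all
  then show ?thesis
    by (simp add: haar_distr_translation)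
qed

lemma integrable_translate:
  fixes f :: "'a \<Rightarrow> 'b :: {banach, second_countable_topology}"
  assumes "integrable (haar K) f"
  shows "integrable (haar K) (\<lambda>x. f (a + x))"
proof (rule integrable_distr[where T = "\<lambda>x. a + x" and M' = borel and f = f])
  show "(\<lambda>x. a + x) \<in> measurable (haar K) borel"
    by simp
  show "integrable (distr (haar K) borel (\<lambda>x. a + x)) f"
    using assms by (simp add: haar_distr_translation)
qed

lemma integral_dilate:
  fixes f :: "'a \<Rightarrow> 'b :: {banach, second_countable_topology}"
  assumes [measurable]: "f \<in> borel_measurable (haar K)"
  shows "(\<integral>x. f (\<pp> powi j * x) \<partial>haar K) = real q powi j *\<^sub>R (\<integral>x. f x \<partial>haar K)"
proof -
  have "(\<integral>x. f (\<pp> powi j * x) \<partial>haar K) = (\<integral>x. f x \<partial>distr (haar K) borel (\<lambda>x. \<pp> powi j * x))"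
    by (rule integral_distr[symmetric]) simp_all
  also have "\<dots> = (\<integral>x. real q powi j *\<^sub>R f x \<partial>haar K)"
    unfolding haar_distr_dilation by (rule integral_density) (auto simp: less_imp_le)
  finally show ?thesis
    by simp
qed

lemma integrable_dilate:
  fixes f :: "'a \<Rightarrow> 'b :: {banach, second_countable_topology}"
  assumes "integrable (haar K) f"
  shows "integrable (haar K) (\<lambda>x. f (\<pp> powi j * x))"
proof (rule integrable_distr[where T = "\<lambda>x. \<pp> powi j * x" and M' = borel and f = f])
  show "(\<lambda>x. \<pp> powi j * x) \<in> measurable (haar K) borel"
    by simp
  show "integrable (distr (haar K) borel (\<lambda>x. \<pp> powi j * x)) f"
    unfolding haar_distr_dilation
    using assms by (subst integrable_density) (auto simp: less_imp_le)
qed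

lemma AE_dilate:
  assumes "AE x in haar K. P x"
  shows "AE x in haar K. P (\<pp> powi j * x)"
proof (rule AE_distrD[where M' = borel and f = "\<lambda>x. \<pp> powi j * x" and P = P])
  show "AE x in distr (haar K) borel (\<lambda>x. \<pp> powi j * x). P x"
    unfolding haar_distr_dilation using assms by (subst AE_density) auto
qed simp

lemma chi_measurable [measurable]: "chi \<in> borel_measurable borel"
  by (intro borel_measurable_continuous_onI chr_continuous)

lemma cosets_sum_indicator:
  fixes f :: "'a \<Rightarrow> 'b :: real_normed_algebra_1"
  shows "(\<lambda>k. indicator (coset n (rep n k)) x * f x) sums f x"
proof -
  obtain k where k: "x \<in> coset n (rep n k)"
    using coset_rep_partition by blast
  then have "indicator (coset n (rep n i)) x * f x = (if i = k then f x else 0)" for i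
    using coset_rep_partition[of x n] by (auto simp: indicator_def)
  then show ?thesis
    using sums_single[of k "\<lambda>_. f x"] by simp
qed

lemma nn_integral_cosets:
  assumes [measurable]: "f \<in> borel_measurable (haar K)"
  shows "(\<integral>\<^sup>+x. f x \<partial>haar K) = (\<Sum>k. \<integral>\<^sup>+x. f x * indicator (coset n (rep n k)) x \<partial>haar K)"
proof -
  have "f x = (\<Sum>k. f x * indicator (coset n (rep n k)) x)" for x
  proof -
    obtain k where k: "x \<in> coset n (rep n k)"
      using coset_rep_partition by blast
    then have "f x * indicator (coset n (rep n i)) x = (if i = k then f x else 0)" for i
      using coset_rep_partition[of x n] by (auto simp: indicator_def)
    then show ?thesis
      using sums_unique[OF sums_single[of k "\<lambda>_. f x"]] by simp
  qed
  then have "(\<integral>\<^sup>+x. f x \<partial>haar K) = (\<integral>\<^sup>+x. (\<Sum>k. f x * indicator (coset n (rep n k)) x) \<partial>haar K)"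
    by simp
  also have "\<dots> = (\<Sum>k. \<integral>\<^sup>+x. f x * indicator (coset n (rep n k)) x \<partial>haar K)"
    by (rule nn_integral_suminf) simp
  finally show ?thesis .
qed

lemma norm_q_powi [simp]: "norm (of_nat q powi n :: complex) = real q powi n"
  by (simp add: norm_power_int)

section \<open>Fourier transforms of integrable functions\<close>

definition coset_integral :: "int \<Rightarrow> 'a \<Rightarrow> ('a \<Rightarrow> complex) \<Rightarrow> complex"
  where "coset_integral n a F = (\<integral>x. indicator (coset n a) x * F x \<partial>haar K)"

text \<open>
  The mean of \<open>F\<close> over the coset of \<open>\<pp>\<^sup>n\<DD>\<close> that contains \<open>x\<close>: the conditional expectation of \<open>F\<close>
  given the partition into these cosets.
\<close>

definition avg :: "int \<Rightarrow> ('a \<Rightarrow> complex) \<Rightarrow> 'a \<Rightarrow> complex"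
  where "avg n F x = of_real (real q powi n) * coset_integral n x F"

lemma integrable_indicator_coset_mult [intro]:
  fixes F :: "'a \<Rightarrow> complex"
  assumes "integrable (haar K) F"
  shows "integrable (haar K) (\<lambda>x. indicator (coset n a) x * F x)"
proof -
  have "integrable (haar K) (\<lambda>x. indicator (coset n a) x *\<^sub>R F x)"
    using assms by (intro integrable_mult_indicator) auto
  moreover have "indicator (coset n a) x *\<^sub>R F x = indicator (coset n a) x * F x" for x
    by (simp add: indicator_def)
  ultimately show ?thesis
    by simp
qed

lemma chi_mult_measurable [measurable]:
  "(\<lambda>x. chi (y * x)) \<in> borel_measurable (haar K)" "(\<lambda>x. cnj (chi (y * x))) \<in> borel_measurable (haar K)"
proof -
  show "(\<lambda>x. chi (y * x)) \<in> borel_measurable (haar K)" for y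
    by measurable
  from this[of "- y"] show "(\<lambda>x. cnj (chi (y * x))) \<in> borel_measurable (haar K)"
    by (simp add: chi_cnj)
qed

lemma integrable_real_indicator_coset: "integrable (haar K) (indicator (coset n a) :: 'a \<Rightarrow> real)"
  by (rule integrable_real_indicator) (auto simp: less_top[symmetric])

lemma integrable_indicator_coset [simp]:
  "integrable (haar K) (indicator (coset n a) :: 'a \<Rightarrow> complex)"
proof -
  have "integrable (haar K) (\<lambda>x. of_real (indicator (coset n a) x) :: complex)"
    by (rule integrable_of_real[OF integrable_real_indicator_coset])
  then show ?thesis
    by (simp only: of_real_indicator)
qed

lemma lebesgue_integral_indicator_coset:
  "(\<integral>x. indicator (coset n a) x \<partial>haar K) = real q powi (- n)"
  using has_bochner_integral_integral_eq[OF has_bochner_integral_real_indicator[of "coset n a" "haar K"]]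
  by (simp add: less_top[symmetric])

lemma integral_indicator_coset [simp]:
  "(\<integral>x. indicator (coset n a) x \<partial>haar K) = (of_real (real q powi (- n)) :: complex)"
proof -
  have "(\<integral>x. of_real (indicator (coset n a) x) \<partial>haar K) =
      (of_real (\<integral>x. indicator (coset n a) x \<partial>haar K) :: complex)"
    by (rule integral_of_real[OF integrable_real_indicator_coset])
  then show ?thesis
    unfolding of_real_indicator lebesgue_integral_indicator_coset .
qed

lemma summable_coset_integral:
  fixes F :: "'a \<Rightarrow> complex"
  assumes "integrable (haar K) F"
  shows "summable (\<lambda>k. \<integral>x. norm (indicator (coset n (rep n k)) x * F x) \<partial>haar K)"
proof (rule summable_suminf_not_top)
  have "(\<Sum>k. ennreal (\<integral>x. norm (indicator (coset n (rep n k)) x * F x) \<partial>haar K)) =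
      (\<Sum>k. \<integral>\<^sup>+x. ennreal (norm (F x)) * indicator (coset n (rep n k)) x \<partial>haar K)"
  proof (rule suminf_cong)
    fix k
    have "ennreal (\<integral>x. norm (indicator (coset n (rep n k)) x * F x) \<partial>haar K) =
        (\<integral>\<^sup>+x. ennreal (norm (indicator (coset n (rep n k)) x * F x)) \<partial>haar K)"
      using assms by (intro nn_integral_eq_integral[symmetric] integrable_norm) auto
    also have "\<dots> = (\<integral>\<^sup>+x. ennreal (norm (F x)) * indicator (coset n (rep n k)) x \<partial>haar K)"
      by (intro nn_integral_cong) (simp add: indicator_def)
    finally show "ennreal (\<integral>x. norm (indicator (coset n (rep n k)) x * F x) \<partial>haar K) =
      (\<integral>\<^sup>+x. ennreal (norm (F x)) * indicator (coset n (rep n k)) x \<partial>haar K)" .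
  qed
  also have "\<dots> = (\<integral>\<^sup>+x. ennreal (norm (F x)) \<partial>haar K)"
    using assms by (intro nn_integral_cosets[symmetric]) auto
  also have "\<dots> < \<infinity>"
    using assms by (simp add: integrable_iff_bounded)
  finally show "(\<Sum>k. ennreal (\<integral>x. norm (indicator (coset n (rep n k)) x * F x) \<partial>haar K)) \<noteq> top_class.top"
    by simp
qed simp

lemma sums_coset_integral:
  assumes "integrable (haar K) F"
  shows "(\<lambda>k. coset_integral n (rep n k) F) sums (\<integral>x. F x \<partial>haar K)"
proof -
  let ?f = "\<lambda>k x. indicator (coset n (rep n k)) x * F x"
  have "(\<lambda>k. integral\<^sup>L (haar K) (?f k)) sums (\<integral>x. (\<Sum>k. ?f k x) \<partial>haar K)"
  proof (rule sums_integral)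
    have "summable (\<lambda>k. norm (?f k x))" for x
    proof -
      have "norm (?f k x) = indicator (coset n (rep n k)) x * norm (F x)" for k
        by (simp add: indicator_def)
      then show ?thesis
        using cosets_sum_indicator[of n x "\<lambda>x. norm (F x)"] by (simp add: sums_iff)
    qed
    then show "AE x in haar K. summable (\<lambda>k. norm (?f k x))"
      by simp
  qed (use assms summable_coset_integral in auto)
  then show ?thesis
    using sums_unique[OF cosets_sum_indicator[of n _ F]] by (simp add: coset_integral_def)
qed

lemma norm_coset_integral_le:
  "norm (coset_integral n a F) \<le> (\<integral>x. norm (indicator (coset n a) x * F x) \<partial>haar K)"
  unfolding coset_integral_def by (rule integral_norm_bound)

lemma summable_norm_coset_integral:
  assumes "integrable (haar K) F"
  shows "summable (\<lambda>k. norm (coset_integral n (rep n k) F))"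
  using norm_coset_integral_le by (intro summable_comparison_test'[OF summable_coset_integral[OF assms]]) simp

text \<open>Integrating a nontrivial character over a subgroup gives 0, by translation invariance.\<close>

lemma integral_chi_coset:
  "(\<integral>\<xi>. indicator (coset n 0) \<xi> * chi (y * \<xi>) \<partial>haar K) =
    (if v y \<le> real q powi n then of_real (real q powi (- n)) else 0)"
proof (cases "v y \<le> real q powi n")
  case True
  have "indicator (coset n 0) \<xi> * chi (y * \<xi>) = (indicator (coset n 0) \<xi> :: complex)" for \<xi>
  proof (cases "\<xi> \<in> coset n 0")
    case \<xi>: True
    then have "v (y * \<xi>) \<le> real q powi n * real q powi (- n)"
      unfolding absv_mult by (intro mult_mono True) (auto simp: coset_def less_imp_le)
    then have "chi (y * \<xi>) = 1"
      using q_pos by (intro chi_eq_1) (simp add: power_int_minus)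
    then show ?thesis
      by simp
  qed simp
  then have "(\<integral>\<xi>. indicator (coset n 0) \<xi> * chi (y * \<xi>) \<partial>haar K) =
      (\<integral>\<xi>. indicator (coset n 0) \<xi> \<partial>haar K)"
    by (simp only:)
  then show ?thesis
    using True by simp
next
  case False
  then have "v (y * \<pp> powi n) > 1"
    using q_pos by (simp add: absv_mult v_prime_elt_powi power_int_minus field_simps)
  then obtain x where x: "v x \<le> 1" "chi (y * \<pp> powi n * x) \<noteq> 1"
    by (rule chi_nontrivial)
  define w where "w = \<pp> powi n * x"
  define I where "I = (\<integral>\<xi>. indicator (coset n 0) \<xi> * chi (y * \<xi>) \<partial>haar K)"
  have w: "w \<in> coset n 0"
    using x(1) by (simp add: w_def coset_def absv_mult v_prime_elt_powi mult_left_le less_imp_le)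
  have shift: "w + \<xi> \<in> coset n 0 \<longleftrightarrow> \<xi> \<in> coset n 0" for \<xi>
  proof -
    have "coset n (- w) = coset n 0"
      using w by (intro coset_eq) (simp add: coset_def)
    then show ?thesis
      by (simp add: mem_coset_translate)
  qed
  \<comment> \<open>Translation by \<open>w\<close> preserves \<open>\<pp>\<^sup>n\<DD>\<close> and multiplies \<open>I\<close> by \<open>\<chi>(y w) \<noteq> 1\<close>.\<close>
  have "I = (\<integral>\<xi>. indicator (coset n 0) (w + \<xi>) * chi (y * (w + \<xi>)) \<partial>haar K)"
    unfolding I_def by (rule integral_translate[symmetric]) simp
  also have "\<dots> = (\<integral>\<xi>. chi (y * w) * (indicator (coset n 0) \<xi> * chi (y * \<xi>)) \<partial>haar K)"
    using shift by (intro Bochner_Integration.integral_cong) (auto simp: indicator_def ring_distribs chr_add)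
  also have "\<dots> = chi (y * w) * I"
    unfolding I_def by (rule integral_mult_right_zero)
  finally have "I = 0"
    using x(2) by (simp add: w_def mult.assoc)
  then show ?thesis
    using False by (simp add: I_def)
qed

text \<open>
  For \<open>\<xi>\<close> in \<open>\<pp>\<^sup>-\<^sup>n\<DD>\<close> the character \<open>\<chi>\<^sub>\<xi>\<close> is constant on the cosets of \<open>\<pp>\<^sup>n\<DD>\<close>. Hence the Fourier
  transform is on \<open>\<pp>\<^sup>-\<^sup>n\<DD>\<close> an absolutely convergent sum of characters.
\<close>

lemma fourier_L1_sums:
  assumes "integrable (haar K) F" and "\<xi> \<in> coset (- n) 0"
  shows "(\<lambda>k. coset_integral n (rep n k) F * cnj (chi (\<xi> * rep n k))) sums fourier_L1 K F \<xi>"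
proof -
  have int: "integrable (haar K) (\<lambda>x. F x * cnj (chi (\<xi> * x)))"
    by (rule Bochner_Integration.integrable_bound[OF assms(1)])
      (use assms(1) chi_mult_measurable in \<open>auto simp: norm_mult chr_norm\<close>)
  have "coset_integral n (rep n k) (\<lambda>x. F x * cnj (chi (\<xi> * x))) =
    coset_integral n (rep n k) F * cnj (chi (\<xi> * rep n k))" for k
  proof -
    have "indicator (coset n (rep n k)) x * (F x * cnj (chi (\<xi> * x))) =
      indicator (coset n (rep n k)) x * F x * cnj (chi (\<xi> * rep n k))" for x
    proof (cases "x \<in> coset n (rep n k)")
      case True
      then have "v (\<xi> * (x - rep n k)) \<le> real q powi n * real q powi (- n)"
        unfolding absv_mult using assms(2) by (intro mult_mono) (auto simp: coset_def less_imp_le)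
      then have "chi (\<xi> * (x - rep n k)) = 1"
        using q_pos by (intro chi_eq_1) (simp add: power_int_minus)
      moreover have "\<xi> * x = \<xi> * (x - rep n k) + \<xi> * rep n k"
        by (simp add: algebra_simps)
      ultimately have "chi (\<xi> * x) = chi (\<xi> * rep n k)"
        by (metis chr_add mult_1)
      then show ?thesis
        by simp
    qed simp
    then show ?thesis
      unfolding coset_integral_def by (simp only: integral_mult_left_zero)
  qed
  then show ?thesis
    using sums_coset_integral[OF int, of n] by (simp add: fourier_L1_def)
qed

text \<open>
  On each \<open>\<pp>\<^sup>-\<^sup>n\<DD>\<close> the Fourier transform is a pointwise limit of finite sums of characters.
\<close>

lemma borel_measurable_fourier_L1:
  assumes "integrable (haar K) F"
  shows "fourier_L1 K F \<in> borel_measurable (haar K)"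
proof -
  have "(\<lambda>\<xi>. indicator (coset (- n) 0) \<xi> * fourier_L1 K F \<xi>) \<in> borel_measurable (haar K)" for n
  proof (rule borel_measurable_LIMSEQ_metric)
    fix \<xi>
    show "(\<lambda>m. indicator (coset (- n) 0) \<xi> *
        (\<Sum>k<m. coset_integral n (rep n k) F * cnj (chi (\<xi> * rep n k)))) \<longlonglongrightarrow>
      indicator (coset (- n) 0) \<xi> * fourier_L1 K F \<xi>"
      using fourier_L1_sums[OF assms, of \<xi> n]
      by (cases "\<xi> \<in> coset (- n) 0") (auto simp: sums_def)
  next
    fix m
    have [measurable]: "(\<lambda>\<xi>. cnj (chi (\<xi> * rep n k))) \<in> borel_measurable (haar K)" for k
      using chi_mult_measurable(2)[of "rep n k"] by (simp add: mult.commute)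
    then show "(\<lambda>\<xi>. indicator (coset (- n) 0) \<xi> *
        (\<Sum>k<m. coset_integral n (rep n k) F * cnj (chi (\<xi> * rep n k)))) \<in> borel_measurable (haar K)"
      by measurable
  qed
  then show ?thesis
  proof (rule borel_measurable_LIMSEQ_metric)
    fix \<xi>
    obtain N where N: "v \<xi> < real q ^ N"
      using real_arch_pow[of "real q" "v \<xi>"] q_gt_1 by auto
    have "\<forall>n\<ge>N. indicator (coset (- int n) 0) \<xi> * fourier_L1 K F \<xi> = fourier_L1 K F \<xi>"
    proof (intro allI impI)
      fix n assume "N \<le> n"
      then have "real q ^ N \<le> real q ^ n"
        using q_pos by (intro power_increasing) auto
      then show "indicator (coset (- int n) 0) \<xi> * fourier_L1 K F \<xi> = fourier_L1 K F \<xi>"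
        using N by (simp add: coset_def)
    qed
    then show "(\<lambda>n. indicator (coset (- int n) 0) \<xi> * fourier_L1 K F \<xi>) \<longlonglongrightarrow> fourier_L1 K F \<xi>"
      by (intro tendsto_eventually) (auto simp: eventually_sequentially)
  qed
qed

text \<open>
  The characters \<open>\<xi> \<mapsto> \<chi>(\<xi> \<pp>\<^sup>n u(k))\<close> are orthogonal on \<open>\<pp>\<^sup>-\<^sup>n\<DD>\<close>, so that the norm of the sum in
  \<open>fourier_L1_sums\<close> can be read off from its coefficients. The partial sums of that series are
  uniformly bounded, and dominated convergence justifies the passage from finite sums.
\<close>

lemma plancherel_truncated:
  assumes F: "integrable (haar K) F"
  shows "(\<integral>\<^sup>+\<xi>. ennreal ((cmod (fourier_L1 K F \<xi>))\<^sup>2) * indicator (coset (- n) 0) \<xi> \<partial>haar K) =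
    (\<Sum>k. ennreal (real q powi n * (cmod (coset_integral n (rep n k) F))\<^sup>2))"
proof -
  define c where "c k = coset_integral n (rep n k) F" for k
  define e where "e k \<xi> = cnj (chi (\<xi> * rep n k))" for k \<xi>
  define P :: "'a \<Rightarrow> complex" where "P = indicator (coset (- n) 0)"
  define s where "s m \<xi> = (\<Sum>k<m. c k * e k \<xi>)" for m \<xi>
  define C where "C = (\<Sum>k. norm (c k))"
  have sum_c: "summable (\<lambda>k. norm (c k))"
    unfolding c_def by (rule summable_norm_coset_integral[OF F])
  have e_norm: "norm (e k \<xi>) = 1" for k \<xi>
    by (simp add: e_def chr_norm)
  have [measurable]: "e k \<in> borel_measurable (haar K)" for k
    using chi_mult_measurable(2)[of "rep n k"] unfolding e_def by (simp add: mult.commute)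
  have [measurable]: "P \<in> borel_measurable (haar K)" "fourier_L1 K F \<in> borel_measurable (haar K)"
    using F by (simp_all add: P_def borel_measurable_fourier_L1)
  have int_P: "integrable (haar K) P" "integrable (haar K) (\<lambda>\<xi>. norm (P \<xi>))"
    by (simp_all add: P_def)
  have orth: "(\<integral>\<xi>. P \<xi> * (e k \<xi> * cnj (e l \<xi>)) \<partial>haar K) =
      (if k = l then of_real (real q powi n) else 0)" for k l
  proof -
    have "P \<xi> * (e k \<xi> * cnj (e l \<xi>)) = P \<xi> * chi ((rep n l - rep n k) * \<xi>)" for \<xi>
      using chr_add[of "- (\<xi> * rep n k)" "\<xi> * rep n l"]
      by (simp add: e_def chi_cnj algebra_simps)
    moreover have "v (rep n l - rep n k) \<le> real q powi (- n) \<longleftrightarrow> k = l"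
    proof -
      have "v (rep n l - rep n k) \<le> real q powi (- n) \<longleftrightarrow> rep n l \<in> coset n (rep n k)"
        by (simp add: coset_def)
      then show ?thesis
        using coset_rep_partition[of "rep n l" n] by (metis coset_self)
    qed
    ultimately show ?thesis
      using integral_chi_coset[of "- n" "rep n l - rep n k"] by (simp only: P_def) simp
  qed
  have int_ee: "integrable (haar K) (\<lambda>\<xi>. P \<xi> * (e k \<xi> * cnj (e l \<xi>)))" for k l
    by (rule Bochner_Integration.integrable_bound[OF int_P(1)]) (auto simp: norm_mult e_norm)
  have ss: "(\<integral>\<xi>. P \<xi> * (s m \<xi> * cnj (s m \<xi>)) \<partial>haar K) =
      of_real (\<Sum>k<m. real q powi n * (cmod (c k))\<^sup>2)" for m
  proof -
    have "(\<integral>\<xi>. P \<xi> * (s m \<xi> * cnj (s m \<xi>)) \<partial>haar K) =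
        (\<integral>\<xi>. (\<Sum>k<m. \<Sum>l<m. (c k * cnj (c l)) * (P \<xi> * (e k \<xi> * cnj (e l \<xi>)))) \<partial>haar K)"
    proof -
      have "s m \<xi> * cnj (s m \<xi>) = (\<Sum>k<m. \<Sum>l<m. (c k * e k \<xi>) * (cnj (c l) * cnj (e l \<xi>)))" for \<xi>
        unfolding s_def cnj_sum sum_product by simp
      then show ?thesis
        by (simp add: sum_distrib_left ac_simps)
    qed
    also have "\<dots> = (\<Sum>k<m. \<Sum>l<m. (c k * cnj (c l)) * (if k = l then of_real (real q powi n) else 0))"
      by (simp add: int_ee orth)
    also have "\<dots> = (\<Sum>k<m. (c k * cnj (c k)) * of_real (real q powi n))"
      by (intro sum.cong refl) (simp add: if_distrib cong: if_cong)
    finally show ?thesis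
      by (simp add: mult.commute flip: complex_norm_square)
  qed
  have s_lim: "(\<lambda>m. s m \<xi>) \<longlonglongrightarrow> fourier_L1 K F \<xi>" if "\<xi> \<in> coset (- n) 0" for \<xi>
    using fourier_L1_sums[OF F that] by (simp add: sums_def s_def c_def e_def)
  have s_le: "norm (s m \<xi>) \<le> C" for m \<xi>
  proof -
    have "norm (s m \<xi>) \<le> (\<Sum>k<m. norm (c k))"
      unfolding s_def by (rule order_trans[OF norm_sum]) (simp add: norm_mult e_norm)
    also have "\<dots> \<le> C"
      unfolding C_def by (rule sum_le_suminf[OF sum_c]) auto
    finally show ?thesis .
  qed
  let ?g = "\<lambda>\<xi>. P \<xi> * (fourier_L1 K F \<xi> * cnj (fourier_L1 K F \<xi>))"
  have dom: "AE \<xi> in haar K. (\<lambda>m. P \<xi> * (s m \<xi> * cnj (s m \<xi>))) \<longlonglongrightarrow> ?g \<xi>"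
    "\<And>m. AE \<xi> in haar K. norm (P \<xi> * (s m \<xi> * cnj (s m \<xi>))) \<le> norm (P \<xi>) * (C * C)"
    "integrable (haar K) (\<lambda>\<xi>. norm (P \<xi>) * (C * C))"
    "\<And>m. (\<lambda>\<xi>. P \<xi> * (s m \<xi> * cnj (s m \<xi>))) \<in> borel_measurable (haar K)"
  proof -
    show "AE \<xi> in haar K. (\<lambda>m. P \<xi> * (s m \<xi> * cnj (s m \<xi>))) \<longlonglongrightarrow> ?g \<xi>"
    proof (rule AE_I2)
      fix \<xi>
      show "(\<lambda>m. P \<xi> * (s m \<xi> * cnj (s m \<xi>))) \<longlonglongrightarrow> ?g \<xi>"
        using s_lim[of \<xi>] by (cases "\<xi> \<in> coset (- n) 0") (auto simp: P_def intro!: tendsto_intros)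
    qed
    show "AE \<xi> in haar K. norm (P \<xi> * (s m \<xi> * cnj (s m \<xi>))) \<le> norm (P \<xi>) * (C * C)" for m
      using s_le order_trans[OF norm_ge_zero s_le]
      by (intro AE_I2) (auto simp: norm_mult intro!: mult_left_mono mult_mono)
    show "(\<lambda>\<xi>. P \<xi> * (s m \<xi> * cnj (s m \<xi>))) \<in> borel_measurable (haar K)" for m
      unfolding s_def by measurable
    show "integrable (haar K) (\<lambda>\<xi>. norm (P \<xi>) * (C * C))"
      using int_P by (intro integrable_mult_left) auto
  qed
  have int_g: "integrable (haar K) ?g"
    by (rule integrable_dominated_convergence[OF _ dom(4,3,1,2)]) measurable
  have "(\<lambda>m. \<integral>\<xi>. P \<xi> * (s m \<xi> * cnj (s m \<xi>)) \<partial>haar K) \<longlonglongrightarrow> integral\<^sup>L (haar K) ?g"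
    by (rule integral_dominated_convergence[OF _ dom(4,3,1,2)]) measurable
  then have "(\<lambda>m. Re (of_real (\<Sum>k<m. real q powi n * (cmod (c k))\<^sup>2))) \<longlonglongrightarrow> Re (integral\<^sup>L (haar K) ?g)"
    unfolding ss by (rule tendsto_Re)
  then have "(\<lambda>k. real q powi n * (cmod (c k))\<^sup>2) sums Re (integral\<^sup>L (haar K) ?g)"
    by (simp only: sums_def Re_complex_of_real)
  then have sums: "(\<Sum>k. ennreal (real q powi n * (cmod (c k))\<^sup>2)) = ennreal (Re (integral\<^sup>L (haar K) ?g))"
    using q_pos by (intro suminf_ennreal_eq) (auto simp: less_imp_le)
  have Re_g: "Re (?g \<xi>) = indicator (coset (- n) 0) \<xi> * (cmod (fourier_L1 K F \<xi>))\<^sup>2" for \<xi>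
    by (simp add: P_def indicator_def flip: complex_norm_square)
  have "(\<integral>\<^sup>+\<xi>. ennreal ((cmod (fourier_L1 K F \<xi>))\<^sup>2) * indicator (coset (- n) 0) \<xi> \<partial>haar K) =
      (\<integral>\<^sup>+\<xi>. ennreal (Re (?g \<xi>)) \<partial>haar K)"
    unfolding Re_g by (intro nn_integral_cong) (simp add: indicator_def)
  also have "\<dots> = ennreal (\<integral>\<xi>. Re (?g \<xi>) \<partial>haar K)"
    by (rule nn_integral_eq_integral[OF integrable_Re[OF int_g]]) (simp only: Re_g, simp)
  also have "(\<integral>\<xi>. Re (?g \<xi>) \<partial>haar K) = Re (integral\<^sup>L (haar K) ?g)"
    by (rule integral_Re[OF int_g])
  finally show ?thesis
    unfolding sums[symmetric] c_def .
qed

section \<open>Averages over cosets\<close>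

lemma avg_eq:
  assumes "x \<in> coset n (rep n k)"
  shows "avg n F x = of_real (real q powi n) * coset_integral n (rep n k) F"
  using coset_eq[OF assms] by (simp add: avg_def coset_integral_def)

lemma borel_measurable_avg [measurable]: "avg n F \<in> borel_measurable (haar K)"
proof (rule borel_measurable_LIMSEQ_metric)
  fix x
  have "indicator (coset n (rep n k)) x * avg n F x =
    indicator (coset n (rep n k)) x * (of_real (real q powi n) * coset_integral n (rep n k) F)" for k
    using avg_eq[of x n k F] by (cases "x \<in> coset n (rep n k)") auto
  then show "(\<lambda>m. \<Sum>k<m. indicator (coset n (rep n k)) x *
      (of_real (real q powi n) * coset_integral n (rep n k) F)) \<longlonglongrightarrow> avg n F x"
    using cosets_sum_indicator[of n x "avg n F"] unfolding sums_def by (simp only:)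
qed measurable

lemma nn_integral_avg:
  fixes \<Phi> :: "complex \<Rightarrow> ennreal"
  assumes [measurable]: "\<Phi> \<in> borel_measurable borel"
  shows "(\<integral>\<^sup>+x. \<Phi> (avg n F x) \<partial>haar K) =
    (\<Sum>k. \<Phi> (of_real (real q powi n) * coset_integral n (rep n k) F) * ennreal (real q powi (- n)))"
proof -
  have "(\<integral>\<^sup>+x. \<Phi> (avg n F x) \<partial>haar K) =
      (\<Sum>k. \<integral>\<^sup>+x. \<Phi> (avg n F x) * indicator (coset n (rep n k)) x \<partial>haar K)"
    by (rule nn_integral_cosets) measurable
  also have "\<dots> = (\<Sum>k. \<integral>\<^sup>+x. \<Phi> (of_real (real q powi n) * coset_integral n (rep n k) F) *
      indicator (coset n (rep n k)) x \<partial>haar K)"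
    by (intro suminf_cong nn_integral_cong) (auto simp: avg_eq indicator_def)
  finally show ?thesis
    by (simp add: nn_integral_cmult_indicator)
qed

lemma ennreal_square_q_powi:
  "ennreal ((cmod (of_real (real q powi n) * c))\<^sup>2) * ennreal (real q powi (- n)) =
    ennreal (real q powi n * (cmod c)\<^sup>2)"
proof -
  have "(cmod (of_real (real q powi n) * c))\<^sup>2 * real q powi (- n) = real q powi n * (cmod c)\<^sup>2"
    using q_pos by (simp add: norm_mult power_mult_distrib power2_eq_square power_int_minus)
  then show ?thesis
    by (subst ennreal_mult[symmetric]) (simp_all add: less_imp_le)
qed

text \<open>
  Truncating the Fourier transform to \<open>\<pp>\<^sup>-\<^sup>n\<DD>\<close> corresponds to averaging over the cosets of \<open>\<pp>\<^sup>n\<DD>\<close>: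
  both sides are computed from the integrals of \<open>F\<close> over these cosets.
\<close>

lemma plancherel_avg:
  assumes F: "integrable (haar K) F"
  shows "(\<integral>\<^sup>+\<xi>. ennreal ((cmod (fourier_L1 K F \<xi>))\<^sup>2) * indicator (coset (- n) 0) \<xi> \<partial>haar K) =
    (\<integral>\<^sup>+x. ennreal ((cmod (avg n F x))\<^sup>2) \<partial>haar K)"
proof -
  have "(\<lambda>z. ennreal ((cmod z)\<^sup>2)) \<in> borel_measurable borel"
    by measurable
  from nn_integral_avg[OF this] show ?thesis
    unfolding plancherel_truncated[OF F] ennreal_square_q_powi by (rule sym)
qed

lemma nn_integral_norm_avg_le:
  assumes F: "integrable (haar K) F"
  shows "(\<integral>\<^sup>+x. norm (avg n F x) \<partial>haar K) \<le> (\<integral>\<^sup>+x. norm (F x) \<partial>haar K)"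
proof -
  have "(\<integral>\<^sup>+x. norm (avg n F x) \<partial>haar K) = (\<Sum>k. ennreal (norm (coset_integral n (rep n k) F)))"
  proof -
    have "ennreal (cmod (of_real (real q powi n) * c)) * ennreal (real q powi (- n)) = ennreal (cmod c)" for c
      using q_pos by (simp add: norm_mult power_int_minus flip: ennreal_mult)
    moreover have "(\<lambda>z. ennreal (cmod z)) \<in> borel_measurable borel"
      by measurable
    ultimately show ?thesis
      using nn_integral_avg[of "\<lambda>z. ennreal (norm z)" n F] by (simp only:)
  qed
  also have "\<dots> \<le> (\<Sum>k. \<integral>\<^sup>+x. ennreal (norm (F x)) * indicator (coset n (rep n k)) x \<partial>haar K)"
  proof (rule suminf_le)
    fix k
    have "ennreal (norm (coset_integral n (rep n k) F)) \<le>
        (\<integral>\<^sup>+x. norm (indicator (coset n (rep n k)) x * F x) \<partial>haar K)"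
      unfolding coset_integral_def using F by (intro integral_norm_bound_ennreal) auto
    also have "\<dots> = (\<integral>\<^sup>+x. ennreal (norm (F x)) * indicator (coset n (rep n k)) x \<partial>haar K)"
      by (intro nn_integral_cong) (simp add: indicator_def)
    finally show "ennreal (norm (coset_integral n (rep n k) F)) \<le>
      (\<integral>\<^sup>+x. ennreal (norm (F x)) * indicator (coset n (rep n k)) x \<partial>haar K)" .
  qed (rule summableI)+
  also have "\<dots> = (\<integral>\<^sup>+x. norm (F x) \<partial>haar K)"
    using F by (intro nn_integral_cosets[symmetric]) auto
  finally show ?thesis .
qed

text \<open>
  Cauchy-Schwarz on each coset.
\<close>

lemma nn_integral_norm_avg_square_le:
  assumes F: "integrable (haar K) F"
  shows "(\<integral>\<^sup>+x. ennreal ((norm (avg n F x))\<^sup>2) \<partial>haar K) \<le> (\<integral>\<^sup>+x. ennreal ((norm (F x))\<^sup>2) \<partial>haar K)"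
proof -
  have [measurable]: "F \<in> borel_measurable (haar K)"
    using F by auto
  have "(\<integral>\<^sup>+x. ennreal ((norm (avg n F x))\<^sup>2) \<partial>haar K) =
      (\<Sum>k. ennreal (real q powi n) * (ennreal (norm (coset_integral n (rep n k) F)))\<^sup>2)"
  proof -
    have measurable_meas: "(\<lambda>z. ennreal ((cmod z)\<^sup>2)) \<in> borel_measurable borel"
      by measurable
    have "ennreal ((cmod (of_real (real q powi n) * c))\<^sup>2) * ennreal (real q powi (- n)) =
      ennreal (real q powi n) * (ennreal (cmod c))\<^sup>2" for c
      unfolding ennreal_square_q_powi by (simp add: ennreal_mult ennreal_power less_imp_le)
    then show ?thesis
      using nn_integral_avg[of "\<lambda>z. ennreal ((norm z)\<^sup>2)" n F] by (simp only: measurable_meas)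
  qed
  also have "\<dots> \<le> (\<Sum>k. \<integral>\<^sup>+x. ennreal ((norm (F x))\<^sup>2) * indicator (coset n (rep n k)) x \<partial>haar K)"
  proof (rule suminf_le)
    fix k
    let ?I = "indicator (coset n (rep n k)) :: 'a \<Rightarrow> ennreal"
    have "ennreal (norm (coset_integral n (rep n k) F)) \<le>
        (\<integral>\<^sup>+x. norm (indicator (coset n (rep n k)) x * F x) \<partial>haar K)"
      unfolding coset_integral_def using F by (intro integral_norm_bound_ennreal) auto
    also have "\<dots> = (\<integral>\<^sup>+x. (ennreal (norm (F x)) * ?I x) * ?I x \<partial>haar K)"
      by (intro nn_integral_cong) (simp add: indicator_def)
    finally have "(ennreal (norm (coset_integral n (rep n k) F)))\<^sup>2 \<le>
        (\<integral>\<^sup>+x. (ennreal (norm (F x)) * ?I x) * ?I x \<partial>haar K)\<^sup>2"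
      by (rule power_mono) simp
    also have "\<dots> \<le> (\<integral>\<^sup>+x. (ennreal (norm (F x)) * ?I x)\<^sup>2 \<partial>haar K) * (\<integral>\<^sup>+x. (?I x)\<^sup>2 \<partial>haar K)"
      by (rule Cauchy_Schwarz_nn_integral) measurable
    also have "(\<integral>\<^sup>+x. (?I x)\<^sup>2 \<partial>haar K) = (\<integral>\<^sup>+x. ?I x \<partial>haar K)"
      by (intro nn_integral_cong) (simp add: indicator_def)
    also have "(\<integral>\<^sup>+x. (ennreal (norm (F x)) * ?I x)\<^sup>2 \<partial>haar K) =
        (\<integral>\<^sup>+x. ennreal ((norm (F x))\<^sup>2) * ?I x \<partial>haar K)"
      by (intro nn_integral_cong) (simp add: indicator_def ennreal_power)
    finally have "ennreal (real q powi n) * (ennreal (norm (coset_integral n (rep n k) F)))\<^sup>2 \<le>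
        ennreal (real q powi n) *
          ((\<integral>\<^sup>+x. ennreal ((norm (F x))\<^sup>2) * ?I x \<partial>haar K) * ennreal (real q powi (- n)))"
      by (intro mult_left_mono) auto
    also have "\<dots> = (ennreal (real q powi n) * ennreal (real q powi (- n))) *
        (\<integral>\<^sup>+x. ennreal ((norm (F x))\<^sup>2) * ?I x \<partial>haar K)"
      by (simp only: ac_simps)
    also have "ennreal (real q powi n) * ennreal (real q powi (- n)) = 1"
      using q_pos by (simp add: power_int_minus flip: ennreal_mult)
    finally show "ennreal (real q powi n) * (ennreal (norm (coset_integral n (rep n k) F)))\<^sup>2 \<le>
        (\<integral>\<^sup>+x. ennreal ((norm (F x))\<^sup>2) * ?I x \<partial>haar K)"
      by simp
  qed (rule summableI)+
  also have "\<dots> = (\<integral>\<^sup>+x. ennreal ((norm (F x))\<^sup>2) \<partial>haar K)"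
    by (intro nn_integral_cosets[symmetric]) measurable
  finally show ?thesis .
qed

text \<open>
  Convergence of the averages to \<open>F\<close> in \<open>L\<^sup>1\<close>. It is preserved by sums, multiples and limits, which
  reduces the case of an integrable \<open>F\<close> to indicators of cosets.
\<close>

definition avg_converges :: "('a \<Rightarrow> complex) \<Rightarrow> bool"
  where "avg_converges F \<longleftrightarrow> integrable (haar K) F \<and>
    (\<lambda>n :: nat. \<integral>x. norm (avg (int n) F x - F x) \<partial>haar K) \<longlonglongrightarrow> 0"

lemma avg_add:
  assumes "integrable (haar K) F" "integrable (haar K) G"
  shows "avg n (\<lambda>x. F x + G x) x = avg n F x + avg n G x"
proof -
  have "coset_integral n x (\<lambda>x. F x + G x) = coset_integral n x F + coset_integral n x G"
    using assms by (simp add: coset_integral_def ring_distribs integrable_indicator_coset_mult)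
  then show ?thesis
    by (simp add: avg_def ring_distribs)
qed

lemma avg_mult: "avg n (\<lambda>x. c * F x) x = c * avg n F x"
proof -
  have "coset_integral n x (\<lambda>x. c * F x) = c * coset_integral n x F"
    unfolding coset_integral_def
    by (simp only: mult.left_commute[of _ c] integral_mult_right_zero)
  then show ?thesis
    by (simp add: avg_def)
qed

lemma avg_diff:
  assumes "integrable (haar K) F" "integrable (haar K) G"
  shows "avg n (\<lambda>x. F x - G x) x = avg n F x - avg n G x"
  using avg_add[OF assms(1) integrable_mult_right[of "- 1"], OF assms(2)] avg_mult[of n "- 1" G]
  by simp

lemma integrable_avg [simp]:
  assumes "integrable (haar K) F"
  shows "integrable (haar K) (avg n F)"
proof (rule integrableI_bounded)
  have "(\<integral>\<^sup>+x. norm (avg n F x) \<partial>haar K) \<le> (\<integral>\<^sup>+x. norm (F x) \<partial>haar K)"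
    by (rule nn_integral_norm_avg_le[OF assms])
  also have "\<dots> < \<infinity>"
    using assms by (simp add: integrable_iff_bounded)
  finally show "(\<integral>\<^sup>+x. norm (avg n F x) \<partial>haar K) < \<infinity>" .
qed measurable

lemma integral_norm_avg_le:
  assumes "integrable (haar K) F"
  shows "(\<integral>x. norm (avg n F x) \<partial>haar K) \<le> (\<integral>x. norm (F x) \<partial>haar K)"
  using nn_integral_norm_avg_le[OF assms, of n] assms
  by (simp add: nn_integral_eq_integral integrable_avg)

lemma avg_converges_add:
  assumes "avg_converges F" "avg_converges G"
  shows "avg_converges (\<lambda>x. F x + G x)"
proof -
  have int: "integrable (haar K) F" "integrable (haar K) G"
    using assms by (auto simp: avg_converges_def)
  let ?e = "\<lambda>F n. \<integral>x. norm (avg (int n) F x - F x) \<partial>haar K"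
  have "(\<lambda>n. ?e F n + ?e G n) \<longlonglongrightarrow> 0"
    using assms tendsto_add[of "?e F" 0 sequentially "?e G" 0] by (simp add: avg_converges_def)
  then have "?e (\<lambda>x. F x + G x) \<longlonglongrightarrow> 0"
  proof (rule tendsto_sandwich[OF _ _ tendsto_const, rotated 2])
    have "?e (\<lambda>x. F x + G x) n \<le> ?e F n + ?e G n" for n
    proof -
      have "?e (\<lambda>x. F x + G x) n \<le>
          (\<integral>x. norm (avg (int n) F x - F x) + norm (avg (int n) G x - G x) \<partial>haar K)"
        using int by (intro integral_mono) (auto simp: avg_add norm_diff_triangle_ineq)
      then show ?thesis
        using int by simp
    qed
    then show "\<forall>\<^sub>F n in sequentially. ?e (\<lambda>x. F x + G x) n \<le> ?e F n + ?e G n"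
      by simp
  qed simp
  then show ?thesis
    using int by (simp add: avg_converges_def)
qed

lemma avg_converges_mult:
  assumes "avg_converges F"
  shows "avg_converges (\<lambda>x. c * F x)"
proof -
  have "norm (avg n (\<lambda>x. c * F x) x - c * F x) = norm c * norm (avg n F x - F x)" for n x
    by (simp add: avg_mult norm_mult flip: right_diff_distrib)
  then show ?thesis
    using assms tendsto_mult_right_zero[of "\<lambda>n. \<integral>x. norm (avg (int n) F x - F x) \<partial>haar K" sequentially "norm c"]
    by (simp add: avg_converges_def)
qed

text \<open>Averaging is a contraction, so convergence passes to \<open>L\<^sup>1\<close> limits.\<close>

lemma avg_converges_limit:
  assumes F: "integrable (haar K) F" and s: "\<And>i. avg_converges (s i)"
    and lim: "(\<lambda>i. \<integral>x. norm (F x - s i x) \<partial>haar K) \<longlonglongrightarrow> 0"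
  shows "avg_converges F"
proof -
  let ?e = "\<lambda>F n. \<integral>x. norm (avg (int n) F x - F x) \<partial>haar K"
  have int_s: "integrable (haar K) (s i)" for i
    using s by (simp add: avg_converges_def)
  have "?e F \<longlonglongrightarrow> 0"
  proof (rule LIMSEQ_I)
    fix r :: real assume r: "r > 0"
    then have "\<exists>no. \<forall>n\<ge>no. norm ((\<integral>x. norm (F x - s n x) \<partial>haar K) - 0) < r / 3"
      by (intro LIMSEQ_D[OF lim]) simp
    then obtain i where i: "norm ((\<integral>x. norm (F x - s i x) \<partial>haar K) - 0) < r / 3"
      by blast
    have "?e (s i) \<longlonglongrightarrow> 0"
      using s by (simp add: avg_converges_def)
    then have "\<exists>no. \<forall>n\<ge>no. norm (?e (s i) n - 0) < r / 3"
      using r by (intro LIMSEQ_D[where X = "?e (s i)"]) simp_all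
    then obtain no where no: "\<And>n. n \<ge> no \<Longrightarrow> norm (?e (s i) n - 0) < r / 3"
      by blast
    have "norm (?e F n - 0) < r" if "n \<ge> no" for n
    proof -
      have int_d: "integrable (haar K) (\<lambda>x. F x - s i x)"
        using F int_s by simp
      have "avg (int n) F x - F x = avg (int n) (\<lambda>x. F x - s i x) x +
        (avg (int n) (s i) x - s i x) - (F x - s i x)" for x
        using avg_diff[OF F int_s] by simp
      moreover have "norm (a + b - c) \<le> norm a + norm b + norm c" for a b c :: complex
        by (rule order_trans[OF norm_triangle_ineq4]) (simp add: norm_triangle_ineq)
      ultimately have "norm (avg (int n) F x - F x) \<le> norm (avg (int n) (\<lambda>x. F x - s i x) x) +
        norm (avg (int n) (s i) x - s i x) + norm (F x - s i x)" for x
        by presburger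
      then have "?e F n \<le> (\<integral>x. norm (avg (int n) (\<lambda>x. F x - s i x) x) +
          norm (avg (int n) (s i) x - s i x) + norm (F x - s i x) \<partial>haar K)"
        using F int_s int_d by (intro integral_mono) auto
      also have "\<dots> = (\<integral>x. norm (avg (int n) (\<lambda>x. F x - s i x) x) \<partial>haar K) + ?e (s i) n +
          (\<integral>x. norm (F x - s i x) \<partial>haar K)"
        using F int_s int_d by simp
      also have "\<dots> < r"
        using integral_norm_avg_le[OF int_d, of "int n"] i no[OF that] by simp
      finally show ?thesis
        by simp
    qed
    then show "\<exists>no. \<forall>n\<ge>no. norm (?e F n - 0) < r"
      by blast
  qed
  then show ?thesis
    using F by (simp add: avg_converges_def)
qed

text \<open>
  For \<open>n \<ge> m\<close> the cosets of \<open>\<pp>\<^sup>n\<DD>\<close> refine those of \<open>\<pp>\<^sup>m\<DD>\<close>, and averaging changes nothing.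
\<close>

lemma avg_converges_coset: "avg_converges (indicator (coset m a))"
proof -
  have "avg n (indicator (coset m a)) x = indicator (coset m a) x" if "m \<le> n" for n x
  proof (cases "x \<in> coset m a")
    case True
    then have "coset n x \<subseteq> coset m a"
      using coset_mono[OF that, of x] coset_eq[OF True] by simp
    then have "indicator (coset n x) y * indicator (coset m a) y = (indicator (coset n x) y :: complex)" for y
      by (auto simp: indicator_def)
    then have "coset_integral n x (indicator (coset m a)) = of_real (real q powi (- n))"
      unfolding coset_integral_def by (simp only: integral_indicator_coset)
    then show ?thesis
      using True q_pos by (simp add: avg_def power_int_minus)
  next
    case False
    have "y \<notin> coset m a" if "y \<in> coset n x" for y
    proof
      assume "y \<in> coset m a"
      then have "coset m a = coset m y"
        using coset_eq by simp
      moreover have "x \<in> coset m y"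
        using \<open>y \<in> coset n x\<close> coset_mono[OF \<open>m \<le> n\<close>, of y] mem_coset_commute[of x n y] by auto
      ultimately show False
        using False by simp
    qed
    then have "indicator (coset n x) y * indicator (coset m a) y = (0 :: complex)" for y
      by (auto simp: indicator_def)
    then have "coset_integral n x (indicator (coset m a)) = 0"
      unfolding coset_integral_def by (simp only: Bochner_Integration.integral_zero)
    then show ?thesis
      using False by (simp add: avg_def)
  qed
  then have "\<forall>n\<ge>nat m. (\<integral>x. norm (avg (int n) (indicator (coset m a)) x - indicator (coset m a) x) \<partial>haar K) = 0"
    by simp
  then have "(\<lambda>n. \<integral>x. norm (avg (int n) (indicator (coset m a)) x - indicator (coset m a) x) \<partial>haar K) \<longlonglongrightarrow> 0"
    by (intro tendsto_eventually) (simp only: eventually_sequentially, rule exI)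
  then show ?thesis
    by (simp add: avg_converges_def)
qed

lemma avg_converges_zero: "avg_converges (\<lambda>x. 0)"
  using avg_converges_mult[OF avg_converges_coset, of 0] by simp

lemma avg_converges_UN:
  fixes A :: "nat \<Rightarrow> 'a set"
  assumes "disjoint_family A" and [measurable]: "\<And>i. A i \<in> sets (haar K)"
    and A: "\<And>i. avg_converges (indicator (A i))"
    and fin: "emeasure (haar K) (\<Union>i. A i) < \<infinity>"
  shows "avg_converges (indicator (\<Union>i. A i))"
proof (rule avg_converges_limit)
  let ?U = "indicator (\<Union>i. A i) :: 'a \<Rightarrow> complex"
  let ?s = "\<lambda>m x. \<Sum>i<m. indicator (A i) x :: complex"
  have s_eq: "?s m x = indicator (\<Union>i<m. A i) x" for m x
  proof -
    have "disjoint_family_on A {..<m}"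
      using assms(1) by (rule disjoint_family_on_mono[rotated]) simp
    then show ?thesis
      by (subst indicator_UN_disjoint) auto
  qed
  have "integrable (haar K) (indicator (\<Union>i. A i) :: 'a \<Rightarrow> real)"
    using fin by (intro integrable_real_indicator) auto
  then have int_U: "integrable (haar K) (\<lambda>x. of_real (indicator (\<Union>i. A i) x) :: complex)"
    by (rule integrable_of_real)
  then show "integrable (haar K) ?U"
    by (simp only: of_real_indicator)
  have "avg_converges (?s m)" for m
    by (induction m) (simp_all add: avg_converges_zero avg_converges_add A)
  then show "avg_converges (?s m)" for m .
  have "(\<lambda>m. \<integral>x. norm (?U x - ?s m x) \<partial>haar K) \<longlonglongrightarrow> (\<integral>x. 0 \<partial>haar K)"
  proof (rule integral_dominated_convergence[where w = "\<lambda>x. norm (?U x)"])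
    show "AE x in haar K. (\<lambda>m. norm (?U x - ?s m x)) \<longlonglongrightarrow> 0"
    proof (rule AE_I2)
      fix x
      have "\<exists>N. \<forall>m\<ge>N. ?U x = ?s m x"
      proof (cases "x \<in> (\<Union>i. A i)")
        case True
        then obtain i where "x \<in> A i"
          by auto
        then have "\<forall>m\<ge>Suc i. ?U x = ?s m x"
          unfolding s_eq by (auto simp: indicator_def)
        then show ?thesis ..
      next
        case False
        then show ?thesis
          unfolding s_eq by (auto simp: indicator_def)
      qed
      then show "(\<lambda>m. norm (?U x - ?s m x)) \<longlonglongrightarrow> 0"
        by (intro tendsto_eventually) (auto simp: eventually_sequentially)
    qed
    show "AE x in haar K. norm (norm (?U x - ?s m x)) \<le> norm (?U x)" for m
      unfolding s_eq by (intro AE_I2) (auto simp: indicator_def)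
    show "integrable (haar K) (\<lambda>x. norm (?U x))"
      using integrable_norm[OF int_U] by (simp only: of_real_indicator)
  qed measurable
  then show "(\<lambda>m. \<integral>x. norm (?U x - ?s m x) \<partial>haar K) \<longlonglongrightarrow> 0"
    by simp
qed

text \<open>
  Intersecting with a fixed coset keeps all measures finite, so that the induction over the Borel
  sets can pass to complements.
\<close>

lemma avg_converges_Int_coset:
  assumes "A \<in> sets borel"
  shows "avg_converges (indicator (A \<inter> coset n a))"
proof -
  let ?E = "insert {} (range (\<lambda>(n, a). coset n a))"
  have "?E \<subseteq> Pow UNIV" "A \<in> sigma_sets UNIV ?E"
    using assms sets_borel_cosets by simp_all
  with Int_stable_cosets show ?thesis
  proof (induction rule: sigma_sets_induct_disjoint)
    case (basic A)
    then have "A \<inter> coset n a \<in> ?E"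
      using Int_stable_cosets by (rule_tac Int_stableD) auto
    then show ?case
      using avg_converges_coset avg_converges_zero by (auto simp: indicator_def[of "{}"])
  next
    case empty
    then show ?case
      using avg_converges_zero by (simp add: indicator_def)
  next
    case (compl A)
    have eq: "indicator ((UNIV - A) \<inter> coset n a) = (\<lambda>x. indicator (coset n a) x + (- 1) * indicator (A \<inter> coset n a) x :: complex)"
      by (auto simp: indicator_def)
    show ?case
      unfolding eq by (intro avg_converges_add avg_converges_coset avg_converges_mult compl(2))
  next
    case (union A)
    have meas: "A i \<in> sets borel" for i
      using union sets_borel_cosets by auto
    have "avg_converges (indicator (\<Union>i. A i \<inter> coset n a))"
    proof (rule avg_converges_UN)
      show "disjoint_family (\<lambda>i. A i \<inter> coset n a)"
        using union(1) by (auto simp: disjoint_family_on_def)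
      have "emeasure (haar K) (\<Union>i. A i \<inter> coset n a) \<le> emeasure (haar K) (coset n a)"
        by (intro emeasure_mono) auto
      then show "emeasure (haar K) (\<Union>i. A i \<inter> coset n a) < \<infinity>"
        by (simp add: le_less_trans)
    qed (use union meas in \<open>auto simp: sets_haar\<close>)
    then show ?case
      by (simp add: Int_UN_distrib2)
  qed
qed

lemma avg_converges_integrable:
  assumes "integrable (haar K) F"
  shows "avg_converges F"
  using assms
proof (induction F rule: integrable_induct)
  case (base A c)
  have A: "(\<Union>k. A \<inter> coset 0 (rep 0 k)) = A"
    by (simp only: Int_UN_distrib[symmetric] UN_cosets) simp
  have "avg_converges (indicator (\<Union>k. A \<inter> coset 0 (rep 0 k)))"
  proof (rule avg_converges_UN)
    show "disjoint_family (\<lambda>k. A \<inter> coset 0 (rep 0 k))"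
      using disjoint_cosets[of 0] by (auto simp: disjoint_family_on_def)
    show "emeasure (haar K) (\<Union>k. A \<inter> coset 0 (rep 0 k)) < \<infinity>"
      using base unfolding A by simp
  qed (use base avg_converges_Int_coset in \<open>auto simp: sets_haar\<close>)
  then have "avg_converges (indicator A)"
    unfolding A .
  moreover have "indicator A x *\<^sub>R c = c * indicator A x" for x
    by (simp add: indicator_def)
  ultimately show ?case
    using avg_converges_mult[of "indicator A" c] by simp
next
  case (add F G)
  then show ?case
    by (intro avg_converges_add)
next
  case (lim F s)
  have "(\<lambda>i. \<integral>x. norm (F x - s i x) \<partial>haar K) \<longlonglongrightarrow> (\<integral>x. 0 \<partial>haar K)"
  proof (rule integral_dominated_convergence[where w = "\<lambda>x. 3 * norm (F x)"])
    show "AE x in haar K. (\<lambda>i. norm (F x - s i x)) \<longlonglongrightarrow> 0"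
    proof (rule AE_I2)
      fix x assume "x \<in> space (haar K)"
      then have "(\<lambda>i. F x - s i x) \<longlonglongrightarrow> F x - F x"
        using lim by (intro tendsto_intros) auto
      then show "(\<lambda>i. norm (F x - s i x)) \<longlonglongrightarrow> 0"
        by (simp add: tendsto_norm_zero_iff)
    qed
    show "AE x in haar K. norm (norm (F x - s i x)) \<le> 3 * norm (F x)" for i
    proof (rule AE_I2)
      fix x assume "x \<in> space (haar K)"
      then show "norm (norm (F x - s i x)) \<le> 3 * norm (F x)"
        using lim.hyps(3)[of x i] norm_triangle_ineq4[of "F x" "s i x"] by simp
    qed
  qed (use lim in auto)
  then show ?case
    using lim by (intro avg_converges_limit[of F s]) auto
qed

text \<open>
  Plancherel's theorem holds for integrable functions in the extended sense: both sides may be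
  infinite. By \<open>plancherel_avg\<close> the left side is the supremum of the squared \<open>L\<^sup>2\<close> norms of the
  averages of \<open>F\<close>, which are at most that of \<open>F\<close>; Fatou's lemma gives the other inequality.
\<close>

theorem plancherel_L1:
  assumes F: "integrable (haar K) F"
  shows "(\<integral>\<^sup>+\<xi>. ennreal ((cmod (fourier_L1 K F \<xi>))\<^sup>2) \<partial>haar K) =
    (\<integral>\<^sup>+x. ennreal ((cmod (F x))\<^sup>2) \<partial>haar K)"
proof (rule antisym)
  have [measurable]: "F \<in> borel_measurable (haar K)" "fourier_L1 K F \<in> borel_measurable (haar K)"
    by (rule borel_measurable_integrable[OF F], rule borel_measurable_fourier_L1[OF F])
  let ?h = "\<lambda>n \<xi>. ennreal ((cmod (fourier_L1 K F \<xi>))\<^sup>2) * indicator (coset (- int n) 0) \<xi>"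
  have lim_h: "ennreal ((cmod (fourier_L1 K F \<xi>))\<^sup>2) = liminf (\<lambda>n. ?h n \<xi>)" for \<xi>
  proof -
    obtain N where N: "v \<xi> < real q ^ N"
      using real_arch_pow[of "real q" "v \<xi>"] q_gt_1 by auto
    have "\<xi> \<in> coset (- int n) 0" if "n \<ge> N" for n
    proof -
      have "real q ^ N \<le> real q ^ n"
        using q_pos that by (intro power_increasing) auto
      then show ?thesis
        using N by (simp add: coset_def)
    qed
    then have "\<forall>n\<ge>N. ?h n \<xi> = ennreal ((cmod (fourier_L1 K F \<xi>))\<^sup>2)"
      by simp
    then have "(\<lambda>n. ?h n \<xi>) \<longlonglongrightarrow> ennreal ((cmod (fourier_L1 K F \<xi>))\<^sup>2)"
      by (intro tendsto_eventually) (auto simp: eventually_sequentially)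
    then show ?thesis
      by (rule lim_imp_Liminf[OF sequentially_bot, symmetric])
  qed
  have "(\<integral>\<^sup>+\<xi>. ennreal ((cmod (fourier_L1 K F \<xi>))\<^sup>2) \<partial>haar K) =
      (\<integral>\<^sup>+\<xi>. liminf (\<lambda>n. ?h n \<xi>) \<partial>haar K)"
    by (intro nn_integral_cong lim_h)
  also have "\<dots> \<le> liminf (\<lambda>n. \<integral>\<^sup>+\<xi>. ?h n \<xi> \<partial>haar K)"
    by (rule nn_integral_liminf) measurable
  also have "\<dots> \<le> (\<integral>\<^sup>+x. ennreal ((cmod (F x))\<^sup>2) \<partial>haar K)"
    unfolding plancherel_avg[OF F]
    by (rule Liminf_le) (use nn_integral_norm_avg_square_le[OF F] in auto)
  finally show "(\<integral>\<^sup>+\<xi>. ennreal ((cmod (fourier_L1 K F \<xi>))\<^sup>2) \<partial>haar K) \<le>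
    (\<integral>\<^sup>+x. ennreal ((cmod (F x))\<^sup>2) \<partial>haar K)" .
  have "(\<lambda>n. \<integral>x. norm (avg (int n) F x - F x) \<partial>haar K) \<longlonglongrightarrow> 0"
    using avg_converges_integrable[OF F] by (simp add: avg_converges_def)
  then obtain r where r: "AE x in haar K. (\<lambda>n. avg (int (r n)) F x - F x) \<longlonglongrightarrow> 0"
    using tendsto_L1_AE_subseq[of "haar K" "\<lambda>n x. avg (int n) F x - F x"] F by auto
  have "(\<integral>\<^sup>+x. ennreal ((cmod (F x))\<^sup>2) \<partial>haar K) =
      (\<integral>\<^sup>+x. liminf (\<lambda>n. ennreal ((cmod (avg (int (r n)) F x))\<^sup>2)) \<partial>haar K)"
  proof (rule nn_integral_cong_AE, use r in eventually_elim)
    fix x assume "(\<lambda>n. avg (int (r n)) F x - F x) \<longlonglongrightarrow> 0"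
    then have "(\<lambda>n. ennreal ((cmod (avg (int (r n)) F x))\<^sup>2)) \<longlonglongrightarrow> ennreal ((cmod (F x))\<^sup>2)"
      by (intro tendsto_ennrealI tendsto_power tendsto_norm) (simp add: LIM_zero_iff)
    then show "ennreal ((cmod (F x))\<^sup>2) = liminf (\<lambda>n. ennreal ((cmod (avg (int (r n)) F x))\<^sup>2))"
      by (rule lim_imp_Liminf[OF sequentially_bot, symmetric])
  qed
  also have "\<dots> \<le> liminf (\<lambda>n. \<integral>\<^sup>+x. ennreal ((cmod (avg (int (r n)) F x))\<^sup>2) \<partial>haar K)"
    by (rule nn_integral_liminf) measurable
  also have "\<dots> \<le> (\<integral>\<^sup>+\<xi>. ennreal ((cmod (fourier_L1 K F \<xi>))\<^sup>2) \<partial>haar K)"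
    unfolding plancherel_avg[OF F, symmetric]
    by (rule Liminf_le) (auto intro!: eventuallyI always_eventually nn_integral_mono simp: indicator_def)
  finally show "(\<integral>\<^sup>+x. ennreal ((cmod (F x))\<^sup>2) \<partial>haar K) \<le>
    (\<integral>\<^sup>+\<xi>. ennreal ((cmod (fourier_L1 K F \<xi>))\<^sup>2) \<partial>haar K)" .
qed

section \<open>The Hilbert space of square integrable functions\<close>

lemma L2_measurable [measurable_dest]: "f \<in> L2 K \<Longrightarrow> f \<in> borel_measurable (haar K)"
  by (simp add: L2_def)

lemma L2_integrable: "f \<in> L2 K \<Longrightarrow> integrable (haar K) (\<lambda>x. (cmod (f x))\<^sup>2)"
  by (simp add: L2_def)

lemma L2_norm_nonneg [simp]: "L2_norm K f \<ge> 0"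
  by (simp add: L2_norm_def)

lemma L2_norm_square: "(L2_norm K f)\<^sup>2 = (\<integral>x. (cmod (f x))\<^sup>2 \<partial>haar K)"
  by (simp add: L2_norm_def)

lemma nn_integral_L2:
  "f \<in> L2 K \<Longrightarrow> (\<integral>\<^sup>+x. ennreal ((cmod (f x))\<^sup>2) \<partial>haar K) = ennreal ((L2_norm K f)\<^sup>2)"
  by (simp add: L2_norm_square nn_integral_eq_integral L2_integrable)

lemma L2I_nn_integral:
  assumes [measurable]: "f \<in> borel_measurable (haar K)"
    and "(\<integral>\<^sup>+x. ennreal ((cmod (f x))\<^sup>2) \<partial>haar K) < \<infinity>"
  shows "f \<in> L2 K"
  using assms(2) by (auto simp: L2_def intro!: integrableI_bounded)

lemma L2_integrable_mult:
  assumes "f \<in> L2 K" "g \<in> L2 K"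
  shows "integrable (haar K) (\<lambda>x. f x * cnj (g x))"
proof (rule Bochner_Integration.integrable_bound)
  show "integrable (haar K) (\<lambda>x. (cmod (f x))\<^sup>2 + (cmod (g x))\<^sup>2)"
    using assms by (intro Bochner_Integration.integrable_add L2_integrable)
  have "cmod a * cmod b \<le> (cmod a)\<^sup>2 + (cmod b)\<^sup>2" for a b
    using sum_squares_bound[of "cmod a" "cmod b"] mult_nonneg_nonneg[OF norm_ge_zero[of a] norm_ge_zero[of b]] by linarith
  then show "AE x in haar K. norm (f x * cnj (g x)) \<le> norm ((cmod (f x))\<^sup>2 + (cmod (g x))\<^sup>2)"
    by (intro AE_I2) (simp add: norm_mult)
  show "(\<lambda>x. f x * cnj (g x)) \<in> borel_measurable (haar K)"
    using assms[THEN L2_measurable] by measurable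
qed

lemma L2_zero [simp]: "(\<lambda>x. 0) \<in> L2 K"
  by (simp add: L2_def)

lemma L2_add:
  assumes "f \<in> L2 K" "g \<in> L2 K"
  shows "(\<lambda>x. f x + g x) \<in> L2 K"
proof -
  have "integrable (haar K) (\<lambda>x. (cmod (f x + g x))\<^sup>2)"
  proof (rule Bochner_Integration.integrable_bound)
    show "integrable (haar K) (\<lambda>x. 2 * ((cmod (f x))\<^sup>2 + (cmod (g x))\<^sup>2))"
      using assms by (intro integrable_mult_right Bochner_Integration.integrable_add L2_integrable)
    have "(cmod (a + b))\<^sup>2 \<le> 2 * ((cmod a)\<^sup>2 + (cmod b)\<^sup>2)" for a b
    proof -
      have "(cmod (a + b))\<^sup>2 \<le> (cmod a + cmod b)\<^sup>2"
        by (intro power_mono norm_triangle_ineq) simp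
      then show ?thesis
        using sum_squares_bound[of "cmod a" "cmod b"] by (simp add: power2_sum)
    qed
    then show "AE x in haar K. norm ((cmod (f x + g x))\<^sup>2) \<le> norm (2 * ((cmod (f x))\<^sup>2 + (cmod (g x))\<^sup>2))"
      by (intro AE_I2) simp
  qed (use assms[THEN L2_measurable] in measurable)
  then show ?thesis
    using assms[THEN L2_measurable] by (simp add: L2_def)
qed

lemma L2_scale: "f \<in> L2 K \<Longrightarrow> (\<lambda>x. c * f x) \<in> L2 K"
  by (auto simp: L2_def norm_mult power_mult_distrib intro!: borel_measurable_times)

lemma L2_diff: "f \<in> L2 K \<Longrightarrow> g \<in> L2 K \<Longrightarrow> (\<lambda>x. f x - g x) \<in> L2 K"
  using L2_add[OF _ L2_scale[of g "- 1"]] by simp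

lemma L2_sum: "(\<And>i. i \<in> I \<Longrightarrow> f i \<in> L2 K) \<Longrightarrow> (\<lambda>x. \<Sum>i\<in>I. f i x) \<in> L2 K"
  by (induction I rule: infinite_finite_induct) (simp_all add: L2_add)

lemma L2_inner_add_left:
  assumes "f \<in> L2 K" "g \<in> L2 K" "h \<in> L2 K"
  shows "L2_inner K (\<lambda>x. f x + g x) h = L2_inner K f h + L2_inner K g h"
  using assms by (simp add: L2_inner_def ring_distribs L2_integrable_mult)

lemma L2_inner_scale_left: "L2_inner K (\<lambda>x. c * f x) h = c * L2_inner K f h"
  by (simp add: L2_inner_def mult.assoc)

lemma L2_inner_commute: "L2_inner K g f = cnj (L2_inner K f g)"
  unfolding L2_inner_def by (subst Bochner_Integration.integral_cnj[symmetric]) (simp add: mult.commute)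

lemma L2_inner_add_right:
  assumes "f \<in> L2 K" "g \<in> L2 K" "h \<in> L2 K"
  shows "L2_inner K f (\<lambda>x. g x + h x) = L2_inner K f g + L2_inner K f h"
  using arg_cong[OF L2_inner_add_left[OF assms(2,3,1)], of cnj]
  by (simp flip: L2_inner_commute)

lemma L2_inner_scale_right: "L2_inner K f (\<lambda>x. c * h x) = cnj c * L2_inner K f h"
  by (subst (1 2) L2_inner_commute) (simp add: L2_inner_scale_left)

lemma L2_inner_sum_left:
  assumes "\<And>i. i \<in> I \<Longrightarrow> f i \<in> L2 K" "h \<in> L2 K"
  shows "L2_inner K (\<lambda>x. \<Sum>i\<in>I. f i x) h = (\<Sum>i\<in>I. L2_inner K (f i) h)"
  using assms(1)
proof (induction I rule: infinite_finite_induct)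
  case (insert i I)
  then show ?case
    using assms(2) by (simp add: L2_inner_add_left L2_sum)
qed (simp_all add: L2_inner_def)

lemma L2_inner_self: "L2_inner K f f = of_real ((L2_norm K f)\<^sup>2)"
  unfolding L2_norm_square L2_inner_def
  by (simp flip: integral_complex_of_real complex_norm_square)

lemma L2_norm_scale: "L2_norm K (\<lambda>x. c * f x) = cmod c * L2_norm K f"
  by (simp add: L2_norm_def norm_mult power_mult_distrib real_sqrt_mult)

lemma L2_norm_add_square:
  assumes "f \<in> L2 K" "g \<in> L2 K"
  shows "(L2_norm K (\<lambda>x. f x + g x))\<^sup>2 =
    (L2_norm K f)\<^sup>2 + (L2_norm K g)\<^sup>2 + 2 * Re (L2_inner K f g)"
proof -
  have "L2_inner K (\<lambda>x. f x + g x) (\<lambda>x. f x + g x) =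
      L2_inner K f f + L2_inner K g g + (L2_inner K f g + cnj (L2_inner K f g))"
    using assms by (simp add: L2_inner_add_left L2_inner_add_right L2_add flip: L2_inner_commute)
  from arg_cong[OF this, of Re] show ?thesis
    by (simp add: L2_inner_self del: of_real_power)
qed

lemma L2_cauchy_schwarz:
  assumes f: "f \<in> L2 K" and g: "g \<in> L2 K"
  shows "cmod (L2_inner K f g) \<le> L2_norm K f * L2_norm K g"
proof -
  have [measurable]: "f \<in> borel_measurable (haar K)" "g \<in> borel_measurable (haar K)"
    using f g by (simp_all add: L2_measurable)
  have "ennreal (cmod (L2_inner K f g)) \<le> (\<integral>\<^sup>+x. norm (f x * cnj (g x)) \<partial>haar K)"
    unfolding L2_inner_def by (rule integral_norm_bound_ennreal) (rule L2_integrable_mult[OF f g])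
  also have "\<dots> = (\<integral>\<^sup>+x. ennreal (cmod (f x)) * ennreal (cmod (g x)) \<partial>haar K)"
    by (intro nn_integral_cong) (simp add: norm_mult ennreal_mult)
  finally have "(ennreal (cmod (L2_inner K f g)))\<^sup>2 \<le>
      (\<integral>\<^sup>+x. ennreal (cmod (f x)) * ennreal (cmod (g x)) \<partial>haar K)\<^sup>2"
    by (rule power_mono) simp
  also have "\<dots> \<le> (\<integral>\<^sup>+x. (ennreal (cmod (f x)))\<^sup>2 \<partial>haar K) * (\<integral>\<^sup>+x. (ennreal (cmod (g x)))\<^sup>2 \<partial>haar K)"
    by (rule Cauchy_Schwarz_nn_integral) measurable
  also have "\<dots> = ennreal ((L2_norm K f * L2_norm K g)\<^sup>2)"
    by (simp add: ennreal_power nn_integral_L2[OF f] nn_integral_L2[OF g] power_mult_distrib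
        flip: ennreal_mult)
  finally have "(cmod (L2_inner K f g))\<^sup>2 \<le> (L2_norm K f * L2_norm K g)\<^sup>2"
    by (simp add: ennreal_power)
  then show ?thesis
    by (rule power2_le_imp_le) simp
qed

lemma L2_norm_triangle:
  assumes "f \<in> L2 K" "g \<in> L2 K"
  shows "L2_norm K (\<lambda>x. f x + g x) \<le> L2_norm K f + L2_norm K g"
proof (rule power2_le_imp_le)
  have "Re (L2_inner K f g) \<le> L2_norm K f * L2_norm K g"
    using L2_cauchy_schwarz[OF assms] complex_Re_le_cmod order_trans by blast
  then show "(L2_norm K (\<lambda>x. f x + g x))\<^sup>2 \<le> (L2_norm K f + L2_norm K g)\<^sup>2"
    unfolding L2_norm_add_square[OF assms] by (simp add: power2_sum)
qed simp

lemma L2_norm_diff_commute: "L2_norm K (\<lambda>x. f x - g x) = L2_norm K (\<lambda>x. g x - f x)"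
  by (simp add: L2_norm_def norm_minus_commute)

lemma L2_norm_diff_triangle:
  assumes "f \<in> L2 K" "g \<in> L2 K" "h \<in> L2 K"
  shows "L2_norm K (\<lambda>x. f x - h x) \<le> L2_norm K (\<lambda>x. f x - g x) + L2_norm K (\<lambda>x. g x - h x)"
  using L2_norm_triangle[OF L2_diff[OF assms(1,2)] L2_diff[OF assms(2,3)]] by simp

lemma L2_norm_triangle_ineq3:
  assumes "f \<in> L2 K" "g \<in> L2 K"
  shows "\<bar>L2_norm K f - L2_norm K g\<bar> \<le> L2_norm K (\<lambda>x. f x - g x)"
  using L2_norm_diff_triangle[OF assms L2_zero] L2_norm_diff_triangle[OF assms(2,1) L2_zero]
  by (simp add: L2_norm_diff_commute[of g f])

lemma L2_norm_tendsto:
  assumes "\<And>n. F n \<in> L2 K" "f \<in> L2 K" "(\<lambda>n. L2_norm K (\<lambda>x. F n x - f x)) \<longlonglongrightarrow> 0"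
  shows "(\<lambda>n. L2_norm K (F n)) \<longlonglongrightarrow> L2_norm K f"
proof (rule LIM_zero_cancel)
  show "(\<lambda>n. L2_norm K (F n) - L2_norm K f) \<longlonglongrightarrow> 0"
    by (rule Lim_null_comparison[OF _ assms(3)]) (use L2_norm_triangle_ineq3 assms in auto)
qed

text \<open>
  The series of the squared increments, weighted by \<open>2\<^sup>n\<close>, has finite integral, so a sequence that
  is Cauchy at a geometric rate converges pointwise almost everywhere.
\<close>

lemma L2_complete:
  assumes h: "\<And>n. h n \<in> L2 K"
    and fast: "\<And>n. L2_norm K (\<lambda>x. h (Suc n) x - h n x) \<le> 2 * (1 / 4) ^ n"
  obtains g where "g \<in> L2 K" "(\<lambda>n. L2_norm K (\<lambda>x. h n x - g x)) \<longlonglongrightarrow> 0"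
proof -
  have [measurable]: "h n \<in> borel_measurable (haar K)" for n
    using h by (rule L2_measurable)
  define g where "g x = lim (\<lambda>n. h n x)" for x
  have [measurable]: "g \<in> borel_measurable (haar K)"
    unfolding g_def by measurable
  let ?d = "\<lambda>n x. 2 ^ n * (cmod (h (Suc n) x - h n x))\<^sup>2"
  have "(\<integral>\<^sup>+x. (\<Sum>n. ennreal (?d n x)) \<partial>haar K) = (\<Sum>n. \<integral>\<^sup>+x. ennreal (?d n x) \<partial>haar K)"
    by (rule nn_integral_suminf) measurable
  also have "\<dots> \<le> (\<Sum>n. ennreal (4 * (1 / 8) ^ n))"
  proof (rule suminf_le)
    fix n
    have "(\<integral>\<^sup>+x. ennreal (?d n x) \<partial>haar K) =
        ennreal (2 ^ n) * (\<integral>\<^sup>+x. ennreal ((cmod (h (Suc n) x - h n x))\<^sup>2) \<partial>haar K)"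
      by (subst nn_integral_cmult[symmetric]) (auto simp: ennreal_mult intro!: nn_integral_cong)
    also have "\<dots> = ennreal (2 ^ n * (L2_norm K (\<lambda>x. h (Suc n) x - h n x))\<^sup>2)"
      using nn_integral_L2[OF L2_diff[OF h h]] by (simp add: ennreal_mult)
    also have "\<dots> \<le> ennreal (2 ^ n * (2 * (1 / 4) ^ n)\<^sup>2)"
      by (intro ennreal_leI mult_left_mono power_mono fast) auto
    also have "2 ^ n * (2 * (1 / 4) ^ n)\<^sup>2 = 4 * (1 / 8 :: real) ^ n"
      by (simp add: power2_eq_square power_mult_distrib[symmetric] mult.assoc[symmetric])
    finally show "(\<integral>\<^sup>+x. ennreal (?d n x) \<partial>haar K) \<le> ennreal (4 * (1 / 8) ^ n)" .
  qed (rule summableI)+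
  also have "\<dots> = ennreal (\<Sum>n. 4 * (1 / 8) ^ n)"
    by (rule suminf_ennreal2) (auto intro!: summable_mult summable_geometric)
  also have "\<dots> < \<infinity>"
    by simp
  finally have "AE x in haar K. (\<Sum>n. ennreal (?d n x)) \<noteq> \<infinity>"
    by (intro nn_integral_PInf_AE) auto
  then have lim: "AE x in haar K. (\<lambda>n. h n x) \<longlonglongrightarrow> g x"
  proof eventually_elim
    fix x assume "(\<Sum>n. ennreal (?d n x)) \<noteq> \<infinity>"
    then have "summable (\<lambda>n. ?d n x)"
      by (intro summable_suminf_not_top) auto
    then have "Bseq (\<lambda>n. ?d n x)"
      by (intro convergent_imp_Bseq summable_LIMSEQ_zero[THEN convergentI])
    then obtain C where C: "C > 0" "\<And>n. ?d n x \<le> C"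
      by (auto simp: Bseq_def norm_mult)
    have "cmod (h (Suc n) x - h n x) \<le> sqrt C * (1 / sqrt 2) ^ n" for n
    proof (rule power2_le_imp_le)
      have "(cmod (h (Suc n) x - h n x))\<^sup>2 \<le> C / 2 ^ n"
        using C(2)[of n] by (simp add: field_simps)
      also have "\<dots> = (sqrt C * (1 / sqrt 2) ^ n)\<^sup>2"
      proof -
        have "(sqrt 2 ^ n)\<^sup>2 = (2 :: real) ^ n"
          by (metis mult.commute power_mult real_sqrt_pow2 zero_le_numeral)
        then show ?thesis
          using C(1) by (simp add: power_mult_distrib power_divide)
      qed
      finally show "(cmod (h (Suc n) x - h n x))\<^sup>2 \<le> (sqrt C * (1 / sqrt 2) ^ n)\<^sup>2" .
    qed (use C(1) in simp)
    moreover have "summable (\<lambda>n. sqrt C * (1 / sqrt 2) ^ n)"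
      by (intro summable_mult summable_geometric) auto
    ultimately have "summable (\<lambda>n. h (Suc n) x - h n x)"
      by (rule summable_comparison_test'[rotated]) 
    then have "convergent (\<lambda>n. h n x - h 0 x)"
      by (simp add: summable_iff_convergent sum_lessThan_telescope[of "\<lambda>n. h n x"])
    then have "convergent (\<lambda>n. (h n x - h 0 x) + h 0 x)"
      by (intro convergent_add convergent_const)
    then have "convergent (\<lambda>n. h n x)"
      by simp
    then show "(\<lambda>n. h n x) \<longlonglongrightarrow> g x"
      unfolding g_def by (simp add: convergent_LIMSEQ_iff)
  qed
  \<comment> \<open>The geometric series \<open>2 (1/4)\<^sup>n (1 + 1/4 + \<dots>)\<close> has the sum \<open>8/3 (1/4)\<^sup>n\<close>.\<close>
  have dist: "L2_norm K (\<lambda>x. h (n + k) x - h n x) \<le> 8 / 3 * (1 / 4) ^ n * (1 - (1 / 4) ^ k)" for n k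
  proof (induction k)
    case 0
    then show ?case
      by (simp add: L2_norm_def)
  next
    case (Suc k)
    have "L2_norm K (\<lambda>x. h (n + Suc k) x - h n x) \<le>
        2 * (1 / 4) ^ (n + k) + 8 / 3 * (1 / 4) ^ n * (1 - (1 / 4) ^ k)"
      using L2_norm_diff_triangle[OF h[of "n + Suc k"] h[of "n + k"] h[of n]] fast[of "n + k"] Suc.IH
      by simp
    also have "\<dots> = 8 / 3 * (1 / 4) ^ n * (1 - (1 / 4) ^ Suc k)"
    proof -
      have "2 * (a * b) + 8 / 3 * a * (1 - b) = 8 / 3 * a * (1 - 1 / 4 * b)" for a b :: real
        by (simp add: field_simps)
      then show ?thesis
        by (simp only: power_add power_Suc)
    qed
    finally show ?case .
  qed
  have bound: "(\<integral>\<^sup>+x. ennreal ((cmod (h n x - g x))\<^sup>2) \<partial>haar K) \<le> ennreal ((8 / 3 * (1 / 4) ^ n)\<^sup>2)" for n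
  proof -
    have "(\<integral>\<^sup>+x. ennreal ((cmod (h n x - g x))\<^sup>2) \<partial>haar K) =
        (\<integral>\<^sup>+x. liminf (\<lambda>k. ennreal ((cmod (h (n + k) x - h n x))\<^sup>2)) \<partial>haar K)"
    proof (rule nn_integral_cong_AE, use lim in eventually_elim)
      fix x assume "(\<lambda>n. h n x) \<longlonglongrightarrow> g x"
      then have "(\<lambda>k. h (n + k) x) \<longlonglongrightarrow> g x"
        using LIMSEQ_ignore_initial_segment[of _ "g x" n] by (simp add: add.commute)
      then have "(\<lambda>k. ennreal ((cmod (h (n + k) x - h n x))\<^sup>2)) \<longlonglongrightarrow> ennreal ((cmod (g x - h n x))\<^sup>2)"
        by (intro tendsto_ennrealI tendsto_intros)
      then have "liminf (\<lambda>k. ennreal ((cmod (h (n + k) x - h n x))\<^sup>2)) = ennreal ((cmod (g x - h n x))\<^sup>2)"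
        by (rule lim_imp_Liminf[OF sequentially_bot])
      then show "ennreal ((cmod (h n x - g x))\<^sup>2) = liminf (\<lambda>k. ennreal ((cmod (h (n + k) x - h n x))\<^sup>2))"
        by (simp add: norm_minus_commute)
    qed
    also have "\<dots> \<le> liminf (\<lambda>k. \<integral>\<^sup>+x. ennreal ((cmod (h (n + k) x - h n x))\<^sup>2) \<partial>haar K)"
      by (rule nn_integral_liminf) measurable
    also have "\<dots> \<le> ennreal ((8 / 3 * (1 / 4) ^ n)\<^sup>2)"
    proof (rule Liminf_le[OF sequentially_bot])
      have "L2_norm K (\<lambda>x. h (n + k) x - h n x) \<le> 8 / 3 * (1 / 4) ^ n" for k
        using dist[of n k] by (rule order_trans) (simp add: mult_left_le)
      then have "(\<integral>\<^sup>+x. ennreal ((cmod (h (n + k) x - h n x))\<^sup>2) \<partial>haar K) \<le>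
          ennreal ((8 / 3 * (1 / 4) ^ n)\<^sup>2)" for k
        using nn_integral_L2[OF L2_diff[OF h h]] by (simp only:) (intro ennreal_leI power_mono, auto)
      then show "\<forall>\<^sub>F k in sequentially. (\<integral>\<^sup>+x. ennreal ((cmod (h (n + k) x - h n x))\<^sup>2) \<partial>haar K) \<le>
          ennreal ((8 / 3 * (1 / 4) ^ n)\<^sup>2)"
        by simp
    qed
    finally show ?thesis .
  qed
  have diff: "(\<lambda>x. h n x - g x) \<in> L2 K" for n
  proof (rule L2I_nn_integral)
    show "(\<integral>\<^sup>+x. ennreal ((cmod (h n x - g x))\<^sup>2) \<partial>haar K) < \<infinity>"
      by (rule le_less_trans[OF bound]) simp
  qed measurable
  have "g \<in> L2 K"
    using L2_diff[OF h[of 0] diff[of 0]] by simp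
  moreover have "(\<lambda>n. L2_norm K (\<lambda>x. h n x - g x)) \<longlonglongrightarrow> 0"
  proof (rule Lim_null_comparison)
    have "L2_norm K (\<lambda>x. h n x - g x) \<le> 8 / 3 * (1 / 4) ^ n" for n
    proof (rule power2_le_imp_le)
      show "(L2_norm K (\<lambda>x. h n x - g x))\<^sup>2 \<le> (8 / 3 * (1 / 4) ^ n)\<^sup>2"
        using bound[of n] unfolding nn_integral_L2[OF diff] by (subst (asm) ennreal_le_iff) simp_all
    qed simp
    then show "\<forall>\<^sub>F n in sequentially. norm (L2_norm K (\<lambda>x. h n x - g x)) \<le> 8 / 3 * (1 / 4) ^ n"
      by simp
    show "(\<lambda>n. 8 / 3 * (1 / 4 :: real) ^ n) \<longlonglongrightarrow> 0"
      by (intro tendsto_mult_right_zero LIMSEQ_power_zero) simp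
  qed
  ultimately show ?thesis
    using that by blast
qed

text \<open>
  On the subgroups \<open>\<pp>\<^sup>-\<^sup>n\<DD>\<close>, which have finite measure and exhaust \<open>K\<close>, square integrable functions
  are integrable.
\<close>

lemma L2_approx_integrable:
  assumes f: "f \<in> L2 K" and "e > 0"
  obtains F where "integrable (haar K) F" "F \<in> L2 K" "L2_norm K (\<lambda>x. F x - f x) < e"
proof -
  have [measurable]: "f \<in> borel_measurable (haar K)"
    using f by (rule L2_measurable)
  define F where "F n x = indicator (coset (- int n) 0) x * f x" for n x
  have F_L2: "F n \<in> L2 K" for n
    unfolding L2_def
  proof (safe)
    show "F n \<in> borel_measurable (haar K)"
      unfolding F_def by measurable
    then show "integrable (haar K) (\<lambda>x. (cmod (F n x))\<^sup>2)"
      by (intro Bochner_Integration.integrable_bound[OF L2_integrable[OF f]])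
        (auto simp: F_def indicator_def)
  qed
  have "integrable (haar K) (F n)" for n
  proof (rule Bochner_Integration.integrable_bound)
    show "integrable (haar K) (\<lambda>x. (cmod (f x))\<^sup>2 + indicator (coset (- int n) 0) x)"
      using L2_integrable[OF f] integrable_real_indicator_coset by (intro Bochner_Integration.integrable_add)
    have "t \<le> t\<^sup>2 + 1" for t :: real
      using zero_le_power2[of "t - 1 / 2"] by (simp add: power2_eq_square algebra_simps)
    then show "AE x in haar K. norm (F n x) \<le> norm ((cmod (f x))\<^sup>2 + indicator (coset (- int n) 0) x)"
      by (intro AE_I2) (auto simp: F_def indicator_def)
  qed (use F_L2 in \<open>simp add: L2_measurable\<close>)
  moreover have "(\<lambda>n. L2_norm K (\<lambda>x. F n x - f x)) \<longlonglongrightarrow> 0"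
  proof -
    have "(\<lambda>n. \<integral>x. (cmod (F n x - f x))\<^sup>2 \<partial>haar K) \<longlonglongrightarrow> (\<integral>x. 0 \<partial>haar K)"
    proof (rule integral_dominated_convergence[where w = "\<lambda>x. (cmod (f x))\<^sup>2"])
      show "AE x in haar K. (\<lambda>n. (cmod (F n x - f x))\<^sup>2) \<longlonglongrightarrow> 0"
      proof (rule AE_I2)
        fix x
        obtain N where N: "v x < real q ^ N"
          using real_arch_pow[of "real q" "v x"] q_gt_1 by auto
        have "x \<in> coset (- int n) 0" if "n \<ge> N" for n
        proof -
          have "real q ^ N \<le> real q ^ n"
            using q_pos that by (intro power_increasing) auto
          then show ?thesis
            using N by (simp add: coset_def)
        qed
        then have "\<forall>n\<ge>N. (cmod (F n x - f x))\<^sup>2 = 0"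
          by (simp add: F_def)
        then show "(\<lambda>n. (cmod (F n x - f x))\<^sup>2) \<longlonglongrightarrow> 0"
          by (intro tendsto_eventually) (simp only: eventually_sequentially, rule exI)
      qed
      show "AE x in haar K. norm ((cmod (F n x - f x))\<^sup>2) \<le> (cmod (f x))\<^sup>2" for n
        by (intro AE_I2) (auto simp: F_def indicator_def)
    qed (use f F_L2 in \<open>auto simp: L2_integrable intro!: borel_measurable_power borel_measurable_norm borel_measurable_diff L2_measurable\<close>)
    from tendsto_real_sqrt[OF this] show ?thesis
      by (simp add: L2_norm_def)
  qed
  from order_tendstoD(2)[OF this \<open>e > 0\<close>] obtain n where "L2_norm K (\<lambda>x. F n x - f x) < e"
    by (auto simp: eventually_sequentially)
  ultimately show ?thesis
    using that[of "F n"] F_L2 by simp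
qed

section \<open>The Fourier transform of square integrable functions\<close>

lemma integrable_mult_chi:
  assumes "integrable (haar K) F"
  shows "integrable (haar K) (\<lambda>x. F x * chi (y * x))" "integrable (haar K) (\<lambda>x. F x * cnj (chi (y * x)))"
proof -
  have *: "integrable (haar K) (\<lambda>x. F x * chi (y * x))" for y
    by (rule Bochner_Integration.integrable_bound[OF assms])
      (use assms chi_mult_measurable in \<open>auto simp: norm_mult chr_norm\<close>)
  show "integrable (haar K) (\<lambda>x. F x * chi (y * x))"
    by (rule *)
  show "integrable (haar K) (\<lambda>x. F x * cnj (chi (y * x)))"
    using *[of "- y"] by (simp add: chi_cnj)
qed

lemma fourier_L1_add:
  assumes "integrable (haar K) F" "integrable (haar K) G"
  shows "fourier_L1 K (\<lambda>x. F x + G x) = (\<lambda>\<xi>. fourier_L1 K F \<xi> + fourier_L1 K G \<xi>)"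
  using assms by (simp add: fun_eq_iff fourier_L1_def ring_distribs integrable_mult_chi)

lemma fourier_L1_scale: "fourier_L1 K (\<lambda>x. c * F x) = (\<lambda>\<xi>. c * fourier_L1 K F \<xi>)"
  by (simp add: fun_eq_iff fourier_L1_def mult.assoc)

lemma fourier_L1_diff:
  assumes "integrable (haar K) F" "integrable (haar K) G"
  shows "fourier_L1 K (\<lambda>x. F x - G x) = (\<lambda>\<xi>. fourier_L1 K F \<xi> - fourier_L1 K G \<xi>)"
  using fourier_L1_add[OF assms(1) integrable_mult_right[of "- 1"], OF assms(2)]
    fourier_L1_scale[of "- 1" G] by simp

lemma fourier_L1_translate:
  assumes "F \<in> borel_measurable (haar K)"
  shows "fourier_L1 K (\<lambda>x. F (x - a)) = (\<lambda>\<xi>. cnj (chi (\<xi> * a)) * fourier_L1 K F \<xi>)"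
proof
  fix \<xi>
  have [measurable]: "(\<lambda>x. F (- a + x)) \<in> borel_measurable (haar K)"
    by (rule measurable_compose[OF translation_measurable[of "- a", folded measurable_cong_sets[OF sets_haar refl]] ])
      (use assms in \<open>simp add: measurable_cong_sets[OF sets_haar refl]\<close>)
  have "fourier_L1 K (\<lambda>x. F (x - a)) \<xi> = (\<integral>x. F (- a + x) * cnj (chi (\<xi> * x)) \<partial>haar K)"
    by (simp add: fourier_L1_def)
  also have "\<dots> = (\<integral>x. F (- a + (a + x)) * cnj (chi (\<xi> * (a + x))) \<partial>haar K)"
    by (rule integral_translate[symmetric]) measurable
  also have "\<dots> = (\<integral>x. cnj (chi (\<xi> * a)) * (F x * cnj (chi (\<xi> * x))) \<partial>haar K)"
    by (simp add: ring_distribs chr_add ac_simps)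
  finally show "fourier_L1 K (\<lambda>x. F (x - a)) \<xi> = cnj (chi (\<xi> * a)) * fourier_L1 K F \<xi>"
    by (simp add: fourier_L1_def)
qed

lemma fourier_L1_L2:
  assumes "integrable (haar K) F" "F \<in> L2 K"
  shows "fourier_L1 K F \<in> L2 K" and "L2_norm K (fourier_L1 K F) = L2_norm K F"
proof -
  show L2: "fourier_L1 K F \<in> L2 K"
    using assms by (intro L2I_nn_integral borel_measurable_fourier_L1)
      (simp_all add: plancherel_L1 nn_integral_L2)
  have "ennreal ((L2_norm K (fourier_L1 K F))\<^sup>2) = ennreal ((L2_norm K F)\<^sup>2)"
    using plancherel_L1[OF assms(1)] by (simp only: nn_integral_L2[OF L2] nn_integral_L2[OF assms(2)])
  then show "L2_norm K (fourier_L1 K F) = L2_norm K F"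
    by simp
qed

text \<open>
  Approximating \<open>f\<close> by integrable functions at a geometric rate, one gets by \<open>fourier_L1_L2\<close> Fourier
  transforms that are Cauchy at the rate required by \<open>L2_complete\<close>.
\<close>

lemma is_fourier_exists:
  assumes f: "f \<in> L2 K"
  obtains g where "is_fourier K f g"
proof -
  have "\<exists>F. integrable (haar K) F \<and> F \<in> L2 K \<and> L2_norm K (\<lambda>x. F x - f x) < (1 / 4) ^ n" for n
    using L2_approx_integrable[OF f, of "(1 / 4) ^ n"] by auto
  then obtain F where F: "\<And>n. integrable (haar K) (F n)" "\<And>n. F n \<in> L2 K"
    "\<And>n. L2_norm K (\<lambda>x. F n x - f x) < (1 / 4) ^ n"
    by metis
  have "L2_norm K (\<lambda>\<xi>. fourier_L1 K (F (Suc n)) \<xi> - fourier_L1 K (F n) \<xi>) \<le> 2 * (1 / 4) ^ n" for n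
  proof -
    have "L2_norm K (\<lambda>\<xi>. fourier_L1 K (F (Suc n)) \<xi> - fourier_L1 K (F n) \<xi>) =
        L2_norm K (\<lambda>x. F (Suc n) x - F n x)"
      using fourier_L1_L2(2)[of "\<lambda>x. F (Suc n) x - F n x"] F by (simp add: fourier_L1_diff L2_diff)
    also have "\<dots> \<le> L2_norm K (\<lambda>x. F (Suc n) x - f x) + L2_norm K (\<lambda>x. F n x - f x)"
      using L2_norm_diff_triangle[OF F(2) f F(2)] by (simp add: L2_norm_diff_commute[of f])
    also have "\<dots> \<le> (1 / 4) ^ Suc n + (1 / 4) ^ n"
      using F(3)[of n] F(3)[of "Suc n"] by linarith
    also have "\<dots> \<le> 2 * (1 / 4) ^ n"
      by simp
    finally show ?thesis .
  qed
  then obtain g where "g \<in> L2 K" "(\<lambda>n. L2_norm K (\<lambda>\<xi>. fourier_L1 K (F n) \<xi> - g \<xi>)) \<longlonglongrightarrow> 0"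
    using L2_complete[of "\<lambda>n. fourier_L1 K (F n)"] F fourier_L1_L2(1) by blast
  moreover have "(\<lambda>n. L2_norm K (\<lambda>x. F n x - f x)) \<longlonglongrightarrow> 0"
  proof (rule Lim_null_comparison)
    show "\<forall>\<^sub>F n in sequentially. norm (L2_norm K (\<lambda>x. F n x - f x)) \<le> (1 / 4) ^ n"
      using F(3) by (simp add: less_imp_le)
    show "(\<lambda>n. (1 / 4 :: real) ^ n) \<longlonglongrightarrow> 0"
      by (rule LIMSEQ_power_zero) simp
  qed
  ultimately have "is_fourier K f g"
    using f F fourier_L1_L2(1) unfolding is_fourier_def by blast
  then show ?thesis
    using that by blast
qed

lemma is_fourier_fourier: "f \<in> L2 K \<Longrightarrow> is_fourier K f (fourier K f)"
  unfolding fourier_def by (metis is_fourier_exists someI)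

lemma is_fourier_L2: "is_fourier K f g \<Longrightarrow> f \<in> L2 K" "is_fourier K f g \<Longrightarrow> g \<in> L2 K"
  by (simp_all add: is_fourier_def)

lemma is_fourierE:
  assumes "is_fourier K f g"
  obtains F where "\<And>n. integrable (haar K) (F n)" "\<And>n. F n \<in> L2 K"
    "(\<lambda>n. L2_norm K (\<lambda>x. F n x - f x)) \<longlonglongrightarrow> 0"
    "(\<lambda>n. L2_norm K (\<lambda>\<xi>. fourier_L1 K (F n) \<xi> - g \<xi>)) \<longlonglongrightarrow> 0"
  using assms unfolding is_fourier_def by blast

lemma is_fourierI:
  assumes "f \<in> L2 K" "g \<in> L2 K" "\<And>n. integrable (haar K) (F n)" "\<And>n. F n \<in> L2 K"
    "(\<lambda>n. L2_norm K (\<lambda>x. F n x - f x)) \<longlonglongrightarrow> 0"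
    "(\<lambda>n. L2_norm K (\<lambda>\<xi>. fourier_L1 K (F n) \<xi> - g \<xi>)) \<longlonglongrightarrow> 0"
  shows "is_fourier K f g"
  using assms fourier_L1_L2(1) unfolding is_fourier_def by blast

lemma is_fourier_norm:
  assumes "is_fourier K f g"
  shows "L2_norm K g = L2_norm K f"
proof -
  obtain F where F: "\<And>n. integrable (haar K) (F n)" "\<And>n. F n \<in> L2 K"
    "(\<lambda>n. L2_norm K (\<lambda>x. F n x - f x)) \<longlonglongrightarrow> 0"
    "(\<lambda>n. L2_norm K (\<lambda>\<xi>. fourier_L1 K (F n) \<xi> - g \<xi>)) \<longlonglongrightarrow> 0"
    using assms by (rule is_fourierE) blast
  have "(\<lambda>n. L2_norm K (fourier_L1 K (F n))) \<longlonglongrightarrow> L2_norm K g"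
    using F is_fourier_L2(2)[OF assms] by (intro L2_norm_tendsto fourier_L1_L2) auto
  moreover have "(\<lambda>n. L2_norm K (F n)) \<longlonglongrightarrow> L2_norm K f"
    using F is_fourier_L2(1)[OF assms] by (intro L2_norm_tendsto) auto
  ultimately show ?thesis
    using F fourier_L1_L2(2) LIMSEQ_unique by fastforce
qed

lemma L2_tendsto_add:
  assumes "\<And>n. F n \<in> L2 K" "\<And>n. G n \<in> L2 K" "f \<in> L2 K" "g \<in> L2 K"
    and "(\<lambda>n. L2_norm K (\<lambda>x. F n x - f x)) \<longlonglongrightarrow> 0" "(\<lambda>n. L2_norm K (\<lambda>x. G n x - g x)) \<longlonglongrightarrow> 0"
  shows "(\<lambda>n. L2_norm K (\<lambda>x. (F n x + G n x) - (f x + g x))) \<longlonglongrightarrow> 0"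
proof (rule Lim_null_comparison)
  have "L2_norm K (\<lambda>x. (F n x + G n x) - (f x + g x)) \<le>
    L2_norm K (\<lambda>x. F n x - f x) + L2_norm K (\<lambda>x. G n x - g x)" for n
    using L2_norm_triangle[OF L2_diff L2_diff, OF assms(1,3,2,4)] by (simp add: algebra_simps)
  then show "\<forall>\<^sub>F n in sequentially. norm (L2_norm K (\<lambda>x. (F n x + G n x) - (f x + g x))) \<le>
    L2_norm K (\<lambda>x. F n x - f x) + L2_norm K (\<lambda>x. G n x - g x)"
    by simp
  show "(\<lambda>n. L2_norm K (\<lambda>x. F n x - f x) + L2_norm K (\<lambda>x. G n x - g x)) \<longlonglongrightarrow> 0"
    using tendsto_add[OF assms(5,6)] by simp
qed

lemma is_fourier_add:
  assumes "is_fourier K f f'" "is_fourier K g g'"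
  shows "is_fourier K (\<lambda>x. f x + g x) (\<lambda>\<xi>. f' \<xi> + g' \<xi>)"
proof -
  obtain F where F: "\<And>n. integrable (haar K) (F n)" "\<And>n. F n \<in> L2 K"
    "(\<lambda>n. L2_norm K (\<lambda>x. F n x - f x)) \<longlonglongrightarrow> 0"
    "(\<lambda>n. L2_norm K (\<lambda>\<xi>. fourier_L1 K (F n) \<xi> - f' \<xi>)) \<longlonglongrightarrow> 0"
    using assms(1) by (rule is_fourierE) blast
  obtain G where G: "\<And>n. integrable (haar K) (G n)" "\<And>n. G n \<in> L2 K"
    "(\<lambda>n. L2_norm K (\<lambda>x. G n x - g x)) \<longlonglongrightarrow> 0"
    "(\<lambda>n. L2_norm K (\<lambda>\<xi>. fourier_L1 K (G n) \<xi> - g' \<xi>)) \<longlonglongrightarrow> 0"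
    using assms(2) by (rule is_fourierE) blast
  note L2 = assms[THEN is_fourier_L2(1)] assms[THEN is_fourier_L2(2)]
  show ?thesis
  proof (rule is_fourierI[where F = "\<lambda>n x. F n x + G n x"])
    show "(\<lambda>n. L2_norm K (\<lambda>x. (F n x + G n x) - (f x + g x))) \<longlonglongrightarrow> 0"
      by (rule L2_tendsto_add) (use F G L2 in auto)
    show "(\<lambda>n. L2_norm K (\<lambda>\<xi>. fourier_L1 K (\<lambda>x. F n x + G n x) \<xi> - (f' \<xi> + g' \<xi>))) \<longlonglongrightarrow> 0"
      unfolding fourier_L1_add[OF F(1) G(1)]
      by (rule L2_tendsto_add) (use F G L2 fourier_L1_L2 in auto)
  qed (use F G L2 in \<open>auto intro: L2_add\<close>)
qed

lemma is_fourier_scale: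
  assumes "is_fourier K f f'"
  shows "is_fourier K (\<lambda>x. c * f x) (\<lambda>\<xi>. c * f' \<xi>)"
proof -
  obtain F where F: "\<And>n. integrable (haar K) (F n)" "\<And>n. F n \<in> L2 K"
    "(\<lambda>n. L2_norm K (\<lambda>x. F n x - f x)) \<longlonglongrightarrow> 0"
    "(\<lambda>n. L2_norm K (\<lambda>\<xi>. fourier_L1 K (F n) \<xi> - f' \<xi>)) \<longlonglongrightarrow> 0"
    using assms(1) by (rule is_fourierE) blast
  note L2 = assms[THEN is_fourier_L2(1)] assms[THEN is_fourier_L2(2)]
  show ?thesis
  proof (rule is_fourierI[where F = "\<lambda>n x. c * F n x"])
    show "(\<lambda>n. L2_norm K (\<lambda>x. c * F n x - c * f x)) \<longlonglongrightarrow> 0"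
      using tendsto_mult_right_zero[OF F(3), of "cmod c"] by (simp flip: right_diff_distrib L2_norm_scale)
    show "(\<lambda>n. L2_norm K (\<lambda>\<xi>. fourier_L1 K (\<lambda>x. c * F n x) \<xi> - c * f' \<xi>)) \<longlonglongrightarrow> 0"
      unfolding fourier_L1_scale
      using tendsto_mult_right_zero[OF F(4), of "cmod c"] by (simp flip: right_diff_distrib L2_norm_scale)
  qed (use F L2 in \<open>auto intro: L2_scale\<close>)
qed

text \<open>An isometry preserves inner products, by polarization.\<close>

lemma is_fourier_inner:
  assumes "is_fourier K f f'" "is_fourier K g g'"
  shows "L2_inner K f g = L2_inner K f' g'"
proof -
  have Re: "Re (L2_inner K f h) = Re (L2_inner K f' h')" if h: "is_fourier K h h'" for h h'
  proof -
    note L2 = is_fourier_L2[OF assms(1)] is_fourier_L2[OF h]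
    show ?thesis
      using L2_norm_add_square[OF L2(1,3)] L2_norm_add_square[OF L2(2,4)]
        is_fourier_norm[OF is_fourier_add[OF assms(1) h]] is_fourier_norm[OF assms(1)] is_fourier_norm[OF h]
      by simp
  qed
  have "Re (L2_inner K f g) = Re (L2_inner K f' g')"
    by (rule Re[OF assms(2)])
  moreover have "Im (L2_inner K f g) = Im (L2_inner K f' g')"
    using Re[OF is_fourier_scale[OF assms(2), of \<i>]] by (simp add: L2_inner_scale_right)
  ultimately show ?thesis
    by (rule complex_eqI)
qed

lemma L2_translate:
  assumes "f \<in> L2 K"
  shows "(\<lambda>x. f (x - a)) \<in> L2 K" "L2_norm K (\<lambda>x. f (x - a)) = L2_norm K f"
proof -
  have [measurable]: "f \<in> borel_measurable (haar K)"
    using assms by (rule L2_measurable)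
  then have "f \<in> borel_measurable borel"
    by (simp cong: measurable_cong_sets add: sets_haar)
  then have "(\<lambda>x. f (- a + x)) \<in> borel_measurable borel"
    by measurable
  then have "(\<lambda>x. f (- a + x)) \<in> borel_measurable (haar K)"
    by simp
  moreover have "integrable (haar K) (\<lambda>x. (cmod (f (- a + x)))\<^sup>2)"
    by (rule integrable_translate[OF L2_integrable[OF assms]])
  ultimately show "(\<lambda>x. f (x - a)) \<in> L2 K"
    by (simp add: L2_def)
  have "(\<integral>x. (cmod (f (- a + x)))\<^sup>2 \<partial>haar K) = (\<integral>x. (cmod (f x))\<^sup>2 \<partial>haar K)"
    by (rule integral_translate) measurable
  then show "L2_norm K (\<lambda>x. f (x - a)) = L2_norm K f"
    by (simp add: L2_norm_def)
qed

lemma L2_unimodular: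
  assumes "f \<in> L2 K"
  shows "(\<lambda>x. cnj (chi (x * a)) * f x) \<in> L2 K" "L2_norm K (\<lambda>x. cnj (chi (x * a)) * f x) = L2_norm K f"
proof -
  have [measurable]: "f \<in> borel_measurable (haar K)"
    using assms by (rule L2_measurable)
  have "(\<lambda>x. cnj (chi (a * x)) * f x) \<in> borel_measurable (haar K)"
    by measurable
  then show "(\<lambda>x. cnj (chi (x * a)) * f x) \<in> L2 K"
    using assms by (simp add: L2_def norm_mult chr_norm mult.commute[of _ a])
  show "L2_norm K (\<lambda>x. cnj (chi (x * a)) * f x) = L2_norm K f"
    by (simp add: L2_norm_def norm_mult chr_norm)
qed

lemma is_fourier_translate:
  assumes "is_fourier K f f'"
  shows "is_fourier K (\<lambda>x. f (x - a)) (\<lambda>\<xi>. cnj (chi (\<xi> * a)) * f' \<xi>)"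
proof -
  obtain F where F: "\<And>n. integrable (haar K) (F n)" "\<And>n. F n \<in> L2 K"
    "(\<lambda>n. L2_norm K (\<lambda>x. F n x - f x)) \<longlonglongrightarrow> 0"
    "(\<lambda>n. L2_norm K (\<lambda>\<xi>. fourier_L1 K (F n) \<xi> - f' \<xi>)) \<longlonglongrightarrow> 0"
    using assms(1) by (rule is_fourierE) blast
  note L2 = assms[THEN is_fourier_L2(1)] assms[THEN is_fourier_L2(2)]
  show ?thesis
  proof (rule is_fourierI[where F = "\<lambda>n x. F n (x - a)"])
    show "integrable (haar K) (\<lambda>x. F n (x - a))" for n
      using integrable_translate[OF F(1)[of n], of "- a"] by simp
    show "(\<lambda>n. L2_norm K (\<lambda>x. F n (x - a) - f (x - a))) \<longlonglongrightarrow> 0"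
      using L2_translate(2)[OF L2_diff[OF F(2) L2(1)]] F(3) by simp
    have "(\<lambda>\<xi>. cnj (chi (\<xi> * a)) * fourier_L1 K (F n) \<xi> - cnj (chi (\<xi> * a)) * f' \<xi>) =
      (\<lambda>\<xi>. cnj (chi (\<xi> * a)) * (fourier_L1 K (F n) \<xi> - f' \<xi>))" for n
      by (simp add: algebra_simps)
    then show "(\<lambda>n. L2_norm K (\<lambda>\<xi>. fourier_L1 K (\<lambda>x. F n (x - a)) \<xi> - cnj (chi (\<xi> * a)) * f' \<xi>)) \<longlonglongrightarrow> 0"
      unfolding fourier_L1_translate[OF L2_measurable[OF F(2)]]
      using L2_unimodular(2)[OF L2_diff[OF fourier_L1_L2(1)[OF F(1,2)] L2(2)]] F(4) by simp
  qed (use F L2 L2_translate L2_unimodular in auto)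
qed

section \<open>Periodization\<close>

text \<open>
  The sum of the translates of \<open>G\<close> by the \<open>u(l)\<close>, restricted to the fundamental domain \<open>\<DD>\<close>.
\<close>

definition periodization :: "('a \<Rightarrow> complex) \<Rightarrow> 'a \<Rightarrow> complex"
  where "periodization G \<xi> = (\<Sum>l. indicator (coset 0 0) \<xi> * G (u l + \<xi>))"

lemma rep_0 [simp]: "rep 0 k = u k"
  by (simp add: rep_def)

text \<open>
  The Fourier transform of a function that is supported in \<open>\<DD>\<close> is constant on the cosets of \<open>\<DD>\<close>. So
  the integral of its square is the sum of its values at the \<open>u(k)\<close>, and Plancherel's theorem on \<open>K\<close>
  contains Parseval's equation on \<open>\<DD>\<close>.
\<close>

lemma parseval_int_ring:
  assumes h: "integrable (haar K) h" and supp: "\<And>x. x \<notin> coset 0 0 \<Longrightarrow> h x = 0"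
  shows "(\<Sum>k. ennreal ((cmod (\<integral>x. h x * chi (u k * x) \<partial>haar K))\<^sup>2)) =
    (\<integral>\<^sup>+x. ennreal ((cmod (h x))\<^sup>2) \<partial>haar K)"
proof -
  define F where "F x = cnj (h x)" for x
  define c where "c k = (\<integral>x. h x * chi (u k * x) \<partial>haar K)" for k
  have F: "integrable (haar K) F"
    unfolding F_def using h by simp
  have F_eq: "fourier_L1 K F \<xi> = cnj (c k)" if \<xi>: "\<xi> \<in> coset 0 (u k)" for \<xi> k
  proof -
    have "F x * cnj (chi (\<xi> * x)) = cnj (h x * chi (u k * x))" for x
    proof (cases "x \<in> coset 0 0")
      case True
      then have "v ((\<xi> - u k) * x) \<le> 1 * 1"
        unfolding absv_mult using \<xi> by (intro mult_mono) (auto simp: coset_def)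
      then have "chi ((\<xi> - u k) * x) = 1"
        by (intro chi_eq_1) simp
      moreover have "\<xi> * x = (\<xi> - u k) * x + u k * x"
        by (simp add: algebra_simps)
      ultimately have "chi (\<xi> * x) = chi (u k * x)"
        by (metis chr_add mult_1)
      then show ?thesis
        by (simp add: F_def)
    qed (simp add: F_def supp)
    then show ?thesis
      unfolding fourier_L1_def c_def by (simp only: Bochner_Integration.integral_cnj)
  qed
  have "(\<integral>\<^sup>+x. ennreal ((cmod (h x))\<^sup>2) \<partial>haar K) = (\<integral>\<^sup>+\<xi>. ennreal ((cmod (fourier_L1 K F \<xi>))\<^sup>2) \<partial>haar K)"
    by (simp add: plancherel_L1[OF F]) (simp add: F_def)
  also have "\<dots> = (\<Sum>k. \<integral>\<^sup>+\<xi>. ennreal ((cmod (fourier_L1 K F \<xi>))\<^sup>2) * indicator (coset 0 (rep 0 k)) \<xi> \<partial>haar K)"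
    by (rule nn_integral_cosets) (use borel_measurable_fourier_L1[OF F] in measurable)
  also have "\<dots> = (\<Sum>k. \<integral>\<^sup>+\<xi>. ennreal ((cmod (c k))\<^sup>2) * indicator (coset 0 (u k)) \<xi> \<partial>haar K)"
    by (intro suminf_cong nn_integral_cong) (auto simp: F_eq indicator_def)
  also have "\<dots> = (\<Sum>k. ennreal ((cmod (c k))\<^sup>2))"
    by (simp add: nn_integral_cmult_indicator)
  finally show ?thesis
    by (simp add: c_def)
qed

context
  fixes G :: "'a \<Rightarrow> complex"
  assumes G: "integrable (haar K) G"
begin

lemma integrable_periodization_term:
  "integrable (haar K) (\<lambda>\<xi>. indicator (coset 0 0) \<xi> * G (u l + \<xi>))"
  by (rule integrable_indicator_coset_mult[OF integrable_translate[OF G]])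

lemma summable_integral_periodization:
  "summable (\<lambda>l. \<integral>\<xi>. norm (indicator (coset 0 0) \<xi> * G (u l + \<xi>)) \<partial>haar K)"
proof -
  have "(\<integral>\<xi>. norm (indicator (coset 0 0) \<xi> * G (u l + \<xi>)) \<partial>haar K) =
    (\<integral>x. norm (indicator (coset 0 (rep 0 l)) x * G x) \<partial>haar K)" for l
  proof -
    have "(\<integral>x. norm (indicator (coset 0 (u l)) x * G x) \<partial>haar K) =
        (\<integral>\<xi>. norm (indicator (coset 0 (u l)) (u l + \<xi>) * G (u l + \<xi>)) \<partial>haar K)"
      by (rule integral_translate[symmetric]) (use G in measurable)
    moreover have "indicator (coset 0 (u l)) (u l + \<xi>) = (indicator (coset 0 0) \<xi> :: complex)" for \<xi>
      by (simp add: indicator_def mem_coset_translate)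
    ultimately show ?thesis
      by simp
  qed
  then show ?thesis
    using summable_coset_integral[OF G, of 0] by simp
qed

lemma AE_summable_periodization:
  "AE \<xi> in haar K. summable (\<lambda>l. norm (indicator (coset 0 0) \<xi> * G (u l + \<xi>)))"
proof -
  let ?f = "\<lambda>l \<xi>. norm (indicator (coset 0 0) \<xi> * G (u l + \<xi>))"
  have "(\<integral>\<^sup>+\<xi>. (\<Sum>l. ennreal (?f l \<xi>)) \<partial>haar K) = (\<Sum>l. \<integral>\<^sup>+\<xi>. ennreal (?f l \<xi>) \<partial>haar K)"
    by (rule nn_integral_suminf) (use integrable_periodization_term in measurable)
  also have "\<dots> = (\<Sum>l. ennreal (\<integral>\<xi>. ?f l \<xi> \<partial>haar K))"
    by (intro suminf_cong nn_integral_eq_integral integrable_norm integrable_periodization_term) simp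
  also have "\<dots> = ennreal (\<Sum>l. \<integral>\<xi>. ?f l \<xi> \<partial>haar K)"
    by (rule suminf_ennreal2) (auto intro: summable_integral_periodization)
  also have "\<dots> < \<infinity>"
    by simp
  finally have "AE \<xi> in haar K. (\<Sum>l. ennreal (?f l \<xi>)) \<noteq> \<infinity>"
    by (intro nn_integral_PInf_AE borel_measurable_suminf)
      (use integrable_periodization_term in measurable)
  then show ?thesis
    by eventually_elim (rule summable_suminf_not_top, auto)
qed

lemma integrable_periodization: "integrable (haar K) (periodization G)"
  unfolding periodization_def
  by (rule integrable_suminf[OF integrable_periodization_term AE_summable_periodization
        summable_integral_periodization])

text \<open>The characters \<open>\<chi>\<^sub>k\<close> do not change under periodization, as they are trivial at all \<open>u(l)\<close>.\<close>

lemma integral_periodization_chi: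
  "(\<integral>\<xi>. periodization G \<xi> * chi (u k * \<xi>) \<partial>haar K) = (\<integral>\<xi>. G \<xi> * chi (u k * \<xi>) \<partial>haar K)"
proof -
  let ?f = "\<lambda>l \<xi>. indicator (coset 0 0) \<xi> * G (u l + \<xi>) * chi (u k * \<xi>)"
  have norm_f: "norm (?f l \<xi>) = norm (indicator (coset 0 0) \<xi> * G (u l + \<xi>))" for l \<xi>
    by (simp add: norm_mult chr_norm)
  have "(\<lambda>l. \<integral>\<xi>. ?f l \<xi> \<partial>haar K) sums (\<integral>\<xi>. (\<Sum>l. ?f l \<xi>) \<partial>haar K)"
    using AE_summable_periodization summable_integral_periodization integrable_periodization_term
    by (intro sums_integral) (simp_all only: norm_f integrable_mult_chi)
  also have "(\<integral>\<xi>. (\<Sum>l. ?f l \<xi>) \<partial>haar K) = (\<integral>\<xi>. periodization G \<xi> * chi (u k * \<xi>) \<partial>haar K)"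
  proof (rule integral_cong_AE)
    show "AE \<xi> in haar K. (\<Sum>l. ?f l \<xi>) = periodization G \<xi> * chi (u k * \<xi>)"
      using AE_summable_periodization
      by eventually_elim (simp add: periodization_def suminf_mult2[OF summable_norm_cancel])
    show "(\<lambda>\<xi>. periodization G \<xi> * chi (u k * \<xi>)) \<in> borel_measurable (haar K)"
      using integrable_mult_chi(1)[OF integrable_periodization] by simp
    show "(\<lambda>\<xi>. \<Sum>l. ?f l \<xi>) \<in> borel_measurable (haar K)"
      using AE_summable_periodization summable_integral_periodization integrable_periodization_term
      by (intro borel_measurable_integrable integrable_suminf) (simp_all only: norm_f integrable_mult_chi)
  qed
  also have "(\<lambda>l. \<integral>\<xi>. ?f l \<xi> \<partial>haar K) = (\<lambda>l. coset_integral 0 (rep 0 l) (\<lambda>\<xi>. G \<xi> * chi (u k * \<xi>)))"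
  proof
    fix l
    let ?g = "\<lambda>x. indicator (coset 0 (u l)) x * (G x * chi (u k * x))"
    have "(\<integral>\<xi>. ?g (u l + \<xi>) \<partial>haar K) = (\<integral>x. ?g x \<partial>haar K)"
      using integrable_mult_chi(1)[OF G, of "u k"] by (intro integral_translate) auto
    moreover have "?g (u l + \<xi>) = ?f l \<xi>" for \<xi>
      using chi_coset_rep_mult[of k l] by (simp add: indicator_def mem_coset_translate ring_distribs chr_add)
    ultimately show "(\<integral>\<xi>. ?f l \<xi> \<partial>haar K) = coset_integral 0 (rep 0 l) (\<lambda>\<xi>. G \<xi> * chi (u k * \<xi>))"
      by (simp add: coset_integral_def)
  qed
  finally show ?thesis
    using sums_coset_integral[OF integrable_mult_chi(1)[OF G], of 0 "u k"] sums_unique2 by blast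
qed

text \<open>
  The functions \<open>G\<close> of interest are products of two functions in \<open>L\<^sup>2(K)\<close> and hence integrable, but
  they may fail to be square integrable. Therefore the equation takes place in \<open>[0, \<infinity>]\<close>.
\<close>

theorem parseval_periodization:
  "(\<Sum>k. ennreal ((cmod (\<integral>\<xi>. G \<xi> * chi (u k * \<xi>) \<partial>haar K))\<^sup>2)) =
    (\<integral>\<^sup>+\<xi>. ennreal ((cmod (periodization G \<xi>))\<^sup>2) \<partial>haar K)"
  unfolding integral_periodization_chi[symmetric]
  by (rule parseval_int_ring[OF integrable_periodization]) (simp add: periodization_def)

end

lemma periodization_lincomb:
  assumes "integrable (haar K) G" "integrable (haar K) H"
    and "\<And>l \<xi>. \<beta> (u l + \<xi>) = \<beta> \<xi>" "\<And>l \<xi>. \<gamma> (u l + \<xi>) = \<gamma> \<xi>"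
  shows "AE \<xi> in haar K. periodization (\<lambda>\<xi>. \<beta> \<xi> * G \<xi> + \<gamma> \<xi> * H \<xi>) \<xi> =
    \<beta> \<xi> * periodization G \<xi> + \<gamma> \<xi> * periodization H \<xi>"
  using AE_summable_periodization[OF assms(1)] AE_summable_periodization[OF assms(2)]
proof eventually_elim
  fix \<xi>
  let ?g = "\<lambda>l. indicator (coset 0 0) \<xi> * G (u l + \<xi>)" and ?h = "\<lambda>l. indicator (coset 0 0) \<xi> * H (u l + \<xi>)"
  assume "summable (\<lambda>l. norm (?g l))" "summable (\<lambda>l. norm (?h l))"
  then have "?g sums periodization G \<xi>" "?h sums periodization H \<xi>"
    unfolding periodization_def by (auto intro: summable_sums summable_norm_cancel)
  then have "(\<lambda>l. \<beta> \<xi> * ?g l + \<gamma> \<xi> * ?h l) sums (\<beta> \<xi> * periodization G \<xi> + \<gamma> \<xi> * periodization H \<xi>)"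
    by (intro sums_add sums_mult)
  moreover have "\<beta> \<xi> * ?g l + \<gamma> \<xi> * ?h l =
      indicator (coset 0 0) \<xi> * (\<beta> (u l + \<xi>) * G (u l + \<xi>) + \<gamma> (u l + \<xi>) * H (u l + \<xi>))" for l
    unfolding assms(3,4) by (simp add: algebra_simps)
  ultimately have "(\<lambda>l. indicator (coset 0 0) \<xi> * (\<beta> (u l + \<xi>) * G (u l + \<xi>) + \<gamma> (u l + \<xi>) * H (u l + \<xi>)))
      sums (\<beta> \<xi> * periodization G \<xi> + \<gamma> \<xi> * periodization H \<xi>)"
    by (simp only:)
  then show "periodization (\<lambda>\<xi>. \<beta> \<xi> * G \<xi> + \<gamma> \<xi> * H \<xi>) \<xi> =
      \<beta> \<xi> * periodization G \<xi> + \<gamma> \<xi> * periodization H \<xi>"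
    unfolding periodization_def[of "\<lambda>\<xi>. \<beta> \<xi> * G \<xi> + \<gamma> \<xi> * H \<xi>"] by (rule sums_unique[symmetric])
qed

lemma fourier_coefficient:
  assumes "f \<in> L2 K" "g \<in> L2 K"
  shows "L2_inner K f (\<lambda>x. g (x - a)) = (\<integral>\<xi>. fourier K f \<xi> * cnj (fourier K g \<xi>) * chi (a * \<xi>) \<partial>haar K)"
  using is_fourier_inner[OF is_fourier_fourier[OF assms(1)] is_fourier_translate[OF is_fourier_fourier[OF assms(2)]], of a]
  by (simp add: L2_inner_def ac_simps)

text \<open>
  The coefficients on the left are those of the integrable function
  \<open>W\<^sub>l = \<beta>\<^sub>l\<^sup>* G + t \<gamma>\<^sub>l\<^sup>* H\<close>, where \<open>G\<close> and \<open>H\<close> are the products of the Fourier transforms of \<open>f\<close> and \<open>g\<close>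
  with the conjugate of that of \<open>\<psi>\<close>. As \<open>\<beta>\<^sub>l\<close> and \<open>\<gamma>\<^sub>l\<close> are periodic, they can be pulled out of the
  periodization of \<open>W\<^sub>l\<close>, and the sum over \<open>l\<close> of the squares is evaluated pointwise by
  \<open>pythagoras_columns\<close>.
\<close>

lemma frame_coefficients_at_scale_0:
  fixes \<beta> \<gamma> :: "nat \<Rightarrow> 'a \<Rightarrow> complex"
  assumes L2: "f \<in> L2 K" "g \<in> L2 K" "\<psi> \<in> L2 K" "\<And>l. l < L \<Longrightarrow> \<Psi> l \<in> L2 K" "\<And>l. l < L \<Longrightarrow> \<Phi> l \<in> L2 K"
    and meas: "\<And>l. l < L \<Longrightarrow> \<beta> l \<in> borel_measurable (haar K)" "\<And>l. l < L \<Longrightarrow> \<gamma> l \<in> borel_measurable (haar K)"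
    and per: "\<And>l k \<xi>. l < L \<Longrightarrow> \<beta> l (u k + \<xi>) = \<beta> l \<xi>" "\<And>l k \<xi>. l < L \<Longrightarrow> \<gamma> l (u k + \<xi>) = \<gamma> l \<xi>"
    and \<Psi>: "\<And>l. l < L \<Longrightarrow> AE \<xi> in haar K. fourier K (\<Psi> l) \<xi> = \<beta> l \<xi> * fourier K \<psi> \<xi>"
    and \<Phi>: "\<And>l. l < L \<Longrightarrow> AE \<xi> in haar K. fourier K (\<Phi> l) \<xi> = \<gamma> l \<xi> * fourier K \<psi> \<xi>"
    and norm: "AE \<xi> in haar K. (\<Sum>l<L. \<beta> l \<xi> * cnj (\<beta> l \<xi>)) = 1"
      "AE \<xi> in haar K. (\<Sum>l<L. \<gamma> l \<xi> * cnj (\<gamma> l \<xi>)) = 1"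
    and orth: "t = 0 \<or> (AE \<xi> in haar K. (\<Sum>l<L. cnj (\<beta> l \<xi>) * \<gamma> l \<xi>) = 0)"
  shows "(\<Sum>l<L. \<Sum>k. ennreal ((cmod (L2_inner K f (\<lambda>x. \<Psi> l (x - u k)) + t * L2_inner K g (\<lambda>x. \<Phi> l (x - u k))))\<^sup>2)) =
    (\<Sum>k. ennreal ((cmod (L2_inner K f (\<lambda>x. \<psi> (x - u k))))\<^sup>2)) +
    ennreal ((cmod t)\<^sup>2) * (\<Sum>k. ennreal ((cmod (L2_inner K g (\<lambda>x. \<psi> (x - u k))))\<^sup>2))"
proof -
  let ?F = "fourier K"
  have F_L2: "?F h \<in> L2 K" if "h \<in> L2 K" for h
    using is_fourier_L2(2)[OF is_fourier_fourier[OF that]] .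
  note F_meas = L2_measurable[OF F_L2]
  define G where "G \<xi> = ?F f \<xi> * cnj (?F \<psi> \<xi>)" for \<xi>
  define H where "H \<xi> = ?F g \<xi> * cnj (?F \<psi> \<xi>)" for \<xi>
  define W where "W l \<xi> = cnj (\<beta> l \<xi>) * G \<xi> + (t * cnj (\<gamma> l \<xi>)) * H \<xi>" for l \<xi>
  have G: "integrable (haar K) G" and H: "integrable (haar K) H"
    unfolding G_def H_def using L2 by (auto intro: L2_integrable_mult F_L2)
  note [measurable] = borel_measurable_integrable[OF integrable_periodization[OF G]]
    borel_measurable_integrable[OF integrable_periodization[OF H]]
    borel_measurable_integrable[OF G] borel_measurable_integrable[OF H]
  have int_\<Psi>: "integrable (haar K) (\<lambda>\<xi>. ?F f \<xi> * cnj (?F (\<Psi> l) \<xi>))"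
    and int_\<Phi>: "integrable (haar K) (\<lambda>\<xi>. ?F g \<xi> * cnj (?F (\<Phi> l) \<xi>))" if "l < L" for l
    using L2 that by (auto intro: L2_integrable_mult F_L2)
  have W_meas [measurable]: "W l \<in> borel_measurable (haar K)" if "l < L" for l
    using meas[OF that] unfolding W_def by measurable
  have W_AE: "AE \<xi> in haar K. ?F f \<xi> * cnj (?F (\<Psi> l) \<xi>) + t * (?F g \<xi> * cnj (?F (\<Phi> l) \<xi>)) = W l \<xi>"
    if "l < L" for l
    using \<Psi>[OF that] \<Phi>[OF that] by eventually_elim (simp add: W_def G_def H_def)
  have int_W: "integrable (haar K) (W l)" if "l < L" for l
  proof (rule integrable_cong_AE_imp[OF _ W_meas[OF that]])
    show "integrable (haar K) (\<lambda>\<xi>. ?F f \<xi> * cnj (?F (\<Psi> l) \<xi>) + t * (?F g \<xi> * cnj (?F (\<Phi> l) \<xi>)))"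
      using int_\<Psi> int_\<Phi> that by simp
  qed (rule W_AE[OF that])
  have coeff: "L2_inner K f (\<lambda>x. \<Psi> l (x - u k)) + t * L2_inner K g (\<lambda>x. \<Phi> l (x - u k)) =
    (\<integral>\<xi>. W l \<xi> * chi (u k * \<xi>) \<partial>haar K)" if "l < L" for l k
  proof -
    have "L2_inner K f (\<lambda>x. \<Psi> l (x - u k)) + t * L2_inner K g (\<lambda>x. \<Phi> l (x - u k)) =
        (\<integral>\<xi>. ?F f \<xi> * cnj (?F (\<Psi> l) \<xi>) * chi (u k * \<xi>) + t * (?F g \<xi> * cnj (?F (\<Phi> l) \<xi>) * chi (u k * \<xi>)) \<partial>haar K)"
      using that L2 integrable_mult_chi(1)[OF int_\<Psi>[OF that], of "u k"] integrable_mult_chi(1)[OF int_\<Phi>[OF that], of "u k"]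
      by (simp add: fourier_coefficient)
    also have "\<dots> = (\<integral>\<xi>. W l \<xi> * chi (u k * \<xi>) \<partial>haar K)"
    proof (rule integral_cong_AE)
      show "AE \<xi> in haar K. ?F f \<xi> * cnj (?F (\<Psi> l) \<xi>) * chi (u k * \<xi>) + t * (?F g \<xi> * cnj (?F (\<Phi> l) \<xi>) * chi (u k * \<xi>)) =
        W l \<xi> * chi (u k * \<xi>)"
        using W_AE[OF that]
      proof eventually_elim
        case (elim \<xi>)
        show ?case
          unfolding elim[symmetric] by (simp add: algebra_simps)
      qed
    qed (use that int_W int_\<Psi> int_\<Phi> integrable_mult_chi(1) in \<open>auto intro!: borel_measurable_integrable\<close>)
    finally show ?thesis .
  qed
  have per_W: "AE \<xi> in haar K. periodization (W l) \<xi> =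
    cnj (\<beta> l \<xi>) * periodization G \<xi> + (t * cnj (\<gamma> l \<xi>)) * periodization H \<xi>" if "l < L" for l
    unfolding W_def using per that by (intro periodization_lincomb G H) auto
  have per_W_all: "AE \<xi> in haar K. \<forall>l\<in>{..<L}. periodization (W l) \<xi> =
    cnj (\<beta> l \<xi>) * periodization G \<xi> + (t * cnj (\<gamma> l \<xi>)) * periodization H \<xi>"
    using per_W by (intro AE_finite_allI) auto
  have "(\<Sum>l<L. \<Sum>k. ennreal ((cmod (L2_inner K f (\<lambda>x. \<Psi> l (x - u k)) + t * L2_inner K g (\<lambda>x. \<Phi> l (x - u k))))\<^sup>2)) =
      (\<Sum>l<L. \<integral>\<^sup>+\<xi>. ennreal ((cmod (periodization (W l) \<xi>))\<^sup>2) \<partial>haar K)"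
    by (intro sum.cong refl) (simp add: coeff parseval_periodization[OF int_W])
  also have "\<dots> = (\<integral>\<^sup>+\<xi>. (\<Sum>l<L. ennreal ((cmod (periodization (W l) \<xi>))\<^sup>2)) \<partial>haar K)"
    by (rule nn_integral_sum[symmetric])
      (use borel_measurable_integrable[OF integrable_periodization[OF int_W]] in measurable)
  also have "\<dots> = (\<integral>\<^sup>+\<xi>. ennreal ((cmod (periodization G \<xi>))\<^sup>2) +
      ennreal ((cmod t)\<^sup>2) * ennreal ((cmod (periodization H \<xi>))\<^sup>2) \<partial>haar K)"
  proof (rule nn_integral_cong_AE)
    have "AE \<xi> in haar K. t = 0 \<or> (\<Sum>l<L. cnj (\<beta> l \<xi>) * \<gamma> l \<xi>) = 0"
      using orth by (auto elim: eventually_mono)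
    with per_W_all norm show "AE \<xi> in haar K. (\<Sum>l<L. ennreal ((cmod (periodization (W l) \<xi>))\<^sup>2)) =
      ennreal ((cmod (periodization G \<xi>))\<^sup>2) + ennreal ((cmod t)\<^sup>2) * ennreal ((cmod (periodization H \<xi>))\<^sup>2)"
    proof eventually_elim
      case (elim \<xi>)
      then have "(\<Sum>l<L. (cmod (periodization (W l) \<xi>))\<^sup>2) =
          (cmod (periodization G \<xi>))\<^sup>2 + (cmod t)\<^sup>2 * (cmod (periodization H \<xi>))\<^sup>2"
        using pythagoras_columns[of "\<lambda>l. \<beta> l \<xi>" L "\<lambda>l. \<gamma> l \<xi>" t] by simp
      then show ?case
        by (simp flip: ennreal_mult ennreal_plus)
    qed
  qed
  also have "\<dots> = (\<integral>\<^sup>+\<xi>. ennreal ((cmod (periodization G \<xi>))\<^sup>2) \<partial>haar K) +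
      ennreal ((cmod t)\<^sup>2) * (\<integral>\<^sup>+\<xi>. ennreal ((cmod (periodization H \<xi>))\<^sup>2) \<partial>haar K)"
    by (subst nn_integral_add) (auto simp: nn_integral_cmult)
  also have "\<dots> = (\<Sum>k. ennreal ((cmod (L2_inner K f (\<lambda>x. \<psi> (x - u k))))\<^sup>2)) +
    ennreal ((cmod t)\<^sup>2) * (\<Sum>k. ennreal ((cmod (L2_inner K g (\<lambda>x. \<psi> (x - u k))))\<^sup>2))"
    by (simp add: fourier_coefficient L2 parseval_periodization[OF G, symmetric] parseval_periodization[OF H, symmetric])
      (simp add: G_def H_def)
  finally show ?thesis .
qed

section \<open>Wavelet coefficients at all scales\<close>

lemma L2_dilate:
  assumes "f \<in> L2 K"
  shows "(\<lambda>x. f (\<pp> powi j * x)) \<in> L2 K"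
proof -
  have "f \<in> borel_measurable borel"
    using L2_measurable[OF assms] by (simp cong: measurable_cong_sets add: sets_haar)
  then have "(\<lambda>x. f (\<pp> powi j * x)) \<in> borel_measurable borel"
    by measurable
  then have "(\<lambda>x. f (\<pp> powi j * x)) \<in> borel_measurable (haar K)"
    by simp
  moreover have "integrable (haar K) (\<lambda>x. (cmod (f (\<pp> powi j * x)))\<^sup>2)"
    by (rule integrable_dilate[OF L2_integrable[OF assms]])
  ultimately show ?thesis
    by (simp add: L2_def)
qed

lemma wavelet_L2:
  assumes "\<psi> \<in> L2 K"
  shows "wavelet K \<psi> j k \<in> L2 K"
  unfolding wavelet_def by (intro L2_scale L2_dilate[where f = "\<lambda>x. \<psi> (x - u k)"] L2_translate assms)

text \<open>
  The unitary dilation that takes the wavelet coefficients at scale \<open>j\<close> to scale 0.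
\<close>

definition dilated :: "int \<Rightarrow> ('a \<Rightarrow> complex) \<Rightarrow> 'a \<Rightarrow> complex"
  where "dilated j f x = of_real (real q powr (- (real_of_int j / 2))) * f (\<pp> powi j * x)"

lemma dilated_L2: "f \<in> L2 K \<Longrightarrow> dilated j f \<in> L2 K"
  unfolding dilated_def by (intro L2_scale L2_dilate)

lemma L2_inner_wavelet:
  assumes "f \<in> L2 K" "\<psi> \<in> L2 K"
  shows "L2_inner K f (wavelet K \<psi> j k) = L2_inner K (dilated j f) (\<lambda>x. \<psi> (x - u k))"
proof -
  define h where "h x = f x * cnj (wavelet K \<psi> j k x)" for x
  have "h \<in> borel_measurable (haar K)"
    unfolding h_def by (intro borel_measurable_integrable L2_integrable_mult assms wavelet_L2)
  then have "(\<integral>x. h x \<partial>haar K) = real q powi (- j) *\<^sub>R (\<integral>x. h (\<pp> powi j * x) \<partial>haar K)"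
    using q_pos by (simp add: integral_dilate[of h j] power_int_minus)
  also have "\<dots> = (\<integral>x. of_real (real q powi (- j)) * h (\<pp> powi j * x) \<partial>haar K)"
    by (simp add: scaleR_conv_of_real)
  also have "\<dots> = (\<integral>x. dilated j f x * cnj (\<psi> (x - u k)) \<partial>haar K)"
  proof -
    have "real q powi (- j) * real q powr (real_of_int j / 2) = real q powr (- (real_of_int j / 2))"
      using q_pos powr_add[of "real q" "real_of_int (- j)" "real_of_int j / 2"]
        powr_real_of_int'[of "real q" "- j"] by simp
    then have "of_real (real q powi (- j)) * of_real (real q powr (real_of_int j / 2)) =
        (of_real (real q powr (- (real_of_int j / 2))) :: complex)"
      by (simp only: of_real_mult[symmetric])
    then have alg: "of_real (real q powi (- j)) * (x * (of_real (real q powr (real_of_int j / 2)) * y)) =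
        of_real (real q powr (- (real_of_int j / 2))) * x * y" for x y :: complex
      by (metis mult.assoc mult.left_commute)
    have "of_real (real q powi (- j)) * h (\<pp> powi j * x) = dilated j f x * cnj (\<psi> (x - u k))" for x
      by (simp only: h_def wavelet_def dilated_def prime_elt_powi_cancel' complex_cnj_mult
          complex_cnj_complex_of_real alg)
    then show ?thesis
      by (simp only:)
  qed
  finally show ?thesis
    by (simp add: L2_inner_def h_def)
qed

text \<open>
  The identity at scale 0, summed over \<open>i\<close> and over all scales. For \<open>t = 0\<close> it says that \<open>\<Psi>\<close> generates a
  Parseval frame; if it holds for all \<open>t\<close>, then the mixed terms in the coefficients of \<open>f\<close> and \<open>g\<close>
  add up to 0.
\<close>

lemma frame_coefficients:
  fixes \<beta> \<gamma> :: "nat \<Rightarrow> 'a \<Rightarrow> complex" and I :: "'i set"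
  assumes frame: "parseval_wavelet_frame K I \<psi>"
    and f: "f \<in> L2 K" and g: "g \<in> L2 K"
    and L2: "\<And>i l. i \<in> I \<Longrightarrow> l < L \<Longrightarrow> \<Psi> (i, l) \<in> L2 K" "\<And>i l. i \<in> I \<Longrightarrow> l < L \<Longrightarrow> \<Phi> (i, l) \<in> L2 K"
    and meas: "\<And>l. l < L \<Longrightarrow> \<beta> l \<in> borel_measurable (haar K)" "\<And>l. l < L \<Longrightarrow> \<gamma> l \<in> borel_measurable (haar K)"
    and per: "\<And>l k \<xi>. l < L \<Longrightarrow> \<beta> l (u k + \<xi>) = \<beta> l \<xi>" "\<And>l k \<xi>. l < L \<Longrightarrow> \<gamma> l (u k + \<xi>) = \<gamma> l \<xi>"
    and \<Psi>: "\<And>i l. i \<in> I \<Longrightarrow> l < L \<Longrightarrow> AE \<xi> in haar K. fourier K (\<Psi> (i, l)) \<xi> = \<beta> l \<xi> * fourier K (\<psi> i) \<xi>"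
    and \<Phi>: "\<And>i l. i \<in> I \<Longrightarrow> l < L \<Longrightarrow> AE \<xi> in haar K. fourier K (\<Phi> (i, l)) \<xi> = \<gamma> l \<xi> * fourier K (\<psi> i) \<xi>"
    and norm: "AE \<xi> in haar K. (\<Sum>l<L. \<beta> l \<xi> * cnj (\<beta> l \<xi>)) = 1"
      "AE \<xi> in haar K. (\<Sum>l<L. \<gamma> l \<xi> * cnj (\<gamma> l \<xi>)) = 1"
    and orth: "t = 0 \<or> (AE \<xi> in haar K. (\<Sum>l<L. cnj (\<beta> l \<xi>) * \<gamma> l \<xi>) = 0)"
  shows "((\<lambda>(i, j, k). (cmod (L2_inner K f (wavelet K (\<Psi> i) j k) + t * L2_inner K g (wavelet K (\<Phi> i) j k)))\<^sup>2)
    has_sum (L2_norm K f)\<^sup>2 + (cmod t)\<^sup>2 * (L2_norm K g)\<^sup>2) ((I \<times> {..<L}) \<times> UNIV \<times> UNIV)"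
proof -
  have fin: "finite I" and \<psi>_L2: "\<And>i. i \<in> I \<Longrightarrow> \<psi> i \<in> L2 K"
    using frame by (auto simp: parseval_wavelet_frame_def wavelet_frame_with_bound_def)
  define e where "e h i j k = ennreal ((cmod (L2_inner K h (wavelet K (\<psi> i) j k)))\<^sup>2)" for h i j k
  define c where "c i l j k = ennreal ((cmod (L2_inner K f (wavelet K (\<Psi> (i, l)) j k) +
    t * L2_inner K g (wavelet K (\<Phi> (i, l)) j k)))\<^sup>2)" for i l j k
  have sum_e: "(\<Sum>i\<in>I. \<integral>\<^sup>+j. (\<Sum>k. e h i j k) \<partial>count_space UNIV) = ennreal ((L2_norm K h)\<^sup>2)"
    if "h \<in> L2 K" for h
  proof -
    have "((\<lambda>(i, j, k). (cmod (L2_inner K h (wavelet K (\<psi> i) j k)))\<^sup>2)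
      has_sum (L2_norm K h)\<^sup>2) (I \<times> UNIV \<times> UNIV)"
      using frame that by (simp add: parseval_wavelet_frame_def wavelet_frame_with_bound_def)
    then have "(\<integral>\<^sup>+p. ennreal ((\<lambda>(i, j, k). (cmod (L2_inner K h (wavelet K (\<psi> i) j k)))\<^sup>2) p)
        \<partial>count_space (I \<times> UNIV \<times> UNIV)) = ennreal ((L2_norm K h)\<^sup>2)"
      by (intro has_sum_iff_nn_integral[THEN iffD1]) (auto split: prod.splits)
    then show ?thesis
      unfolding nn_integral_count_space_scales[OF fin] by (simp add: e_def)
  qed
  have scale: "(\<Sum>l<L. \<Sum>k. c i l j k) = (\<Sum>k. e f i j k) + ennreal ((cmod t)\<^sup>2) * (\<Sum>k. e g i j k)"
    if i: "i \<in> I" for i j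
  proof -
    have "(\<Sum>l<L. \<Sum>k. c i l j k) = (\<Sum>l<L. \<Sum>k. ennreal ((cmod (L2_inner K (dilated j f) (\<lambda>x. \<Psi> (i, l) (x - u k)) +
        t * L2_inner K (dilated j g) (\<lambda>x. \<Phi> (i, l) (x - u k))))\<^sup>2))"
      by (intro sum.cong refl suminf_cong) (simp add: c_def L2_inner_wavelet f g L2 i)
    also have "\<dots> = (\<Sum>k. ennreal ((cmod (L2_inner K (dilated j f) (\<lambda>x. \<psi> i (x - u k))))\<^sup>2)) +
        ennreal ((cmod t)\<^sup>2) * (\<Sum>k. ennreal ((cmod (L2_inner K (dilated j g) (\<lambda>x. \<psi> i (x - u k))))\<^sup>2))"
      by (rule frame_coefficients_at_scale_0[OF dilated_L2[OF f] dilated_L2[OF g] \<psi>_L2[OF i] L2(1)[OF i]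
            L2(2)[OF i] meas per \<Psi>[OF i] \<Phi>[OF i] norm orth])
    finally show ?thesis
      by (simp only: e_def L2_inner_wavelet[OF f \<psi>_L2[OF i]] L2_inner_wavelet[OF g \<psi>_L2[OF i]])
  qed
  have "(\<integral>\<^sup>+p. (\<lambda>((i, l), j, k). c i l j k) p \<partial>count_space ((I \<times> {..<L}) \<times> UNIV \<times> UNIV)) =
      (\<Sum>(i, l)\<in>I \<times> {..<L}. \<integral>\<^sup>+j. (\<Sum>k. c i l j k) \<partial>count_space UNIV)"
    unfolding nn_integral_count_space_scales[OF finite_cartesian_product[OF fin finite_lessThan]]
    by (simp add: case_prod_unfold)
  also have "\<dots> = (\<Sum>i\<in>I. \<integral>\<^sup>+j. (\<Sum>l<L. \<Sum>k. c i l j k) \<partial>count_space UNIV)"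
    by (simp add: sum.cartesian_product[symmetric] nn_integral_sum)
  also have "\<dots> = (\<Sum>i\<in>I. (\<integral>\<^sup>+j. (\<Sum>k. e f i j k) \<partial>count_space UNIV) +
      ennreal ((cmod t)\<^sup>2) * (\<integral>\<^sup>+j. (\<Sum>k. e g i j k) \<partial>count_space UNIV))"
    by (intro sum.cong refl) (simp add: scale nn_integral_add nn_integral_cmult)
  also have "\<dots> = ennreal ((L2_norm K f)\<^sup>2) + ennreal ((cmod t)\<^sup>2) * ennreal ((L2_norm K g)\<^sup>2)"
    by (simp only: sum.distrib sum_distrib_left[symmetric] sum_e f g)
  also have "\<dots> = ennreal ((L2_norm K f)\<^sup>2 + (cmod t)\<^sup>2 * (L2_norm K g)\<^sup>2)"
    by (simp add: ennreal_mult)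
  moreover have "(\<lambda>((i, l), j, k). c i l j k) = (\<lambda>p. ennreal ((\<lambda>(i, j, k). (cmod (L2_inner K f (wavelet K (\<Psi> i) j k) + t * L2_inner K g (wavelet K (\<Phi> i) j k)))\<^sup>2) p))"
    by (simp add: fun_eq_iff c_def)
  ultimately have "(\<integral>\<^sup>+p. ennreal ((\<lambda>(i, j, k). (cmod (L2_inner K f (wavelet K (\<Psi> i) j k) + t * L2_inner K g (wavelet K (\<Phi> i) j k)))\<^sup>2) p)
      \<partial>count_space ((I \<times> {..<L}) \<times> UNIV \<times> UNIV)) = ennreal ((L2_norm K f)\<^sup>2 + (cmod t)\<^sup>2 * (L2_norm K g)\<^sup>2)"
    by (simp only:)
  then show ?thesis
    by (intro has_sum_iff_nn_integral[THEN iffD2]) (auto split: prod.splits)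
qed

section \<open>Vanishing expansions\<close>

text \<open>
  For \<open>g = \<Sum>\<^sub>p\<^sub>\<in>\<^sub>S c\<^sub>p w\<^sub>p\<close> the number \<open>\<parallel>g\<parallel>\<^sup>2 = \<Sum>\<^sub>p\<^sub>\<in>\<^sub>S c\<^sub>p \<langle>w\<^sub>p, g\<rangle>\<close> is, up to the sign, the sum over the
  complement of \<open>S\<close>, which is at most \<open>\<parallel>g\<parallel>\<close> times the \<open>\<ell>\<^sup>2\<close> norm of the tail of \<open>c\<close>.
\<close>

lemma L2_expansion_tendsto_zero:
  fixes w :: "'b \<Rightarrow> 'a \<Rightarrow> complex"
  assumes w: "\<And>p. p \<in> A \<Longrightarrow> w p \<in> L2 K"
    and c: "((\<lambda>p. (cmod (c p))\<^sup>2) has_sum C) A"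
    and bessel: "\<And>g. g \<in> L2 K \<Longrightarrow> ((\<lambda>p. (cmod (L2_inner K g (w p)))\<^sup>2) has_sum (L2_norm K g)\<^sup>2) A"
    and zero: "\<And>g. g \<in> L2 K \<Longrightarrow> ((\<lambda>p. c p * cnj (L2_inner K g (w p))) has_sum 0) A"
  shows "((\<lambda>S. L2_norm K (\<lambda>x. \<Sum>p\<in>S. c p * w p x)) \<longlongrightarrow> 0) (finite_subsets_at_top A)"
proof (rule tendstoI)
  fix e :: real assume e: "e > 0"
  have pos: "(e / 2)\<^sup>2 > 0" and nonneg: "\<And>p. p \<in> A \<Longrightarrow> (cmod (c p))\<^sup>2 \<ge> 0"
    using e by simp_all
  obtain X where X: "finite X" "X \<subseteq> A"
    "\<And>S S'. finite S' \<Longrightarrow> X \<subseteq> S \<Longrightarrow> S \<subseteq> S' \<Longrightarrow> S' \<subseteq> A \<Longrightarrow> (\<Sum>p\<in>S' - S. (cmod (c p))\<^sup>2) \<le> (e / 2)\<^sup>2"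
    by (rule has_sum_tail_small[OF c nonneg pos]) blast+
  have bound: "L2_norm K (\<lambda>x. \<Sum>p\<in>S. c p * w p x) \<le> e / 2" if S: "finite S" "X \<subseteq> S" "S \<subseteq> A" for S
  proof -
    define g where "g x = (\<Sum>p\<in>S. c p * w p x)" for x
    define d where "d p = L2_inner K g (w p)" for p
    have g: "g \<in> L2 K"
      unfolding g_def using S w by (intro L2_sum L2_scale) auto
    have "L2_inner K (\<lambda>x. \<Sum>p\<in>S. c p * w p x) g = (\<Sum>p\<in>S. L2_inner K (\<lambda>x. c p * w p x) g)"
      using S w g by (intro L2_inner_sum_left L2_scale) auto
    also have "\<dots> = (\<Sum>p\<in>S. c p * cnj (d p))"
      by (simp add: L2_inner_scale_left d_def flip: L2_inner_commute)
    finally have "(\<Sum>p\<in>S. c p * cnj (d p)) = L2_inner K g g"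
      by (simp only: g_def[symmetric])
    then have norm_g: "cmod (\<Sum>p\<in>S. c p * cnj (d p)) = (L2_norm K g)\<^sup>2"
      by (simp add: L2_inner_self norm_power)
    have "(L2_norm K g)\<^sup>2 \<le> e / 2 * L2_norm K g + r" if "r > 0" for r
    proof -
      have "\<forall>\<^sub>F S' in finite_subsets_at_top A. dist (\<Sum>p\<in>S'. c p * cnj (d p)) 0 < r"
        using zero[OF g] \<open>r > 0\<close> unfolding has_sum_def d_def by (rule tendstoD)
      then obtain Y where Y: "finite Y" "Y \<subseteq> A"
        "\<forall>S'. finite S' \<and> Y \<subseteq> S' \<and> S' \<subseteq> A \<longrightarrow> dist (\<Sum>p\<in>S'. c p * cnj (d p)) 0 < r"
        unfolding eventually_finite_subsets_at_top by blast
      define S' where "S' = S \<union> Y"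
      have S': "finite S'" "S \<subseteq> S'" "S' \<subseteq> A" "Y \<subseteq> S'"
        using S Y by (auto simp: S'_def)
      have "cmod (\<Sum>p\<in>S'. c p * cnj (d p)) < r"
        using Y(3) S'(1,3,4) by simp
      moreover have "cmod (\<Sum>p\<in>S. c p * cnj (d p)) \<le>
          cmod (\<Sum>p\<in>S'. c p * cnj (d p)) + cmod (\<Sum>p\<in>S' - S. c p * cnj (d p))"
      proof -
        have "(\<Sum>p\<in>S'. c p * cnj (d p)) = (\<Sum>p\<in>S' - S. c p * cnj (d p)) + (\<Sum>p\<in>S. c p * cnj (d p))"
          by (rule sum.subset_diff[OF S'(2,1)])
        then have eq: "(\<Sum>p\<in>S. c p * cnj (d p)) = (\<Sum>p\<in>S'. c p * cnj (d p)) - (\<Sum>p\<in>S' - S. c p * cnj (d p))"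
          by (simp only: add_diff_cancel_left')
        show ?thesis
          unfolding eq by (rule norm_triangle_ineq4)
      qed
      ultimately have "cmod (\<Sum>p\<in>S. c p * cnj (d p)) \<le> cmod (\<Sum>p\<in>S' - S. c p * cnj (d p)) + r"
        by linarith
      also have "cmod (\<Sum>p\<in>S' - S. c p * cnj (d p)) \<le> (\<Sum>p\<in>S' - S. \<bar>cmod (c p)\<bar> * \<bar>cmod (d p)\<bar>)"
        by (rule order_trans[OF norm_sum]) (simp add: norm_mult)
      also have "\<dots> \<le> L2_set (\<lambda>p. cmod (c p)) (S' - S) * L2_set (\<lambda>p. cmod (d p)) (S' - S)"
        by (rule L2_set_mult_ineq)
      also have "\<dots> \<le> e / 2 * L2_norm K g"
      proof (intro mult_mono)
        show "L2_set (\<lambda>p. cmod (c p)) (S' - S) \<le> e / 2"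
          unfolding L2_set_def by (rule real_le_lsqrt) (use X(3)[OF S'(1) S(2) S'(2,3)] e in simp_all)
        have "(\<Sum>p\<in>S' - S. (cmod (d p))\<^sup>2) \<le> (L2_norm K g)\<^sup>2"
          unfolding d_def by (rule finite_sum_le_has_sum[OF bessel[OF g]]) (use S' in auto)
        then show "L2_set (\<lambda>p. cmod (d p)) (S' - S) \<le> L2_norm K g"
          unfolding L2_set_def by (intro real_le_lsqrt) simp_all
      qed (use e in \<open>auto simp: L2_set_nonneg\<close>)
      finally show ?thesis
        by (simp add: norm_g)
    qed
    then have "L2_norm K g * L2_norm K g \<le> e / 2 * L2_norm K g"
      unfolding power2_eq_square by (rule field_le_epsilon)
    moreover have "L2_norm K g \<le> e / 2" if "x * x \<le> e / 2 * x" "x \<ge> 0" "x = L2_norm K g" for x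
      using that e by (cases "x = 0") (auto simp: mult_le_cancel_right)
    ultimately have "L2_norm K g \<le> e / 2"
      using L2_norm_nonneg[of g] by blast
    then show ?thesis
      by (simp only: g_def[abs_def])
  qed
  show "\<forall>\<^sub>F S in finite_subsets_at_top A. dist (L2_norm K (\<lambda>x. \<Sum>p\<in>S. c p * w p x)) 0 < e"
    unfolding eventually_finite_subsets_at_top
  proof (intro exI[of _ X] conjI allI impI X(1,2))
    fix S assume "finite S \<and> X \<subseteq> S \<and> S \<subseteq> A"
    then show "dist (L2_norm K (\<lambda>x. \<Sum>p\<in>S. c p * w p x)) 0 < e"
      using bound[of S] e by simp
  qed
qed

end

section \<open>Tight frames and orthogonality\<close>

theorem theorem3p6:
  fixes K :: "('a :: {field, metric_space}) local_field"
    and \<phi> :: "'a \<Rightarrow> complex"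
    and m :: "nat \<Rightarrow> 'a \<Rightarrow> complex"
    and \<psi> :: "nat \<Rightarrow> 'a \<Rightarrow> complex"
    and A :: "'a \<Rightarrow> complex mat"
    and \<eta> :: "nat \<Rightarrow> nat \<times> nat \<Rightarrow> 'a \<Rightarrow> complex"
    and \<Psi> :: "nat \<Rightarrow> nat \<times> nat \<Rightarrow> 'a \<Rightarrow> complex"
    and N L :: nat
  assumes "char_p_local_field K"
    and "\<phi> \<in> L2 K"
    and "generates_MRA K \<phi>"
    and "\<And>n. n \<le> N \<Longrightarrow> walsh_polynomial K (m n)"
    and "AE \<xi> in haar K. fourier K \<phi> \<xi> = m 0 (prime_elt K * \<xi>) * fourier K \<phi> (prime_elt K * \<xi>)"
    and "\<And>n. n \<in> {1..N} \<Longrightarrow> \<psi> n \<in> L2 K"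
    and "\<And>n. n \<in> {1..N} \<Longrightarrow> AE \<xi> in haar K.
      fourier K (\<psi> n) \<xi> = m n (prime_elt K * \<xi>) * fourier K \<phi> (prime_elt K * \<xi>)"
    and "\<And>k \<xi>. k \<in> {1..residue_card K - 1} \<Longrightarrow>
      mat_adjoint (mask_matrix K N m k \<xi>) * mask_matrix K N m k \<xi> = 1\<^sub>m 2"
    and "parseval_wavelet_frame K {1..N} \<psi>"
    and "paraunitary K L A"
    and "\<And>l r. l < L \<Longrightarrow> r < L \<Longrightarrow> integral_periodic K (\<lambda>\<xi>. A \<xi> $$ (l, r))"
    and "\<And>r n l \<xi>. r < L \<Longrightarrow> n \<in> {1..N} \<Longrightarrow> l < L \<Longrightarrow>
      \<eta> r (n, l) \<xi> = A \<xi> $$ (l, r) * m n \<xi>"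
    and "\<And>r n l. r < L \<Longrightarrow> n \<in> {1..N} \<Longrightarrow> l < L \<Longrightarrow> \<Psi> r (n, l) \<in> L2 K"
    and "\<And>r n l. r < L \<Longrightarrow> n \<in> {1..N} \<Longrightarrow> l < L \<Longrightarrow> AE \<xi> in haar K.
      fourier K (\<Psi> r (n, l)) (inverse (prime_elt K) * \<xi>) = \<eta> r (n, l) \<xi> * fourier K \<phi> \<xi>"
  shows "(\<forall>r<L. tight_wavelet_frame K ({1..N} \<times> {..<L}) (\<Psi> r)) \<and>
    (\<forall>r<L. \<forall>s<L. r \<noteq> s \<longrightarrow>
      orthogonal_wavelet_systems K ({1..N} \<times> {..<L}) (\<Psi> r) (\<Psi> s))"
proof -
  interpret char_p_local_field K
    by fact
  \<comment> \<open>With this argument, \<open>b r l\<close> is the quotient of the Fourier transforms of \<open>\<Psi> r (n, l)\<close> and \<open>\<psi> n\<close>, and it has the periods \<open>u k\<close>.\<close>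
  define b where "b r l \<xi> = A (\<pp> * \<xi>) $$ (l, r)" for r l \<xi>
  note L2 = assms(13)
  \<comment> \<open>The masks are given at \<open>\<xi>\<close> and the Fourier transforms at \<open>\<pp>\<^sup>-\<^sup>1\<xi>\<close>; substituting \<open>\<pp>\<xi>\<close> is harmless, as dilations preserve null sets.\<close>
  have dil: "AE \<xi> in haar K. P (\<pp> * \<xi>)" if "AE \<xi> in haar K. P \<xi>" for P
    using AE_dilate[OF that, of 1] by simp
  have meas: "b r l \<in> borel_measurable (haar K)" if "l < L" "r < L" for l r
  proof -
    have "(\<lambda>\<xi>. A \<xi> $$ (l, r)) \<in> borel_measurable borel"
      using assms(10) that unfolding paraunitary_def by (simp cong: measurable_cong_sets add: sets_haar)
    then have "b r l \<in> borel_measurable borel"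
      unfolding b_def by measurable
    then show ?thesis
      by simp
  qed
  have per: "b r l (u k + \<xi>) = b r l \<xi>" if "l < L" "r < L" for l r k \<xi>
    using assms(11)[OF that] unfolding integral_periodic_def b_def
    by (simp add: ring_distribs add.commute)
  have hat: "AE \<xi> in haar K. fourier K (\<Psi> r (n, l)) \<xi> = b r l \<xi> * fourier K (\<psi> n) \<xi>"
    if "n \<in> {1..N}" "l < L" "r < L" for n l r
    using dil[OF assms(14)[OF that(3,1,2)]] assms(7)[OF that(1)]
    by eventually_elim (simp add: b_def assms(12)[OF that(3,1,2)] mult.assoc[symmetric])
  have entry: "AE \<xi> in haar K. (\<Sum>l<L. cnj (b r l \<xi>) * b s l \<xi>) = (if r = s then 1 else 0)"
    if "r < L" "s < L" for r s
  proof -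
    have "AE \<xi> in haar K. mat_adjoint (A \<xi>) * A \<xi> = 1\<^sub>m L"
      using assms(10) by (simp add: paraunitary_def)
    from dil[OF this] show ?thesis
    proof eventually_elim
      case (elim \<xi>)
      have "A (\<pp> * \<xi>) \<in> carrier_mat L L"
        using assms(10) by (simp add: paraunitary_def)
      then show ?case
        using mat_adjoint_mult_index[of "A (\<pp> * \<xi>)" L r s] elim that by (simp add: b_def)
    qed
  qed
  then have norm: "AE \<xi> in haar K. (\<Sum>l<L. b r l \<xi> * cnj (b r l \<xi>)) = 1" if "r < L" for r
    using entry[OF that that] by (simp add: mult.commute)
  have coeff: "((\<lambda>(i, j, k). (cmod (L2_inner K f (wavelet K (\<Psi> r i) j k) + t * L2_inner K g (wavelet K (\<Psi> s i) j k)))\<^sup>2)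
      has_sum (L2_norm K f)\<^sup>2 + (cmod t)\<^sup>2 * (L2_norm K g)\<^sup>2) (({1..N} \<times> {..<L}) \<times> UNIV \<times> UNIV)"
    if "f \<in> L2 K" "g \<in> L2 K" "r < L" "s < L" "t = 0 \<or> r \<noteq> s" for f g r s t
  proof (rule frame_coefficients[OF assms(9) that(1,2), where \<beta> = "b r" and \<gamma> = "b s"])
    show "t = 0 \<or> (AE \<xi> in haar K. (\<Sum>l<L. cnj (b r l \<xi>) * b s l \<xi>) = 0)"
      using that(5) entry[OF that(3,4)] by auto
  qed (use that L2 meas per hat norm in auto)
  have parseval: "((\<lambda>(i, j, k). (cmod (L2_inner K f (wavelet K (\<Psi> r i) j k)))\<^sup>2)
      has_sum (L2_norm K f)\<^sup>2) (({1..N} \<times> {..<L}) \<times> UNIV \<times> UNIV)" if "f \<in> L2 K" "r < L" for f r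
    using coeff[OF that(1) L2_zero that(2) that(2), of 0] by simp
  show ?thesis
  proof (intro conjI allI impI)
    fix r assume "r < L"
    then have "wavelet_frame_with_bound K ({1..N} \<times> {..<L}) (\<Psi> r) 1"
      unfolding wavelet_frame_with_bound_def using parseval L2 by auto
    then show "tight_wavelet_frame K ({1..N} \<times> {..<L}) (\<Psi> r)"
      unfolding tight_wavelet_frame_def by (intro exI[of _ 1]) simp
  next
    fix r s assume rs: "r < L" "s < L" "r \<noteq> s"
    let ?A = "({1..N} \<times> {..<L}) \<times> (UNIV :: int set) \<times> (UNIV :: nat set)"
    show "orthogonal_wavelet_systems K ({1..N} \<times> {..<L}) (\<Psi> r) (\<Psi> s)"
      unfolding orthogonal_wavelet_systems_def
    proof
      fix f assume f: "f \<in> L2 K"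
      define c where "c = (\<lambda>(i, j, k). L2_inner K f (wavelet K (\<Psi> r i) j k))"
      define w where "w = (\<lambda>(i, j, k). wavelet K (\<Psi> s i) j k)"
      have "((\<lambda>S. L2_norm K (\<lambda>x. \<Sum>p\<in>S. c p * w p x)) \<longlongrightarrow> 0) (finite_subsets_at_top ?A)"
      proof (rule L2_expansion_tendsto_zero)
        show "w p \<in> L2 K" if "p \<in> ?A" for p
          using that L2 rs by (auto simp: w_def intro!: wavelet_L2)
        show "((\<lambda>p. (cmod (c p))\<^sup>2) has_sum (L2_norm K f)\<^sup>2) ?A"
          using parseval[OF f rs(1)] by (simp add: c_def case_prod_unfold)
        show "((\<lambda>p. (cmod (L2_inner K g (w p)))\<^sup>2) has_sum (L2_norm K g)\<^sup>2) ?A" if "g \<in> L2 K" for g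
          using parseval[OF that rs(2)] by (simp add: w_def case_prod_unfold)
        show "((\<lambda>p. c p * cnj (L2_inner K g (w p))) has_sum 0) ?A" if "g \<in> L2 K" for g
        proof (rule has_sum_cross_terms_zero)
          show "((\<lambda>p. (cmod (c p + t * L2_inner K g (w p)))\<^sup>2) has_sum
              (L2_norm K f)\<^sup>2 + (cmod t)\<^sup>2 * (L2_norm K g)\<^sup>2) ?A" for t
            using coeff[OF f that rs(1,2), of t] rs(3) by (simp add: c_def w_def case_prod_unfold)
        qed
      qed
      then show "((\<lambda>S. L2_norm K (\<lambda>x. \<Sum>(i, j, k)\<in>S.
          L2_inner K f (wavelet K (\<Psi> r i) j k) * wavelet K (\<Psi> s i) j k x)) \<longlongrightarrow> 0)
        (finite_subsets_at_top ?A)"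
        by (simp add: c_def w_def case_prod_unfold)
    qed
  qed
qed

end
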